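(* Let $H=-\Delta+V$ be a Schrödinger operator on $L^2(\mathbb{R}^n)$, where $V$ is real-valued and bounded below, $\inf_{x\in\mathbb{R}^n}V(x)>-\infty$, and $V$ is relatively $(-\Delta)$-bounded with relative bound strictly less than one, i.e. $$\lim_{\lambda\to+\infty}\big\|V(-\Delta+\lambda)^{-1}\big\|<1;$$ in particular, $H$ is self-adjoint on the domain $H^2(\mathbb{R}^n)$. Suppose that for some $E_0\in\mathbb{R}$ there exists $\delta>0$ such that the set $$A_{E_0;\delta}:=\{x\in\mathbb{R}^n: V(x)\le E_0+\delta\}$$ has finite Lebesgue measure. Then $$\sigma_{\mathrm{ess}}(H)\subseteq[E_0+\delta,+\infty).$$
   Context: $-\Delta$ is the self-adjoint Laplacian on $L^2(\mathbb{R}^n)$ with domain $H^2(\mathbb{R}^n)$; $V$ is a (Lebesgue measurable) function acting as a multiplication operator with domain $D(V)=\{f\in L^2(\mathbb{R}^n): Vf\in L^2(\mathbb{R}^n)\}$; $\|\cdot\|$ is the operator norm on $L^2(\mathbb{R}^n)$; $\sigma_{\mathrm{ess}}(H)$ is the essential spectrum of the self-adjoint operator $H$. *)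

theory Defs
  imports "HOL-Analysis.Analysis"
begin

section \<open>The complex Hilbert space of square-integrable functions\<close>

definition square_integrable :: "('a::euclidean_space \<Rightarrow> complex) \<Rightarrow> bool" where
  "square_integrable f \<longleftrightarrow>
     f \<in> borel_measurable lebesgue \<and> integrable lebesgue (\<lambda>x. (cmod (f x))\<^sup>2)"

definition L2_eq :: "('a::euclidean_space \<Rightarrow> complex) \<Rightarrow> ('a \<Rightarrow> complex) \<Rightarrow> bool" where
  "L2_eq f g \<longleftrightarrow>
     square_integrable f \<and> square_integrable g \<and> (AE x in lebesgue. f x = g x)"

lemma square_integrable_zero: "square_integrable (\<lambda>x. 0)"
  by (simp add: square_integrable_def)

lemma square_integrable_mult:
  assumes "square_integrable f" shows "square_integrable (\<lambda>x. c * f x)"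
  using assms by (auto simp: square_integrable_def norm_mult power_mult_distrib)

lemma square_integrable_add:
  assumes "square_integrable f" "square_integrable g"
  shows "square_integrable (\<lambda>x. f x + g x)"
proof -
  have f: "f \<in> borel_measurable lebesgue" "integrable lebesgue (\<lambda>x. (cmod (f x))\<^sup>2)"
    and g: "g \<in> borel_measurable lebesgue" "integrable lebesgue (\<lambda>x. (cmod (g x))\<^sup>2)"
    using assms unfolding square_integrable_def by blast+
  have m: "(\<lambda>x. f x + g x) \<in> borel_measurable lebesgue"
    using f(1) g(1) by (rule borel_measurable_add)
  have le: "(cmod (f x + g x))\<^sup>2 \<le> 2 * (cmod (f x))\<^sup>2 + 2 * (cmod (g x))\<^sup>2" for x
  proof -
    have "(cmod (f x + g x))\<^sup>2 \<le> (cmod (f x) + cmod (g x))\<^sup>2"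
      by (intro power_mono norm_triangle_ineq norm_ge_zero)
    also have "\<dots> = (cmod (f x))\<^sup>2 + (cmod (g x))\<^sup>2 + 2 * cmod (f x) * cmod (g x)"
      by (rule power2_sum)
    finally show ?thesis
      using sum_squares_bound[of "cmod (f x)" "cmod (g x)"] by linarith
  qed
  have "integrable lebesgue (\<lambda>x. (cmod (f x + g x))\<^sup>2)"
  proof (rule Bochner_Integration.integrable_bound)
    show "integrable lebesgue (\<lambda>x. 2 * (cmod (f x))\<^sup>2 + 2 * (cmod (g x))\<^sup>2)"
      by (intro Bochner_Integration.integrable_add integrable_mult_right f(2) g(2))
    show "(\<lambda>x. (cmod (f x + g x))\<^sup>2) \<in> borel_measurable lebesgue"
      using m by measurable
    show "AE x in lebesgue. norm ((cmod (f x + g x))\<^sup>2) \<le> norm (2 * (cmod (f x))\<^sup>2 + 2 * (cmod (g x))\<^sup>2)"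
      by (rule AE_I2) (use le in \<open>simp only: real_norm_def abs_of_nonneg zero_le_power2
        add_nonneg_nonneg mult_nonneg_nonneg zero_le_numeral\<close>)
  qed
  with m show ?thesis unfolding square_integrable_def by blast
qed

lemma integrable_inner_L2:
  assumes "square_integrable f" "square_integrable g"
  shows "integrable lebesgue (\<lambda>x. f x \<bullet> g x)"
proof (rule Bochner_Integration.integrable_bound[of lebesgue "\<lambda>x. (cmod (f x))\<^sup>2 + (cmod (g x))\<^sup>2"])
  show "integrable lebesgue (\<lambda>x. (cmod (f x))\<^sup>2 + (cmod (g x))\<^sup>2)"
    using assms by (auto simp: square_integrable_def)
  have [measurable]: "f \<in> borel_measurable lebesgue" "g \<in> borel_measurable lebesgue"
    using assms by (auto simp: square_integrable_def)
  show "(\<lambda>x. f x \<bullet> g x) \<in> borel_measurable lebesgue"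
    by measurable
  have "norm (f x \<bullet> g x) \<le> norm ((cmod (f x))\<^sup>2 + (cmod (g x))\<^sup>2)" for x
  proof -
    have "\<bar>f x \<bullet> g x\<bar> \<le> cmod (f x) * cmod (g x)" by (rule Cauchy_Schwarz_ineq2)
    also have "\<dots> \<le> 2 * cmod (f x) * cmod (g x)" by simp
    also have "\<dots> \<le> (cmod (f x))\<^sup>2 + (cmod (g x))\<^sup>2" by (rule sum_squares_bound)
    finally show ?thesis by simp
  qed
  then show "AE x in lebesgue. norm (f x \<bullet> g x) \<le> norm ((cmod (f x))\<^sup>2 + (cmod (g x))\<^sup>2)"
    by simp
qed

quotient_type (overloaded) 'a L2 = "'a::euclidean_space \<Rightarrow> complex" / partial: L2_eq
proof (rule part_equivpI)
  show "\<exists>f :: 'a \<Rightarrow> complex. L2_eq f f"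
    using square_integrable_zero by (auto simp: L2_eq_def)
  show "symp (L2_eq :: ('a \<Rightarrow> complex) \<Rightarrow> _)"
    by (auto simp: symp_def L2_eq_def eq_commute)
  show "transp (L2_eq :: ('a \<Rightarrow> complex) \<Rightarrow> _)"
    unfolding transp_def L2_eq_def
  proof (intro allI impI conjI)
    fix f g h :: "'a \<Rightarrow> complex"
    assume a: "square_integrable f \<and> square_integrable g \<and> (AE x in lebesgue. f x = g x)"
      and b: "square_integrable g \<and> square_integrable h \<and> (AE x in lebesgue. g x = h x)"
    from a have "AE x in lebesgue. f x = g x" by blast
    moreover from b have "AE x in lebesgue. g x = h x" by blast
    ultimately show "AE x in lebesgue. f x = h x" by eventually_elim simp
  qed auto
qed

text \<open>Complex scalar multiplication; the real one in the class instance is its restriction.\<close>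

lift_definition cscale :: "complex \<Rightarrow> 'a::euclidean_space L2 \<Rightarrow> 'a L2" (infixr \<open>*\<^sub>C\<close> 75)
  is "\<lambda>c f x. c * f x"
  by (auto simp: L2_eq_def square_integrable_mult)

instantiation L2 :: (euclidean_space) real_vector
begin

lift_definition zero_L2 :: "'a L2" is "\<lambda>x. 0"
  by (simp add: L2_eq_def square_integrable_zero)

lift_definition plus_L2 :: "'a L2 \<Rightarrow> 'a L2 \<Rightarrow> 'a L2" is "\<lambda>f g x. f x + g x"
  by (auto simp: L2_eq_def square_integrable_add)

definition uminus_L2 :: "'a L2 \<Rightarrow> 'a L2" where "- u = (- 1) *\<^sub>C u"

definition minus_L2 :: "'a L2 \<Rightarrow> 'a L2 \<Rightarrow> 'a L2" where "u - v = u + - (v :: 'a L2)"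

definition scaleR_L2 :: "real \<Rightarrow> 'a L2 \<Rightarrow> 'a L2" where "r *\<^sub>R u = complex_of_real r *\<^sub>C u"

instance
proof
  fix u v w :: "'a L2" and a b :: real
  show "u + v + w = u + (v + w)"
    by transfer (auto simp: L2_eq_def square_integrable_add add.assoc)
  show "u + v = v + u"
    by transfer (auto simp: L2_eq_def square_integrable_add add.commute)
  show "0 + u = u"
    by transfer (auto simp: L2_eq_def)
  show "- u + u = 0"
    unfolding uminus_L2_def
    by transfer (auto simp: L2_eq_def square_integrable_add square_integrable_zero)
  show "u - v = u + - v"
    by (simp add: minus_L2_def)
  show "a *\<^sub>R (u + v) = a *\<^sub>R u + a *\<^sub>R v"
    unfolding scaleR_L2_def
    by transfer (auto simp: L2_eq_def distrib_left
        intro!: square_integrable_add square_integrable_mult)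
  show "(a + b) *\<^sub>R u = a *\<^sub>R u + b *\<^sub>R u"
    unfolding scaleR_L2_def
    by transfer (auto simp: L2_eq_def distrib_right
        intro!: square_integrable_add square_integrable_mult)
  show "a *\<^sub>R b *\<^sub>R u = (a * b) *\<^sub>R u"
    unfolding scaleR_L2_def
    by transfer (auto simp: L2_eq_def square_integrable_mult mult.assoc)
  show "1 *\<^sub>R u = u"
    unfolding scaleR_L2_def by transfer (auto simp: L2_eq_def)
qed

end

text \<open>The inner product of the class \<open>real_inner\<close> is the real part of the complex one, so that
  the norm is the usual one.\<close>

instantiation L2 :: (euclidean_space) real_inner
begin

lift_definition inner_L2 :: "'a L2 \<Rightarrow> 'a L2 \<Rightarrow> real"
  is "\<lambda>f g. \<integral>x. f x \<bullet> g x \<partial>lebesgue"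
proof -
  fix f f' g g' :: "'a \<Rightarrow> complex"
  assume a: "L2_eq f f'" and b: "L2_eq g g'"
  have [measurable]: "f \<in> borel_measurable lebesgue" "g \<in> borel_measurable lebesgue"
      "f' \<in> borel_measurable lebesgue" "g' \<in> borel_measurable lebesgue"
    using a b by (auto simp: L2_eq_def square_integrable_def)
  have "AE x in lebesgue. f x = f' x" "AE x in lebesgue. g x = g' x"
    using a b by (auto simp: L2_eq_def)
  then have "AE x in lebesgue. f x \<bullet> g x = f' x \<bullet> g' x"
    by eventually_elim simp
  then show "(\<integral>x. f x \<bullet> g x \<partial>lebesgue) = (\<integral>x. f' x \<bullet> g' x \<partial>lebesgue)"
    by (intro integral_cong_AE) measurable
qed

definition norm_L2 :: "'a L2 \<Rightarrow> real" where "norm u = sqrt (u \<bullet> (u :: 'a L2))"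

definition sgn_L2 :: "'a L2 \<Rightarrow> 'a L2" where "sgn u = u /\<^sub>R norm (u :: 'a L2)"

definition dist_L2 :: "'a L2 \<Rightarrow> 'a L2 \<Rightarrow> real" where "dist u v = norm (u - v :: 'a L2)"

definition uniformity_L2 :: "('a L2 \<times> 'a L2) filter" where
  "uniformity_L2 = (INF e\<in>{0<..}. principal {(x, y). dist x y < e})"

definition open_L2 :: "'a L2 set \<Rightarrow> bool" where
  "open_L2 U = (\<forall>x\<in>U. eventually (\<lambda>(x', y). x' = x \<longrightarrow> y \<in> U) uniformity)"

instance
proof
  fix u v w :: "'a L2" and r :: real
  show "sgn u = u /\<^sub>R norm u"
    by (simp add: sgn_L2_def)
  show "dist u v = norm (u - v)"
    by (simp add: dist_L2_def)
  show "(uniformity :: ('a L2 \<times> 'a L2) filter) = (INF e\<in>{0<..}. principal {(x, y). dist x y < e})"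
    by (rule uniformity_L2_def)
  show "open U = (\<forall>x\<in>U. eventually (\<lambda>(x', y). x' = x \<longrightarrow> y \<in> U) uniformity)" for U :: "'a L2 set"
    by (rule open_L2_def)
  show "u \<bullet> v = v \<bullet> u"
    by transfer (simp add: inner_commute)
  show "(u + v) \<bullet> w = u \<bullet> w + v \<bullet> w"
    by transfer (simp add: L2_eq_def inner_add_left integrable_inner_L2)
  show "(r *\<^sub>R u) \<bullet> v = r * (u \<bullet> v)"
    unfolding scaleR_L2_def
    by transfer (simp flip: scaleR_conv_of_real)
  show "0 \<le> u \<bullet> u"
    by transfer simp
  show "u \<bullet> u = 0 \<longleftrightarrow> u = 0"
  proof transfer
    fix f :: "'a \<Rightarrow> complex"
    assume "L2_eq f f"
    then have f: "square_integrable f" by (simp add: L2_eq_def)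
    have "(\<integral>x. f x \<bullet> f x \<partial>lebesgue) = 0 \<longleftrightarrow> (AE x in lebesgue. f x \<bullet> f x = 0)"
      using integrable_inner_L2[OF f f] by (intro integral_nonneg_eq_0_iff_AE) auto
    then show "(\<integral>x. f x \<bullet> f x \<partial>lebesgue) = 0 \<longleftrightarrow> L2_eq f (\<lambda>x. 0)"
      using f by (simp add: L2_eq_def square_integrable_zero)
  qed
  show "norm u = sqrt (u \<bullet> u)"
    by (simp add: norm_L2_def)
qed

end

interpretation L2: vector_space "cscale :: complex \<Rightarrow> 'a::euclidean_space L2 \<Rightarrow> 'a L2"
proof
  fix a b :: complex and u v :: "'a L2"
  show "a *\<^sub>C (u + v) = a *\<^sub>C u + a *\<^sub>C v"
    by transfer (auto simp: L2_eq_def distrib_left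
        intro!: square_integrable_add square_integrable_mult)
  show "(a + b) *\<^sub>C u = a *\<^sub>C u + b *\<^sub>C u"
    by transfer (auto simp: L2_eq_def distrib_right
        intro!: square_integrable_add square_integrable_mult)
  show "a *\<^sub>C b *\<^sub>C u = (a * b) *\<^sub>C u"
    by transfer (auto simp: L2_eq_def square_integrable_mult mult.assoc)
  show "1 *\<^sub>C u = u"
    by transfer (auto simp: L2_eq_def)
qed

lemma norm_L2_eq: "norm u = sqrt (\<integral>x. (cmod (rep_L2 u x))\<^sup>2 \<partial>lebesgue)"
proof -
  have "abs_L2 (rep_L2 u) = u" "L2_eq (rep_L2 u) (rep_L2 u)"
    using Quotient_L2 by (auto simp: Quotient_def)
  then have "u \<bullet> u = (\<integral>x. rep_L2 u x \<bullet> rep_L2 u x \<partial>lebesgue)"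
    by (metis inner_L2.abs_eq)
  then show ?thesis
    by (simp add: norm_L2_def power2_norm_eq_inner)
qed


section \<open>Weak derivatives, the Sobolev spaces, and the Laplacian\<close>

fun C_k :: "nat \<Rightarrow> ('a::euclidean_space \<Rightarrow> real) \<Rightarrow> bool" where
  "C_k 0 \<phi> \<longleftrightarrow> continuous_on UNIV \<phi>"
| "C_k (Suc k) \<phi> \<longleftrightarrow> (\<forall>x. \<phi> differentiable (at x)) \<and>
     (\<forall>b\<in>Basis. C_k k (\<lambda>x. frechet_derivative \<phi> (at x) b))"

definition test_function :: "('a::euclidean_space \<Rightarrow> real) \<Rightarrow> bool" where
  "test_function \<phi> \<longleftrightarrow> (\<forall>k. C_k k \<phi>) \<and> compact (closure {x. \<phi> x \<noteq> 0})"

definition has_weak_deriv :: "'a::euclidean_space \<Rightarrow> 'a L2 \<Rightarrow> 'a L2 \<Rightarrow> bool" where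
  "has_weak_deriv b u v \<longleftrightarrow> (\<forall>\<phi>. test_function \<phi> \<longrightarrow>
     (\<integral>x. frechet_derivative \<phi> (at x) b *\<^sub>R rep_L2 u x \<partial>lebesgue) =
     - (\<integral>x. \<phi> x *\<^sub>R rep_L2 v x \<partial>lebesgue))"

definition weak_deriv :: "'a::euclidean_space \<Rightarrow> 'a L2 \<Rightarrow> 'a L2" where
  "weak_deriv b u = (THE v. has_weak_deriv b u v)"

definition H1 :: "'a::euclidean_space L2 set" where
  "H1 = {u. \<forall>b\<in>Basis. \<exists>v. has_weak_deriv b u v}"

definition H2 :: "'a::euclidean_space L2 set" where
  "H2 = {u \<in> H1. \<forall>b\<in>Basis. weak_deriv b u \<in> H1}"

definition laplacian :: "'a::euclidean_space L2 \<Rightarrow> 'a L2" where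
  "laplacian u = (\<Sum>b\<in>Basis. weak_deriv b (weak_deriv b u))"


section \<open>Unbounded operators and their spectra\<close>

text \<open>The values of \<open>app A\<close> outside \<open>dom A\<close> are irrelevant. The notions below are meant for
  operators that are linear over the complex numbers.\<close>

datatype 'h operator = Operator (dom: "'h set") (app: "'h \<Rightarrow> 'h")

definition op_add :: "'a::euclidean_space L2 operator \<Rightarrow> 'a L2 operator \<Rightarrow> 'a L2 operator" where
  "op_add A B = Operator (dom A \<inter> dom B) (\<lambda>u. app A u + app B u)"

text \<open>\<open>resolvent A z\<close> is the inverse of \<open>A - z\<close>; it is meaningful if \<open>A - z\<close> maps \<open>dom A\<close>
  bijectively onto the whole space.\<close>

definition resolvent :: "'a::euclidean_space L2 operator \<Rightarrow> complex \<Rightarrow> 'a L2 \<Rightarrow> 'a L2" where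
  "resolvent A z = inv_into (dom A) (\<lambda>u. app A u - z *\<^sub>C u)"

definition resolvent_set :: "'a::euclidean_space L2 operator \<Rightarrow> complex set" where
  "resolvent_set A = {z. bij_betw (\<lambda>u. app A u - z *\<^sub>C u) (dom A) UNIV \<and>
                         bounded_linear (resolvent A z)}"

definition spectrum :: "'a::euclidean_space L2 operator \<Rightarrow> complex set" where
  "spectrum A = - resolvent_set A"

definition eigenspace :: "'a::euclidean_space L2 operator \<Rightarrow> complex \<Rightarrow> 'a L2 set" where
  "eigenspace A z = {u \<in> dom A. app A u = z *\<^sub>C u}"

text \<open>Isolated points of the spectrum that are eigenvalues of finite multiplicity. The geometric
  multiplicity is used; for self-adjoint operators it coincides with the algebraic one.\<close>

definition discrete_spectrum :: "'a::euclidean_space L2 operator \<Rightarrow> complex set" where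
  "discrete_spectrum A = {z. z isolated_in spectrum A \<and> eigenspace A z \<noteq> {0} \<and>
                             (\<exists>B. finite B \<and> eigenspace A z \<subseteq> L2.span B)}"

definition ess_spectrum :: "'a::euclidean_space L2 operator \<Rightarrow> complex set" where
  "ess_spectrum A = spectrum A - discrete_spectrum A"

definition relatively_bounded :: "'a::euclidean_space L2 operator \<Rightarrow> 'a L2 operator \<Rightarrow> bool" where
  "relatively_bounded A B \<longleftrightarrow> dom A \<subseteq> dom B \<and>
     (\<exists>a\<ge>0. \<exists>b\<ge>0. \<forall>u\<in>dom A. norm (app B u) \<le> a * norm (app A u) + b * norm u)"


section \<open>Schroedinger operators\<close>

definition neg_laplacian :: "'a::euclidean_space L2 operator" where
  "neg_laplacian = Operator H2 (\<lambda>u. - laplacian u)"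

definition mult_op :: "('a::euclidean_space \<Rightarrow> real) \<Rightarrow> 'a L2 operator" where
  "mult_op V = Operator {u. square_integrable (\<lambda>x. of_real (V x) * rep_L2 u x)}
                        (\<lambda>u. abs_L2 (\<lambda>x. of_real (V x) * rep_L2 u x))"

text \<open>The domain is \<open>H2 \<inter> dom (mult_op V)\<close>, which is \<open>H2\<close> as soon as
  \<open>mult_op V\<close> is bounded relative to the Laplacian.\<close>

definition schroedinger :: "('a::euclidean_space \<Rightarrow> real) \<Rightarrow> 'a L2 operator" where
  "schroedinger V = op_add neg_laplacian (mult_op V)"

end

theory Submission
  imports Defs
begin

text \<open>
  Weak derivatives are identified with the generators of the translation groups on \<open>L\<^sup>2\<close>; this makes
  them closed and skew, and \<open>-\<Delta> + t\<close> is onto \<open>L\<^sup>2\<close> because its range on test functions is dense (by a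
  maximum principle). The Neumann series (Kato--Rellich) transfers surjectivity to \<open>H + t\<close>, so \<open>H\<close> is
  self-adjoint. Write \<open>c = E\<^sub>0 + \<delta>\<close> and \<open>A = {V \<le> c}\<close>. As \<open>V \<ge> c\<close> outside \<open>A\<close> and \<open>V\<close> is bounded below, the
  form of \<open>H\<close> is at least \<open>c \<parallel>u\<parallel>\<^sup>2 + \<parallel>\<nabla>u\<parallel>\<^sup>2 - G \<parallel>1\<^sub>A u\<parallel>\<^sup>2\<close>, and since \<open>A\<close> has finite measure the last
  term is, up to a small multiple of the \<open>H\<^sup>1\<close> norm, controlled by finitely many linear functionals.
  Hence for every \<open>c' < c\<close> the form is bounded below by \<open>c' \<parallel>u\<parallel>\<^sup>2\<close> up to a form of finite rank, and
  this leaves only isolated eigenvalues of finite multiplicity below \<open>c\<close>.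
\<close>

section \<open>The Hilbert space\<close>

text \<open>No Fourier transform is used: existence and regularity for \<open>-\<Delta> + t\<close>
  have to come from translations and integration by parts, which is why strong derivatives of
  translation orbits are the working notion. The inner product of \<open>L2\<close> is only the real
  part of the complex one. Hence a complex functional always appears as a pair of real ones, given
  by \<open>w\<close> and \<open>\<i> *\<^sub>C w\<close>, and orthogonality to a complex subspace
  is recovered from its invariance under complex scalars. Compact operators and weak limits are
  avoided as well. Compactness is expressed by finitely many functionals with a small error, and
  along a bounded sequence finitely many functionals converge after passing to a subsequence. The
  price is a loss in the constant: the error must be absorbed, its gradient part by the kinetic
  energy and its \<open>L2\<close> part by the gap between \<open>c'\<close> and \<open>c\<close>.
  This is why coercivity is available only for \<open>c' < c\<close>, which still suffices since
  each point below \<open>c\<close> leaves room for such a \<open>c'\<close>.\<close>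

lemma orthogonal_projection_exists:
  fixes S :: "'a::real_inner set"
  assumes S: "subspace S" "complete S"
  obtains p where "p \<in> S" "\<And>s. s \<in> S \<Longrightarrow> (x - p) \<bullet> s = 0"
proof -
  have S0: "0 \<in> S" using S(1) by (rule subspace_0)
  define d where "d = infdist x S"
  have d: "d \<le> norm (x - s)" if "s \<in> S" for s
    using infdist_le[OF that, of x] by (simp add: d_def dist_norm)
  have d0: "0 \<le> d" by (simp add: d_def infdist_nonneg)
  have "\<exists>s\<in>S. norm (x - s) < d + 1 / Suc n" for n
  proof -
    have "(INF s\<in>S. dist x s) < d + 1 / Suc n"
      using S0 by (auto simp: d_def infdist_def)
    then have "\<exists>s\<in>S. dist x s < d + 1 / Suc n"
      using S0 by (subst (asm) cINF_less_iff) (auto intro: bdd_belowI[where m = 0])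
    then show ?thesis by (simp add: dist_norm)
  qed
  then obtain s where s: "\<And>n. s n \<in> S" "\<And>n. norm (x - s n) < d + 1 / Suc n"
    by metis
  define a where "a n = (d + 1 / Suc n)\<^sup>2" for n :: nat
  have al: "a \<longlonglongrightarrow> (d + 0)\<^sup>2"
    unfolding a_def by (intro tendsto_intros LIMSEQ_Suc[OF lim_1_over_n])
  \<comment> \<open>Parallelogram law: the midpoint of \<open>s m\<close> and \<open>s n\<close>
    lies in \<open>S\<close>, so its distance from \<open>x\<close> is at least \<open>d\<close>.
    This makes the minimising sequence Cauchy.\<close>
  have par: "(norm (s m - s n))\<^sup>2 \<le> 2 * a m + 2 * a n - 4 * d\<^sup>2" for m n
  proof -
    have "(1/2) *\<^sub>R (s m + s n) \<in> S"
      by (intro subspace_scale subspace_add S s)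
    then have "d \<le> norm (x - (1/2) *\<^sub>R (s m + s n))" by (rule d)
    then have "d\<^sup>2 \<le> (norm (x - (1/2) *\<^sub>R (s m + s n)))\<^sup>2" using d0 by (simp add: power_mono)
    moreover have "(norm (s m - s n))\<^sup>2 =
        2 * (norm (x - s m))\<^sup>2 + 2 * (norm (x - s n))\<^sup>2 - 4 * (norm (x - (1/2) *\<^sub>R (s m + s n)))\<^sup>2"
      unfolding power2_norm_eq_inner
      by (simp add: inner_diff_left inner_diff_right inner_add_left inner_add_right
          algebra_simps inner_commute)
    moreover have "(norm (x - s k))\<^sup>2 \<le> a k" for k
      unfolding a_def using s(2)[of k] by (intro power_mono) auto
    ultimately show ?thesis using \<open>\<And>k. (norm (x - s k))\<^sup>2 \<le> a k\<close>[of m]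
      \<open>\<And>k. (norm (x - s k))\<^sup>2 \<le> a k\<close>[of n] by linarith
  qed
  have "Cauchy s"
  proof (rule CauchyI)
    fix e :: real assume e: "0 < e"
    have "\<forall>\<^sub>F n in sequentially. a n < d\<^sup>2 + e\<^sup>2 / 4"
      using al e by (intro order_tendstoD) auto
    then obtain N where N: "\<And>n. n \<ge> N \<Longrightarrow> a n < d\<^sup>2 + e\<^sup>2 / 4"
      by (auto simp: eventually_sequentially)
    show "\<exists>M. \<forall>m\<ge>M. \<forall>n\<ge>M. norm (s m - s n) < e"
    proof (intro exI allI impI)
      fix m n assume "N \<le> m" "N \<le> n"
      then have "(norm (s m - s n))\<^sup>2 < e\<^sup>2"
        using par[of m n] N[of m] N[of n] by linarith
      then show "norm (s m - s n) < e" using e by (simp add: power_less_imp_less_base)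
    qed
  qed
  then obtain p where p: "p \<in> S" "s \<longlonglongrightarrow> p"
    using S(2) s(1) unfolding complete_def by metis
  have "(\<lambda>n. norm (x - s n)) \<longlonglongrightarrow> norm (x - p)"
    by (intro tendsto_intros p)
  moreover have "(\<lambda>n. d + 1 / Suc n) \<longlonglongrightarrow> d + 0"
    by (intro tendsto_intros LIMSEQ_Suc[OF lim_1_over_n])
  ultimately have pd: "norm (x - p) \<le> d"
    using s(2) by (intro LIMSEQ_le[of _ _ "\<lambda>n. d + 1 / Suc n"]) (auto intro: less_imp_le)
  have "(x - p) \<bullet> v = 0" if v: "v \<in> S" for v
  proof (cases "v = 0")
    case False
    \<comment> \<open>The coefficient that brings \<open>p + r *\<^sub>R v\<close> closest to
      \<open>x\<close>. The gain would be
      \<open>((x - p) \<bullet> v)\<^sup>2 / (v \<bullet> v)\<close>, which minimality of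
      \<open>p\<close> forces to vanish.\<close>
    define r where "r = ((x - p) \<bullet> v) / (v \<bullet> v)"
    have vv: "v \<bullet> v > 0" using False by simp
    have "p + r *\<^sub>R v \<in> S" by (intro subspace_add subspace_scale S p v)
    then have "d \<le> norm (x - (p + r *\<^sub>R v))" by (rule d)
    then have "(norm (x - p))\<^sup>2 \<le> (norm (x - p - r *\<^sub>R v))\<^sup>2"
      using pd by (intro power_mono) (auto simp: algebra_simps)
    also have "\<dots> = (norm (x - p))\<^sup>2 - 2 * r * ((x - p) \<bullet> v) + r\<^sup>2 * (v \<bullet> v)"
      unfolding power2_norm_eq_inner
      by (simp add: inner_diff_left inner_diff_right inner_commute algebra_simps power2_eq_square)
    also have "\<dots> = (norm (x - p))\<^sup>2 - ((x - p) \<bullet> v)\<^sup>2 / (v \<bullet> v)"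
      using vv by (simp add: r_def field_simps power2_eq_square)
    finally have "((x - p) \<bullet> v)\<^sup>2 / (v \<bullet> v) \<le> 0" by simp
    then show ?thesis using vv by (simp add: divide_le_0_iff)
  qed simp
  with p(1) show ?thesis by (rule that)
qed

section \<open>Representatives of square-integrable classes\<close>

lemma rep_L2_square_integrable: "square_integrable (rep_L2 u)"
  using Quotient_rep_reflp[OF Quotient_L2, of u] by (simp add: L2_eq_def)

lemma abs_rep_L2 [simp]: "abs_L2 (rep_L2 u) = u"
  using Quotient_abs_rep[OF Quotient_L2] .

lemma rep_L2_measurable [measurable]: "rep_L2 u \<in> borel_measurable lebesgue"
  using rep_L2_square_integrable by (auto simp: square_integrable_def)

lemma rep_L2_integrable: "integrable lebesgue (\<lambda>x. (cmod (rep_L2 u x))\<^sup>2)"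
  using rep_L2_square_integrable by (auto simp: square_integrable_def)

lemma abs_L2_eq_iff:
  assumes "square_integrable f" "square_integrable g"
  shows "abs_L2 f = abs_L2 g \<longleftrightarrow> (AE x in lebesgue. f x = g x)"
  using Quotient_rel[OF Quotient_L2, of f g] assms by (simp add: L2_eq_def)

lemma L2_eqI: "(AE x in lebesgue. rep_L2 u x = rep_L2 v x) \<Longrightarrow> u = v"
  by (metis abs_L2_eq_iff abs_rep_L2 rep_L2_square_integrable)

lemma rep_abs_L2: "square_integrable f \<Longrightarrow> AE x in lebesgue. rep_L2 (abs_L2 f) x = f x"
  by (metis abs_L2_eq_iff abs_rep_L2 rep_L2_square_integrable)

lemma abs_L2_add:
  "square_integrable f \<Longrightarrow> square_integrable g \<Longrightarrow> abs_L2 f + abs_L2 g = abs_L2 (\<lambda>x. f x + g x)"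
  by (simp add: plus_L2.abs_eq L2_eq_def)

lemma abs_L2_cscale:
  "square_integrable f \<Longrightarrow> c *\<^sub>C abs_L2 f = abs_L2 (\<lambda>x. c * f x)"
  by (simp add: cscale.abs_eq L2_eq_def)

lemma rep_L2_add: "AE x in lebesgue. rep_L2 (u + v) x = rep_L2 u x + rep_L2 v x"
  using rep_abs_L2[OF square_integrable_add[OF rep_L2_square_integrable rep_L2_square_integrable], of u v]
  by (simp add: abs_L2_add[symmetric] rep_L2_square_integrable)

lemma rep_L2_cscale: "AE x in lebesgue. rep_L2 (c *\<^sub>C u) x = c * rep_L2 u x"
  using rep_abs_L2[OF square_integrable_mult[OF rep_L2_square_integrable], of c u]
  by (simp add: abs_L2_cscale[symmetric] rep_L2_square_integrable)

lemma scaleR_cscale: "r *\<^sub>R u = complex_of_real r *\<^sub>C (u :: 'a::euclidean_space L2)"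
  by (rule scaleR_L2_def)

lemma rep_L2_diff: "AE x in lebesgue. rep_L2 (u - v) x = rep_L2 u x - rep_L2 v x"
  using rep_L2_add[of u "(-1) *\<^sub>C v"] rep_L2_cscale[of "-1" v]
  unfolding minus_L2_def uminus_L2_def by eventually_elim simp

lemma rep_L2_zero: "AE x in lebesgue. rep_L2 0 x = 0"
  by (simp add: zero_L2_def rep_abs_L2 square_integrable_zero)

lemma inner_L2_eq: "u \<bullet> v = (\<integral>x. rep_L2 u x \<bullet> rep_L2 v x \<partial>lebesgue)"
  by (simp add: inner_L2.rep_eq)

lemma inner_abs_L2:
  assumes "square_integrable f" "square_integrable g"
  shows "abs_L2 f \<bullet> abs_L2 g = (\<integral>x. f x \<bullet> g x \<partial>lebesgue)"
  using assms by (simp add: inner_L2.abs_eq L2_eq_def)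

lemma inner_abs_L2_left:
  assumes "square_integrable f"
  shows "abs_L2 f \<bullet> u = (\<integral>x. f x \<bullet> rep_L2 u x \<partial>lebesgue)"
  using inner_abs_L2[OF assms rep_L2_square_integrable, of u] by simp

lemma power2_norm_L2: "(norm u)\<^sup>2 = (\<integral>x. (cmod (rep_L2 u x))\<^sup>2 \<partial>lebesgue)"
  by (simp add: norm_L2_eq)

lemma norm_abs_L2:
  assumes "square_integrable f"
  shows "(norm (abs_L2 f))\<^sup>2 = (\<integral>x. (cmod (f x))\<^sup>2 \<partial>lebesgue)"
  unfolding power2_norm_eq_inner using assms by (simp add: inner_abs_L2)

lemma nn_integral_rep_L2:
  "(\<integral>\<^sup>+x. ennreal ((cmod (rep_L2 u x))\<^sup>2) \<partial>lebesgue) = ennreal ((norm u)\<^sup>2)"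
  unfolding power2_norm_L2 by (intro nn_integral_eq_integral rep_L2_integrable) simp

lemma square_integrableI:
  assumes "f \<in> borel_measurable lebesgue"
    and "(\<integral>\<^sup>+x. ennreal ((cmod (f x))\<^sup>2) \<partial>lebesgue) < \<infinity>"
  shows "square_integrable f"
  unfolding square_integrable_def using assms
  by (auto intro!: integrableI_bounded simp: abs_of_nonneg)

lemma norm_abs_L2_le:
  assumes "square_integrable f" "0 \<le> r"
    and "(\<integral>\<^sup>+x. ennreal ((cmod (f x))\<^sup>2) \<partial>lebesgue) \<le> ennreal (r\<^sup>2)"
  shows "norm (abs_L2 f) \<le> r"
proof -
  have "ennreal ((norm (abs_L2 f))\<^sup>2) = (\<integral>\<^sup>+x. ennreal ((cmod (f x))\<^sup>2) \<partial>lebesgue)"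
    using assms(1) unfolding norm_abs_L2[OF assms(1)]
    by (intro nn_integral_eq_integral[symmetric]) (auto simp: square_integrable_def)
  then have "ennreal ((norm (abs_L2 f))\<^sup>2) \<le> ennreal (r\<^sup>2)" using assms(3) by simp
  then have "(norm (abs_L2 f))\<^sup>2 \<le> r\<^sup>2" by (subst (asm) ennreal_le_iff) auto
  then show ?thesis using assms(2) by (rule power2_le_imp_le)
qed

text \<open>The bridge between the real inner product and the complex structure: multiplication by
  \<open>c\<close> has multiplication by \<open>cnj c\<close> as its real adjoint, because the inner
  product is the real part of the complex one.\<close>

lemma cscale_inner_adjoint: "(c *\<^sub>C u) \<bullet> v = u \<bullet> (cnj c *\<^sub>C v)"
proof -
  have "(c *\<^sub>C u) \<bullet> v = (\<integral>x. (c * rep_L2 u x) \<bullet> rep_L2 v x \<partial>lebesgue)"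
    unfolding inner_L2_eq using rep_L2_cscale[of c u]
    by (intro integral_cong_AE) (auto elim!: eventually_mono)
  also have "\<dots> = (\<integral>x. rep_L2 u x \<bullet> (cnj c * rep_L2 v x) \<partial>lebesgue)"
    by (intro Bochner_Integration.integral_cong) (auto simp: inner_complex_def algebra_simps)
  also have "\<dots> = u \<bullet> (cnj c *\<^sub>C v)"
    unfolding inner_L2_eq using rep_L2_cscale[of "cnj c" v]
    by (intro integral_cong_AE) (auto elim!: eventually_mono)
  finally show ?thesis .
qed

lemma norm_cscale [simp]: "norm (c *\<^sub>C u) = cmod c * norm (u :: 'a::euclidean_space L2)"
proof -
  have "(norm (c *\<^sub>C u))\<^sup>2 = u \<bullet> ((cmod c)\<^sup>2 *\<^sub>R u)"
    by (simp add: power2_norm_eq_inner[of "c *\<^sub>C u"] cscale_inner_adjoint scaleR_cscale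
        complex_norm_square[symmetric] mult.commute)
  then have "(norm (c *\<^sub>C u))\<^sup>2 = (cmod c * norm u)\<^sup>2"
    by (simp add: power_mult_distrib power2_norm_eq_inner[of u])
  then show ?thesis by simp
qed

lemma bounded_linear_cscale: "bounded_linear (\<lambda>u :: 'a::euclidean_space L2. c *\<^sub>C u)"
proof
  show "\<exists>K. \<forall>x::'a L2. norm (c *\<^sub>C x) \<le> norm x * K"
    by (intro exI[of _ "cmod c"]) (simp add: mult.commute)
qed (simp_all add: L2.scale_right_distrib scaleR_cscale L2.scale_left_commute)

text \<open>Riesz-Fischer. Along a fast subsequence the squared increments have integral at most
  \<open>4^-n\<close>, so they stay summable after weighting by \<open>2^n\<close>. Where the
  weighted series is finite its terms are bounded, hence the increments decay like
  \<open>2^(-n/2)\<close> and the representatives converge pointwise.\<close>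

instance L2 :: (euclidean_space) complete_space
proof
  fix X :: "nat \<Rightarrow> 'a L2"
  assume X: "Cauchy X"
  have "\<exists>N. \<forall>m\<ge>N. \<forall>k\<ge>N. norm (X m - X k) < (1/2) ^ n" for n
    using CauchyD[OF X, of "(1/2) ^ n"] by simp
  then obtain N where N: "\<And>n m k. m \<ge> N n \<Longrightarrow> k \<ge> N n \<Longrightarrow> norm (X m - X k) < (1/2) ^ n"
    by metis
  \<comment> \<open>The maximum over all earlier indices makes \<open>r m\<close> at least
    \<open>N n\<close> for every \<open>n \<le> m\<close>, so one subsequence is controlled at all
    levels.\<close>
  define r where "r n = (MAX k\<in>{..n}. N k) + n" for n
  have rN: "r m \<ge> N n" if "n \<le> m" for n m
  proof -
    have "N n \<le> (MAX k\<in>{..m}. N k)" using that by (intro Max_ge) auto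
    then show ?thesis by (simp add: r_def)
  qed
  define Y where "Y n = X (r n)" for n
  have Y: "norm (Y m - Y n) < (1/2) ^ n" if "n \<le> m" for n m
    unfolding Y_def by (intro N rN that order_refl)
  define f where "f n = rep_L2 (Y n)" for n
  have fm [measurable]: "f n \<in> borel_measurable lebesgue" for n
    by (simp add: f_def)
  have nf: "(\<integral>\<^sup>+x. ennreal ((cmod (f m x - f n x))\<^sup>2) \<partial>lebesgue) = ennreal ((norm (Y m - Y n))\<^sup>2)" for m n
    unfolding nn_integral_rep_L2[symmetric] f_def
    by (intro nn_integral_cong_AE) (use rep_L2_diff[of "Y m" "Y n"] in eventually_elim, simp)
  have "(\<integral>\<^sup>+x. (\<Sum>n. ennreal (2 ^ n * (cmod (f (Suc n) x - f n x))\<^sup>2)) \<partial>lebesgue)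
      = (\<Sum>n. \<integral>\<^sup>+x. ennreal (2 ^ n * (cmod (f (Suc n) x - f n x))\<^sup>2) \<partial>lebesgue)"
    by (rule nn_integral_suminf) measurable
  also have "\<dots> = (\<Sum>n. ennreal (2 ^ n * (norm (Y (Suc n) - Y n))\<^sup>2))"
    by (simp add: ennreal_mult nn_integral_cmult nf)
  also have "\<dots> \<le> (\<Sum>n. ennreal ((1/2) ^ n))"
  proof (intro suminf_le ennreal_leI)
    fix n
    have "(norm (Y (Suc n) - Y n))\<^sup>2 \<le> ((1/2) ^ n)\<^sup>2"
      using Y[of n "Suc n"] by (intro power_mono) auto
    then have "2 ^ n * (norm (Y (Suc n) - Y n))\<^sup>2 \<le> 2 ^ n * ((1/2) ^ n)\<^sup>2"
      by (intro mult_left_mono) auto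
    also have "\<dots> = (1/2) ^ n"
      by (simp add: power2_eq_square power_divide)
    finally show "2 ^ n * (norm (Y (Suc n) - Y n))\<^sup>2 \<le> (1/2) ^ n" .
  qed auto
  also have "\<dots> < \<infinity>"
    by (simp add: suminf_ennreal2 summable_geometric)
  finally have "AE x in lebesgue. (\<Sum>n. ennreal (2 ^ n * (cmod (f (Suc n) x - f n x))\<^sup>2)) \<noteq> \<infinity>"
    by (intro nn_integral_PInf_AE) auto
  then have cv: "AE x in lebesgue. convergent (\<lambda>n. f n x)"
  proof eventually_elim
    fix x assume "(\<Sum>n. ennreal (2 ^ n * (cmod (f (Suc n) x - f n x))\<^sup>2)) \<noteq> \<infinity>"
    then have "summable (\<lambda>n. 2 ^ n * (cmod (f (Suc n) x - f n x))\<^sup>2)"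
      by (intro summable_suminf_not_top) auto
    then have "Bseq (\<lambda>n. 2 ^ n * (cmod (f (Suc n) x - f n x))\<^sup>2)"
      by (intro convergent_imp_Bseq) (auto simp: convergent_def dest: summable_LIMSEQ_zero)
    then obtain K where K: "K > 0" "\<And>n. 2 ^ n * (cmod (f (Suc n) x - f n x))\<^sup>2 \<le> K"
      by (auto simp: Bseq_def abs_mult)
    have "cmod (f (Suc n) x - f n x) \<le> sqrt K * (sqrt (1/2)) ^ n" for n
    proof -
      have "(cmod (f (Suc n) x - f n x))\<^sup>2 \<le> K * (1/2) ^ n"
        using K(2)[of n] by (simp add: field_simps)
      then have "sqrt ((cmod (f (Suc n) x - f n x))\<^sup>2) \<le> sqrt (K * (1/2) ^ n)"
        by (rule real_sqrt_le_mono)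
      then show ?thesis by (simp add: real_sqrt_mult real_sqrt_power)
    qed
    moreover have "summable (\<lambda>n. sqrt K * (sqrt (1/2)) ^ n)"
      by (intro summable_mult summable_geometric) (simp add: real_sqrt_divide)
    ultimately have "summable (\<lambda>n. f (Suc n) x - f n x)"
      by (rule summable_comparison_test'[rotated])
    then have "convergent (\<lambda>n. f n x - f 0 x)"
      by (simp add: summable_iff_convergent sum_lessThan_telescope[of "\<lambda>n. f n x"])
    then show "convergent (\<lambda>n. f n x)"
      using convergent_add_const_right_iff[of "\<lambda>n. f n x" "- f 0 x"] by simp
  qed
  define g where "g x = lim (\<lambda>n. f n x)" for x
  have gm [measurable]: "g \<in> borel_measurable lebesgue"
    unfolding g_def by (rule borel_measurable_lim_metric) measurable
  \<comment> \<open>Fatou's lemma in \<open>m\<close> carries the Cauchy estimate over to the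
    pointwise limit; it yields both that \<open>g\<close> is square-integrable and the rate of
    convergence.\<close>
  have fat: "(\<integral>\<^sup>+x. ennreal ((cmod (g x - f n x))\<^sup>2) \<partial>lebesgue) \<le> ennreal (((1/2) ^ n)\<^sup>2)" for n
  proof -
    have "(\<integral>\<^sup>+x. ennreal ((cmod (g x - f n x))\<^sup>2) \<partial>lebesgue)
        = (\<integral>\<^sup>+x. liminf (\<lambda>m. ennreal ((cmod (f m x - f n x))\<^sup>2)) \<partial>lebesgue)"
    proof (rule nn_integral_cong_AE, use cv in eventually_elim)
      fix x assume "convergent (\<lambda>n. f n x)"
      then have "(\<lambda>m. f m x) \<longlonglongrightarrow> g x" by (simp add: g_def convergent_LIMSEQ_iff)
      then have "(\<lambda>m. ennreal ((cmod (f m x - f n x))\<^sup>2)) \<longlonglongrightarrow> ennreal ((cmod (g x - f n x))\<^sup>2)"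
        by (intro tendsto_intros)
      then show "ennreal ((cmod (g x - f n x))\<^sup>2) = liminf (\<lambda>m. ennreal ((cmod (f m x - f n x))\<^sup>2))"
        using lim_imp_Liminf[OF sequentially_bot] by metis
    qed
    also have "\<dots> \<le> liminf (\<lambda>m. \<integral>\<^sup>+x. ennreal ((cmod (f m x - f n x))\<^sup>2) \<partial>lebesgue)"
      by (rule nn_integral_liminf) measurable
    also have "\<dots> \<le> liminf (\<lambda>m. ennreal (((1/2) ^ n)\<^sup>2))"
      unfolding nf
      by (intro Liminf_mono eventually_sequentiallyI[of n] ennreal_leI power_mono)
         (auto intro: less_imp_le[OF Y])
    also have "\<dots> = ennreal (((1/2) ^ n)\<^sup>2)"
      by (rule Liminf_const) simp
    finally show ?thesis .
  qed
  have sq: "square_integrable (\<lambda>x. g x - f n x)" for n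
    by (rule square_integrableI) (use fat[of n] in \<open>auto intro: le_less_trans\<close>)
  have g: "square_integrable g"
    using square_integrable_add[OF sq[of 0] rep_L2_square_integrable[of "Y 0"]] by (simp add: f_def)
  have gY: "norm (abs_L2 g - Y n) \<le> (1/2) ^ n" for n
  proof -
    have "abs_L2 g = abs_L2 (\<lambda>x. g x - f n x) + Y n"
      using abs_L2_add[OF sq[of n] rep_L2_square_integrable[of "Y n"]] by (simp add: f_def)
    then show ?thesis using norm_abs_L2_le[OF sq _ fat, of n] by simp
  qed
  have "X \<longlonglongrightarrow> abs_L2 g"
  proof (rule LIMSEQ_I)
    fix e :: real assume "0 < e"
    then obtain n where n: "(1/2::real) ^ n < e / 2"
      using real_arch_pow_inv[of "e/2" "1/2"] by auto
    show "\<exists>no. \<forall>k\<ge>no. norm (X k - abs_L2 g) < e"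
    proof (intro exI allI impI)
      fix k assume k: "N n \<le> k"
      have "norm (X k - abs_L2 g) \<le> norm (X k - Y n) + norm (abs_L2 g - Y n)"
        using norm_triangle_ineq4[of "X k - Y n" "abs_L2 g - Y n"] by simp
      also have "\<dots> < e"
        using N[OF k rN[OF order_refl]] gY[of n] n unfolding Y_def by linarith
      finally show "norm (X k - abs_L2 g) < e" .
    qed
  qed
  then show "convergent X" by (rule convergentI)
qed

instance L2 :: (euclidean_space) banach ..

section \<open>Density of test functions\<close>

lemma borel_measurable_lebesgueI: "f \<in> borel_measurable borel \<Longrightarrow> f \<in> borel_measurable lebesgue"
  by (rule measurable_completion) simp

section \<open>Smooth bump functions\<close>

text \<open>For \<open>p = 1\<close> this is the classical \<open>exp (-1/t)\<close>, extended by
  zero. The polynomial in \<open>1/t\<close> is carried along because it makes the family closed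
  under differentiation, so smoothness follows by one induction over all \<open>p\<close>.\<close>

definition flat_exp :: "real poly \<Rightarrow> real \<Rightarrow> real" where
  "flat_exp p t = (if t > 0 then poly p (inverse t) / exp (inverse t) else 0)"

lemma tendsto_poly_div_exp_0:
  fixes p :: "real poly"
  shows "((\<lambda>x. x ^ k * poly p x / exp x) \<longlongrightarrow> 0) at_top"
proof (induction p arbitrary: k)
  case (pCons a p)
  have "((\<lambda>x. a * (x ^ k / exp x) + x ^ Suc k * poly p x / exp x) \<longlongrightarrow> a * 0 + 0) at_top"
    by (intro tendsto_intros tendsto_power_div_exp_0 pCons.IH)
  then show ?case by (simp add: field_simps)
qed simp

lemma flat_exp_tendsto_0: "(flat_exp p \<longlongrightarrow> 0) (at 0)"
proof (rule filterlim_split_at)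
  show "(flat_exp p \<longlongrightarrow> 0) (at_left 0)"
    by (rule tendsto_eventually) (auto simp: eventually_at_filter flat_exp_def)
  have "((\<lambda>x. poly p x / exp x) \<longlongrightarrow> 0) at_top"
    using tendsto_poly_div_exp_0[of 0 p] by simp
  moreover have "\<forall>\<^sub>F x in at_top. flat_exp p (inverse x) = poly p x / exp x"
    using eventually_gt_at_top[of "0::real"] by eventually_elim (simp add: flat_exp_def)
  ultimately show "(flat_exp p \<longlongrightarrow> 0) (at_right 0)"
    unfolding filterlim_at_right_to_top by (simp add: tendsto_cong)
qed

text \<open>The polynomial \<open>[:0, 0, 1:]\<close> is the square of the variable: differentiating
  \<open>p (1/t) * exp (-1/t)\<close> produces the factor \<open>1/t^2\<close> times
  \<open>p - pderiv p\<close> at \<open>1/t\<close>. At the origin the difference quotient is again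
  a member of the family, with \<open>p\<close> multiplied by the variable, and tends to
  zero.\<close>

lemma has_derivative_flat_exp:
  "(flat_exp p has_real_derivative flat_exp ([:0, 0, 1:] * (p - pderiv p)) t) (at t)"
proof -
  consider "t > 0" | "t < 0" | "t = 0" by linarith
  then show ?thesis
  proof cases
    case 1
    have "((\<lambda>t. poly p (inverse t) / exp (inverse t)) has_real_derivative
        flat_exp ([:0, 0, 1:] * (p - pderiv p)) t) (at t)"
      using 1 by (auto intro!: derivative_eq_intros poly_DERIV[THEN DERIV_chain2]
          simp: flat_exp_def power2_eq_square field_simps)
    then show ?thesis
      by (rule has_field_derivative_transform_within_open[of _ _ _ "{0<..}"])
         (use 1 in \<open>auto simp: flat_exp_def\<close>)
  next
    case 2
    have "((\<lambda>_. 0) has_real_derivative flat_exp ([:0, 0, 1:] * (p - pderiv p)) t) (at t)"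
      using 2 by (simp add: flat_exp_def)
    then show ?thesis
      by (rule has_field_derivative_transform_within_open[of _ _ _ "{..<0}"])
         (use 2 in \<open>auto simp: flat_exp_def\<close>)
  next
    case 3
    have "((\<lambda>h. (flat_exp p (0 + h) - flat_exp p 0) / h) \<longlongrightarrow> 0) (at 0)"
    proof (rule Lim_transform_eventually[OF flat_exp_tendsto_0[of "[:0, 1:] * p"]])
      show "\<forall>\<^sub>F h in at 0. flat_exp ([:0, 1:] * p) h = (flat_exp p (0 + h) - flat_exp p 0) / h"
        unfolding eventually_at_filter
        by (intro always_eventually) (auto simp: flat_exp_def field_simps)
    qed
    then show ?thesis
      unfolding 3 by (simp add: DERIV_def flat_exp_def)
  qed
qed

text \<open>\<open>C_k\<close> speaks of the chosen \<open>frechet_derivative\<close>; uniqueness of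
  the derivative allows any explicit formula to be used in its place.\<close>

lemma C_kI:
  assumes "\<And>x. (\<phi> has_derivative \<phi>' x) (at x)" "\<And>b. b \<in> Basis \<Longrightarrow> C_k k (\<lambda>x. \<phi>' x b)"
  shows "C_k (Suc k) \<phi>"
proof -
  have "frechet_derivative \<phi> (at x) = \<phi>' x" for x
    using frechet_derivative_at[OF assms(1)] by simp
  then show ?thesis using assms by (auto simp: differentiable_def)
qed

lemma C_k_Suc_has_derivative:
  "C_k (Suc k) \<phi> \<Longrightarrow> (\<phi> has_derivative frechet_derivative \<phi> (at x)) (at x)"
  by (simp add: frechet_derivative_works)

lemma C_k_SucD: "C_k (Suc k) \<phi> \<Longrightarrow> C_k k \<phi>"
proof (induction k arbitrary: \<phi>)
  case 0
  then show ?case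
    by (auto intro!: continuous_at_imp_continuous_on differentiable_imp_continuous_within)
next
  case (Suc k)
  from Suc.prems have "\<forall>b\<in>Basis. C_k k (\<lambda>x. frechet_derivative \<phi> (at x) b)"
    by (auto intro: Suc.IH)
  with Suc.prems show ?case by simp
qed

lemma C_k_const: "C_k k (\<lambda>x. c)"
proof (induction k arbitrary: c)
  case (Suc k)
  show ?case by (rule C_kI[where \<phi>' = "\<lambda>_ _. 0"]) (auto intro!: Suc)
qed simp

lemma C_k_add: "C_k k f \<Longrightarrow> C_k k g \<Longrightarrow> C_k k (\<lambda>x. f x + g x)"
proof (induction k arbitrary: f g)
  case 0
  then show ?case by (auto intro: continuous_intros)
next
  case (Suc k)
  show ?case
  proof (rule C_kI)
    show "((\<lambda>x. f x + g x) has_derivative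
       (\<lambda>h. frechet_derivative f (at x) h + frechet_derivative g (at x) h)) (at x)" for x
      using Suc.prems[THEN C_k_Suc_has_derivative, of x] by (rule has_derivative_add)
  qed (use Suc in auto)
qed

lemma C_k_mult: "C_k k f \<Longrightarrow> C_k k g \<Longrightarrow> C_k k (\<lambda>x. f x * g x)"
proof (induction k arbitrary: f g)
  case 0
  then show ?case by (auto intro: continuous_intros)
next
  case (Suc k)
  show ?case
  proof (rule C_kI)
    show "((\<lambda>x. f x * g x) has_derivative
       (\<lambda>h. f x * frechet_derivative g (at x) h + frechet_derivative f (at x) h * g x)) (at x)" for x
      using Suc.prems[THEN C_k_Suc_has_derivative, of x] by (rule has_derivative_mult)
    show "C_k k (\<lambda>x. f x * frechet_derivative g (at x) b + frechet_derivative f (at x) b * g x)"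
      if "b \<in> Basis" for b
      using Suc.prems that C_k_SucD[OF Suc.prems(1)] C_k_SucD[OF Suc.prems(2)]
      by (intro C_k_add Suc.IH) auto
  qed
qed

lemma C_k_prod: "finite I \<Longrightarrow> (\<And>i. i \<in> I \<Longrightarrow> C_k k (f i)) \<Longrightarrow> C_k k (\<lambda>x. \<Prod>i\<in>I. f i x)"
  by (induction I rule: finite_induct) (auto intro: C_k_const C_k_mult)

lemma C_k_translate: "C_k k f \<Longrightarrow> C_k k (\<lambda>x. f (x + a))"
proof (induction k arbitrary: f)
  case 0
  then show ?case
    by (auto intro!: continuous_on_compose2[of UNIV f] continuous_intros)
next
  case (Suc k)
  show ?case
  proof (rule C_kI)
    show "((\<lambda>x. f (x + a)) has_derivative frechet_derivative f (at (x + a))) (at x)" for x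
    proof -
      have "((\<lambda>x. x + a) has_derivative (\<lambda>h. h)) (at x)"
        by (auto intro!: derivative_eq_intros)
      from has_derivative_compose[OF this C_k_Suc_has_derivative[OF Suc.prems]] show ?thesis by simp
    qed
    show "C_k k (\<lambda>x. frechet_derivative f (at (x + a)) b)" if "b \<in> Basis" for b
      using Suc.prems that by (auto intro!: Suc.IH[of "\<lambda>x. frechet_derivative f (at x) b"])
  qed
qed

lemma C_k_flat_exp: "C_k k (\<lambda>x. flat_exp p (x \<bullet> u + \<beta>))"
proof (induction k arbitrary: p)
  case 0
  have "continuous_on UNIV (flat_exp p)"
    using has_derivative_flat_exp[of p]
    by (meson DERIV_isCont continuous_at_imp_continuous_on)
  then show ?case
    by (auto intro!: continuous_on_compose2[of UNIV "flat_exp p"] continuous_intros)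
next
  case (Suc k)
  show ?case
  proof (rule C_kI)
    show "((\<lambda>x. flat_exp p (x \<bullet> u + \<beta>)) has_derivative
      (\<lambda>h. flat_exp ([:0, 0, 1:] * (p - pderiv p)) (x \<bullet> u + \<beta>) * (h \<bullet> u))) (at x)" for x
    proof -
      have "((\<lambda>x. x \<bullet> u + \<beta>) has_derivative (\<lambda>h. h \<bullet> u)) (at x)"
        by (auto intro!: derivative_eq_intros)
      from has_derivative_compose[OF this has_derivative_flat_exp[unfolded has_field_derivative_def]]
      show ?thesis by simp
    qed
  qed (intro C_k_mult C_k_const Suc)
qed

lemma C_k_frechet_derivative:
  "\<forall>k. C_k k \<phi> \<Longrightarrow> b \<in> Basis \<Longrightarrow> C_k k (\<lambda>x. frechet_derivative \<phi> (at x) b)"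
  using C_k.simps(2)[of k \<phi>] by blast

lemma test_functionI:
  assumes "\<And>k. C_k k \<phi>" "compact K" "\<And>x. x \<notin> K \<Longrightarrow> \<phi> x = 0"
  shows "test_function \<phi>"
proof -
  have "closure {x. \<phi> x \<noteq> 0} \<subseteq> K"
    using assms(2,3) by (intro closure_minimal) (auto intro: compact_imp_closed)
  then have "compact (closure {x. \<phi> x \<noteq> 0})"
    using compact_Int_closed[OF assms(2) closed_closure, of "{x. \<phi> x \<noteq> 0}"] by (metis inf.absorb2)
  with assms(1) show ?thesis by (simp add: test_function_def)
qed

lemma test_functionE:
  assumes "test_function \<phi>"
  obtains K where "compact K" "\<And>x. x \<notin> K \<Longrightarrow> \<phi> x = 0"
  using assms closure_subset[of "{x. \<phi> x \<noteq> 0}"] unfolding test_function_def by blast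

lemma test_function_C_k: "test_function \<phi> \<Longrightarrow> C_k k \<phi>"
  by (simp add: test_function_def)

lemma test_function_continuous: "test_function \<phi> \<Longrightarrow> continuous_on S \<phi>"
  using test_function_C_k[of \<phi> 0] by (auto intro: continuous_on_subset)

lemma test_function_has_derivative:
  "test_function \<phi> \<Longrightarrow> (\<phi> has_derivative frechet_derivative \<phi> (at x)) (at x)"
  by (rule C_k_Suc_has_derivative[of 0]) (rule test_function_C_k)

lemma test_function_add:
  assumes "test_function f" "test_function g"
  shows "test_function (\<lambda>x. f x + g x)"
proof -
  from assms obtain K L where "compact K" "\<And>x. x \<notin> K \<Longrightarrow> f x = 0" "compact L" "\<And>x. x \<notin> L \<Longrightarrow> g x = 0"
    by (metis test_functionE)
  then show ?thesis
    using assms by (intro test_functionI[where K = "K \<union> L"]) (auto simp: test_function_C_k intro!: C_k_add)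
qed

lemma test_function_cmult:
  assumes "test_function f"
  shows "test_function (\<lambda>x. c * f x)"
proof -
  from assms obtain K where "compact K" "\<And>x. x \<notin> K \<Longrightarrow> f x = 0"
    by (metis test_functionE)
  then show ?thesis
    using assms by (intro test_functionI[where K = K]) (auto simp: test_function_C_k intro!: C_k_mult C_k_const)
qed

lemma test_function_translate:
  assumes "test_function f"
  shows "test_function (\<lambda>x. f (x + a))"
proof -
  from assms obtain K where K: "compact K" "\<And>x. x \<notin> K \<Longrightarrow> f x = 0"
    by (metis test_functionE)
  show ?thesis
  proof (rule test_functionI)
    show "compact ((+) (- a) ` K)" using K(1) by (rule compact_translation)
    show "f (x + a) = 0" if "x \<notin> (+) (- a) ` K" for x
    proof (rule K(2))
      show "x + a \<notin> K" using that image_eqI[of x "(+) (- a)" "x + a" K] by auto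
    qed
  qed (intro C_k_translate test_function_C_k assms)
qed

lemma test_function_deriv:
  assumes "test_function f" "b \<in> Basis"
  shows "test_function (\<lambda>x. frechet_derivative f (at x) b)"
proof (rule test_functionI)
  show "C_k k (\<lambda>x. frechet_derivative f (at x) b)" for k
    using assms by (intro C_k_frechet_derivative) (auto simp: test_function_C_k)
  let ?K = "closure {x. f x \<noteq> 0}"
  show "compact ?K" using assms by (simp add: test_function_def)
  show "frechet_derivative f (at x) b = 0" if "x \<notin> ?K" for x
  proof -
    have *: "f y = 0" if "y \<in> - ?K" for y
      using that closure_subset[of "{x. f x \<noteq> 0}"] by blast
    have "(f has_derivative (\<lambda>_. 0)) (at x)"
    proof (rule has_derivative_transform_within_open)
      show "((\<lambda>_. 0) has_derivative (\<lambda>_. 0)) (at x)" by (rule has_derivative_const)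
      show "open (- ?K)" by (rule open_Compl) simp
      show "x \<in> - ?K" using that by simp
    qed (rule *[symmetric])
    then show ?thesis by (metis frechet_derivative_at)
  qed
qed

text \<open>Each coordinate contributes a one-sided cutoff at either face. The factor
  \<open>Suc n\<close> steepens the cutoffs, so that the bumps tend pointwise to the indicator of
  the open box while staying below it.\<close>

definition box_bump :: "'a::euclidean_space \<Rightarrow> 'a \<Rightarrow> nat \<Rightarrow> 'a \<Rightarrow> real" where
  "box_bump l r n x = (\<Prod>b\<in>Basis. flat_exp 1 (Suc n * (x \<bullet> b - l \<bullet> b)) * flat_exp 1 (Suc n * (r \<bullet> b - x \<bullet> b)))"

lemma flat_exp_1: "0 \<le> flat_exp 1 t" "flat_exp 1 t \<le> 1" "t \<le> 0 \<Longrightarrow> flat_exp 1 t = 0"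
  by (auto simp: flat_exp_def)

lemma test_function_box_bump: "test_function (box_bump l r n)"
proof (rule test_functionI)
  have *: "flat_exp 1 (Suc n * (x \<bullet> b - l \<bullet> b)) * flat_exp 1 (Suc n * (r \<bullet> b - x \<bullet> b))
     = flat_exp 1 (x \<bullet> (real (Suc n) *\<^sub>R b) + (- Suc n * (l \<bullet> b))) *
       flat_exp 1 (x \<bullet> ((- real (Suc n)) *\<^sub>R b) + Suc n * (r \<bullet> b))" for x b
    by (simp add: algebra_simps)
  show "C_k k (box_bump l r n)" for k
    unfolding box_bump_def[abs_def] * by (intro C_k_prod C_k_mult C_k_flat_exp finite_Basis)
  show "box_bump l r n x = 0" if x: "x \<notin> cbox l r" for x
  proof -
    obtain b where b: "b \<in> Basis" "x \<bullet> b \<le> l \<bullet> b \<or> r \<bullet> b \<le> x \<bullet> b"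
      using x by (auto simp: mem_box not_le intro: less_imp_le)
    then have "flat_exp 1 (Suc n * (x \<bullet> b - l \<bullet> b)) = 0 \<or> flat_exp 1 (Suc n * (r \<bullet> b - x \<bullet> b)) = 0"
      by (auto intro!: flat_exp_1(3) mult_nonneg_nonpos)
    with b(1) show ?thesis unfolding box_bump_def by (intro prod_zero bexI[of _ b]) auto
  qed
qed simp

lemma box_bump_bounds: "0 \<le> box_bump l r n x" "box_bump l r n x \<le> indicator (box l r) x"
proof -
  show "0 \<le> box_bump l r n x"
    by (simp add: box_bump_def prod_nonneg flat_exp_1)
  have "box_bump l r n x \<le> 1"
    unfolding box_bump_def by (intro prod_le_1 conjI mult_nonneg_nonneg mult_le_one flat_exp_1)
  moreover have "box_bump l r n x = 0" if x: "x \<notin> box l r"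
  proof -
    obtain b where b: "b \<in> Basis" "x \<bullet> b \<le> l \<bullet> b \<or> r \<bullet> b \<le> x \<bullet> b"
      using x by (auto simp: mem_box not_less)
    then have "flat_exp 1 (Suc n * (x \<bullet> b - l \<bullet> b)) = 0 \<or> flat_exp 1 (Suc n * (r \<bullet> b - x \<bullet> b)) = 0"
      by (auto intro!: flat_exp_1(3) mult_nonneg_nonpos)
    with b(1) show ?thesis unfolding box_bump_def by (intro prod_zero bexI[of _ b]) auto
  qed
  ultimately show "box_bump l r n x \<le> indicator (box l r) x"
    by (cases "x \<in> box l r") auto
qed

lemma flat_exp_1_tendsto:
  fixes t :: real
  assumes "t > 0"
  shows "(\<lambda>n. flat_exp 1 (Suc n * t)) \<longlonglongrightarrow> 1"
proof -
  have "(\<lambda>n. exp (- (inverse t * inverse (real (Suc n))))) \<longlonglongrightarrow> exp (- (inverse t * 0))"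
    by (intro tendsto_intros LIMSEQ_inverse_real_of_nat)
  moreover have "flat_exp 1 (Suc n * t) = exp (- (inverse t * inverse (real (Suc n))))" for n
  proof -
    have "0 < Suc n * t" using assms by (intro mult_pos_pos) auto
    then have "flat_exp 1 (Suc n * t) = inverse (exp (inverse (Suc n * t)))"
      by (simp add: flat_exp_def inverse_eq_divide del: of_nat_Suc)
    then show ?thesis
      by (simp only: exp_minus inverse_mult_distrib mult.commute)
  qed
  ultimately show ?thesis by simp
qed

lemma box_bump_tendsto: "(\<lambda>n. box_bump l r n x) \<longlonglongrightarrow> indicator (box l r) x"
proof (cases "x \<in> box l r")
  case True
  have "(\<lambda>n. box_bump l r n x) \<longlonglongrightarrow> (\<Prod>b\<in>(Basis :: 'a set). 1 * 1)"
    unfolding box_bump_def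
    by (intro tendsto_prod tendsto_mult flat_exp_1_tendsto) (use True in \<open>auto simp only: mem_box diff_gt_0_iff_gt\<close>)
  then show ?thesis using True by simp
next
  case False
  then have "box_bump l r n x = 0" for n
    using box_bump_bounds[of l r n x] by simp
  then show ?thesis using False by simp
qed

section \<open>The fundamental lemma of the calculus of variations\<close>

lemma AE_nonpos_if_box_integrals_0:
  fixes g :: "'a::euclidean_space \<Rightarrow> real"
  assumes [measurable]: "g \<in> borel_measurable borel"
    and int: "\<And>l r. integrable lborel (\<lambda>x. indicator (box l r) x * g x)"
    and zero: "\<And>l r. (\<integral>x. indicator (box l r) x * g x \<partial>lborel) = 0"
  shows "AE x in lborel. g x \<le> 0"
proof -
  have on_box: "AE x in lborel. x \<in> box l r \<longrightarrow> g x \<le> 0" for l r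
  proof -
    define f where "f x = indicator (box l r) x * g x" for x
    have fi: "integrable lborel f" using int[of l r] unfolding f_def .
    have si: "set_integrable lborel A f" if "A \<in> sets borel" for A
      unfolding set_integrable_def using integrable_mult_indicator[OF _ fi, of A] that by simp
    \<comment> \<open>The sets over which \<open>f\<close> integrates to zero form a Dynkin system
      that contains the intersection-stable boxes generating the Borel sets. Cutting
      \<open>g\<close> off to a fixed box makes \<open>f\<close> integrable, as complements and
      countable unions require. The set of interest is \<open>{x. g x > 0}\<close>.\<close>
    have main: "(LINT x:A|lborel. f x) = 0" if A: "A \<in> sets borel" for A
    proof -
      have "Int_stable (range (\<lambda>(a, b). box a b :: 'a set))"
        by (auto simp: Int_stable_def box_Int_box)
      moreover have "(range (\<lambda>(a, b). box a b :: 'a set)) \<subseteq> Pow UNIV" by auto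
      moreover have "A \<in> sigma_sets UNIV (range (\<lambda>(a, b). box a b))"
        using A unfolding borel_eq_box by simp
      ultimately show ?thesis
      proof (induction rule: sigma_sets_induct_disjoint)
        case (basic A)
        then obtain a b where "A = box a b" by auto
        moreover obtain c d where "box a b \<inter> box l r = box c d" using box_Int_box[of a b l r] by blast
        ultimately have "(LINT x:A|lborel. f x) = (\<integral>x. indicator (box c d) x * g x \<partial>lborel)"
          unfolding set_lebesgue_integral_def f_def
          by (intro Bochner_Integration.integral_cong) (auto simp: indicator_def)
        then show ?case using zero by simp
      next
        case empty
        then show ?case by (simp add: set_lebesgue_integral_def)
      next
        case (compl A)
        then have A: "A \<in> sets borel" by (simp add: borel_eq_box)
        have "(LINT x:UNIV - A|lborel. f x) = (\<integral>x. f x - indicator A x *\<^sub>R f x \<partial>lborel)"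
          unfolding set_lebesgue_integral_def
          by (intro Bochner_Integration.integral_cong) (auto simp: indicator_def)
        also have "\<dots> = (\<integral>x. f x \<partial>lborel) - (LINT x:A|lborel. f x)"
          unfolding set_lebesgue_integral_def
          using fi si[OF A] by (intro Bochner_Integration.integral_diff) (auto simp: set_integrable_def)
        finally show ?case using compl zero by (simp add: f_def)
      next
        case (union F)
        then have F: "F i \<in> sets borel" for i by (auto simp: borel_eq_box subset_eq)
        have "(LINT x:(\<Union>i. F i)|lborel. f x) = (\<Sum>i. (LINT x:(F i)|lborel. f x))"
          using union(1) F si by (intro lebesgue_integral_countable_add)
            (auto simp: disjoint_family_on_def)
        then show ?case using union by simp
      qed
    qed
    define A where "A = {x. g x > 0}"
    have A [measurable]: "A \<in> sets borel" by (simp add: A_def)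
    have "AE x in lborel. indicator A x *\<^sub>R f x = 0"
    proof (subst integral_nonneg_eq_0_iff_AE[symmetric])
      show "integrable lborel (\<lambda>x. indicator A x *\<^sub>R f x)"
        using si[OF A] by (simp add: set_integrable_def)
      show "AE x in lborel. 0 \<le> indicator A x *\<^sub>R f x"
        by (auto simp: A_def f_def indicator_def)
      show "(\<integral>x. indicator A x *\<^sub>R f x \<partial>lborel) = 0"
        using main[OF A] by (simp add: set_lebesgue_integral_def)
    qed
    then show ?thesis
      by eventually_elim (auto simp: A_def f_def indicator_def split: if_splits)
  qed
  have "AE x in lborel. \<forall>n::nat. x \<in> box (- real n *\<^sub>R One) (real n *\<^sub>R One) \<longrightarrow> g x \<le> 0"
    unfolding AE_all_countable using on_box by blast
  then show ?thesis
  proof eventually_elim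
    fix x :: 'a assume *: "\<forall>n::nat. x \<in> box (- real n *\<^sub>R One) (real n *\<^sub>R One) \<longrightarrow> g x \<le> 0"
    have "x \<in> (\<Union>n::nat. box (- real n *\<^sub>R One) (real n *\<^sub>R One))"
      by (simp add: UN_box_eq_UNIV)
    with * show "g x \<le> 0" by blast
  qed
qed

text \<open>Bumps approximate indicators of boxes under a common integrable majorant, so all box
  integrals vanish; applying the box criterion to the function and to its negative finishes. A Borel
  version \<open>h\<close> is used since the Dynkin argument runs over Borel sets.\<close>

lemma AE_0_if_test_integrals_0:
  fixes g :: "'a::euclidean_space \<Rightarrow> real"
  assumes gm: "g \<in> borel_measurable lebesgue" and g2: "integrable lebesgue (\<lambda>x. (g x)\<^sup>2)"
    and zero: "\<And>\<phi>. test_function \<phi> \<Longrightarrow> (\<integral>x. \<phi> x * g x \<partial>lebesgue) = 0"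
  shows "AE x in lebesgue. g x = 0"
proof -
  obtain h where h [measurable]: "h \<in> borel_measurable lborel" and gh: "AE x in lborel. g x = h x"
    using completion_ex_borel_measurable_real[OF gm] by blast
  have gh': "AE x in lebesgue. g x = h x"
    using gh by (simp add: AE_completion)
  have "integrable lebesgue (\<lambda>x. (h x)\<^sup>2)"
    using g2
  proof (rule integrable_cong_AE_imp)
    show "(\<lambda>x. (h x)\<^sup>2) \<in> borel_measurable lebesgue"
      by (rule measurable_completion) simp
    show "AE x in lebesgue. (g x)\<^sup>2 = (h x)\<^sup>2"
      using gh' by eventually_elim simp
  qed
  then have h2: "integrable lborel (\<lambda>x. (h x)\<^sup>2)" by (subst (asm) integrable_completion) auto
  \<comment> \<open>Square-integrability gives integrability on boxes through
    \<open>\<bar>y\<bar> \<le> 1 + y\<^sup>2\<close>, the constant being integrable on a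
    box.\<close>
  have int: "integrable lborel (\<lambda>x. indicator (box l r) x * h x)" for l r
  proof (rule Bochner_Integration.integrable_bound)
    show "integrable lborel (\<lambda>x. indicator (box l r) x + (h x)\<^sup>2)"
      by (intro Bochner_Integration.integrable_add h2) (simp add: emeasure_lborel_box_eq)
    have "\<bar>y\<bar> \<le> 1 + y\<^sup>2" for y :: real
      using sum_squares_bound[of "\<bar>y\<bar>" 1] by simp
    then show "AE x in lborel. norm (indicator (box l r) x * h x) \<le> norm (indicator (box l r) x + (h x)\<^sup>2)"
      by (auto simp: indicator_def)
  qed measurable
  have "(\<integral>x. indicator (box l r) x * h x \<partial>lborel) = 0" for l r
  proof -
    have [measurable]: "box_bump l r n \<in> borel_measurable borel" for n
      by (intro borel_measurable_continuous_onI test_function_continuous test_function_box_bump)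
    have "(\<lambda>n. \<integral>x. box_bump l r n x * h x \<partial>lborel) \<longlonglongrightarrow> (\<integral>x. indicator (box l r) x * h x \<partial>lborel)"
    proof (rule integral_dominated_convergence[where w = "\<lambda>x. \<bar>indicator (box l r) x * h x\<bar>"])
      show "AE x in lborel. (\<lambda>n. box_bump l r n x * h x) \<longlonglongrightarrow> indicator (box l r) x * h x"
        by (intro AE_I2 tendsto_intros box_bump_tendsto)
      show "AE x in lborel. norm (box_bump l r n x * h x) \<le> \<bar>indicator (box l r) x * h x\<bar>" for n
        using box_bump_bounds[of l r n] by (intro AE_I2) (simp add: abs_mult mult_right_mono)
    qed (use int in \<open>auto intro: integrable_abs\<close>)
    moreover have "(\<integral>x. box_bump l r n x * h x \<partial>lborel) = 0" for n
    proof -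
      have "(\<integral>x. box_bump l r n x * h x \<partial>lborel) = (\<integral>x. box_bump l r n x * h x \<partial>lebesgue)"
        by (subst integral_completion) auto
      also have "\<dots> = (\<integral>x. box_bump l r n x * g x \<partial>lebesgue)"
        using gm gh'
        by (intro integral_cong_AE borel_measurable_times borel_measurable_lebesgueI[of "box_bump l r n"]
            borel_measurable_lebesgueI[of h]) (auto elim: eventually_mono)
      finally show ?thesis using zero[OF test_function_box_bump] by simp
    qed
    ultimately show ?thesis by (simp add: LIMSEQ_const_iff)
  qed
  then have "AE x in lborel. h x \<le> 0" "AE x in lborel. - h x \<le> 0"
    using int AE_nonpos_if_box_integrals_0[of h] AE_nonpos_if_box_integrals_0[of "\<lambda>x. - h x"] by auto
  then have "AE x in lborel. g x = 0"
    using gh by eventually_elim simp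
  then show ?thesis by (simp add: AE_completion)
qed

lemma square_integrable_test_function:
  assumes "test_function \<phi>"
  shows "square_integrable (\<lambda>x. complex_of_real (\<phi> x))"
proof -
  obtain K where K: "compact K" "\<And>x. x \<notin> K \<Longrightarrow> \<phi> x = 0"
    using test_functionE[OF assms] by metis
  have c: "continuous_on S \<phi>" for S using assms by (rule test_function_continuous)
  have [measurable]: "\<phi> \<in> borel_measurable borel"
    by (intro borel_measurable_continuous_onI c)
  have "integrable lborel (\<lambda>x. indicator K x *\<^sub>R (\<phi> x)\<^sup>2)"
    by (intro borel_integrable_compact K continuous_intros c)
  moreover have "(\<lambda>x. indicator K x *\<^sub>R (\<phi> x)\<^sup>2) = (\<lambda>x. (\<phi> x)\<^sup>2)"
    using K(2) by (auto simp: indicator_def fun_eq_iff)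
  ultimately have "integrable lebesgue (\<lambda>x. (\<phi> x)\<^sup>2)"
    by (simp add: integrable_completion)
  moreover have "(\<lambda>x. complex_of_real (\<phi> x)) \<in> borel_measurable lebesgue"
    by (rule borel_measurable_lebesgueI) simp
  ultimately show ?thesis by (simp add: square_integrable_def)
qed

section \<open>Test vectors and their density\<close>

definition test_L2 :: "('a::euclidean_space \<Rightarrow> real) \<Rightarrow> 'a L2" where
  "test_L2 \<phi> = abs_L2 (\<lambda>x. of_real (\<phi> x))"

text \<open>The complex integrals in the definition of weak derivatives are recovered from two real
  inner products: \<open>\<phi>\<close> sees the real part, and its multiple by the imaginary unit
  sees the imaginary part.\<close>

lemma inner_test_L2:
  "test_function \<phi> \<Longrightarrow> test_L2 \<phi> \<bullet> u = Re (\<integral>x. \<phi> x *\<^sub>R rep_L2 u x \<partial>lebesgue)"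
  and inner_i_test_L2:
  "test_function \<phi> \<Longrightarrow> (\<i> *\<^sub>C test_L2 \<phi>) \<bullet> u = Im (\<integral>x. \<phi> x *\<^sub>R rep_L2 u x \<partial>lebesgue)"
proof -
  assume \<phi>: "test_function \<phi>"
  note sq = square_integrable_test_function[OF \<phi>]
  have int: "integrable lebesgue (\<lambda>x. \<phi> x *\<^sub>R rep_L2 u x)"
  proof (rule Bochner_Integration.integrable_bound)
    show "integrable lebesgue (\<lambda>x. (cmod (of_real (\<phi> x)))\<^sup>2 + (cmod (rep_L2 u x))\<^sup>2)"
      using sq by (intro Bochner_Integration.integrable_add rep_L2_integrable) (auto simp: square_integrable_def)
    have [measurable]: "\<phi> \<in> borel_measurable borel"
      by (intro borel_measurable_continuous_onI test_function_continuous \<phi>)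
    have "\<phi> \<in> borel_measurable lebesgue"
      by (rule measurable_completion) simp
    then show "(\<lambda>x. \<phi> x *\<^sub>R rep_L2 u x) \<in> borel_measurable lebesgue"
      by (intro borel_measurable_scaleR rep_L2_measurable)
    have "\<bar>a\<bar> * b \<le> a\<^sup>2 + b\<^sup>2" if "b \<ge> 0" for a b :: real
      using sum_squares_bound[of "\<bar>a\<bar>" b] mult_nonneg_nonneg[OF abs_ge_zero that, of a]
      unfolding mult.assoc power2_abs by linarith
    then show "AE x in lebesgue. norm (\<phi> x *\<^sub>R rep_L2 u x) \<le> norm ((cmod (of_real (\<phi> x)))\<^sup>2 + (cmod (rep_L2 u x))\<^sup>2)"
      by simp
  qed
  show "test_L2 \<phi> \<bullet> u = Re (\<integral>x. \<phi> x *\<^sub>R rep_L2 u x \<partial>lebesgue)"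
    unfolding test_L2_def inner_abs_L2_left[OF sq] integral_Re[OF int, symmetric]
    by (intro Bochner_Integration.integral_cong) (auto simp: inner_complex_def)
  show "(\<i> *\<^sub>C test_L2 \<phi>) \<bullet> u = Im (\<integral>x. \<phi> x *\<^sub>R rep_L2 u x \<partial>lebesgue)"
    unfolding test_L2_def abs_L2_cscale[OF sq] inner_abs_L2_left[OF square_integrable_mult[OF sq]]
      integral_Im[OF int, symmetric]
    by (intro Bochner_Integration.integral_cong) (auto simp: inner_complex_def)
qed

text \<open>Test functions are real-valued, so a dense subspace of the complex space needs two of
  them, for the real and the imaginary part.\<close>

definition test_vectors :: "'a::euclidean_space L2 set" where
  "test_vectors = {test_L2 \<phi> + \<i> *\<^sub>C test_L2 \<psi> |\<phi> \<psi>. test_function \<phi> \<and> test_function \<psi>}"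

lemma test_L2_add:
  "test_function \<phi> \<Longrightarrow> test_function \<psi> \<Longrightarrow> test_L2 \<phi> + test_L2 \<psi> = test_L2 (\<lambda>x. \<phi> x + \<psi> x)"
  by (simp add: test_L2_def abs_L2_add square_integrable_test_function)

lemma test_L2_scaleR: "test_function \<phi> \<Longrightarrow> c *\<^sub>R test_L2 \<phi> = test_L2 (\<lambda>x. c * \<phi> x)"
  by (simp add: test_L2_def scaleR_cscale abs_L2_cscale square_integrable_test_function)

lemma test_function_0: "test_function (\<lambda>x. 0)"
  by (rule test_functionI[of _ "{}"]) (auto intro: C_k_const)

lemma test_L2_0: "test_L2 (\<lambda>x. 0) = 0"
  by (simp add: test_L2_def zero_L2_def)

lemma test_L2_in_test_vectors: "test_function \<phi> \<Longrightarrow> test_L2 \<phi> \<in> test_vectors"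
  unfolding test_vectors_def using test_function_0 test_L2_0
  by (metis (mono_tags, lifting) L2.scale_zero_right add.right_neutral mem_Collect_eq)

lemma i_test_L2_in_test_vectors: "test_function \<phi> \<Longrightarrow> \<i> *\<^sub>C test_L2 \<phi> \<in> test_vectors"
  unfolding test_vectors_def using test_function_0 test_L2_0
  by (metis (mono_tags, lifting) add.left_neutral mem_Collect_eq)

lemma subspace_test_vectors: "subspace (test_vectors :: 'a::euclidean_space L2 set)"
  unfolding subspace_def
proof (intro conjI ballI allI)
  show "0 \<in> test_vectors"
    using test_L2_in_test_vectors[OF test_function_0] by (simp add: test_L2_0)
  fix u :: "'a L2" assume "u \<in> test_vectors"
  then obtain \<phi> \<psi> where u: "u = test_L2 \<phi> + \<i> *\<^sub>C test_L2 \<psi>" "test_function \<phi>" "test_function \<psi>"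
    by (auto simp: test_vectors_def)
  {
    fix v :: "'a L2" assume "v \<in> test_vectors"
    then obtain \<phi>' \<psi>' where v: "v = test_L2 \<phi>' + \<i> *\<^sub>C test_L2 \<psi>'" "test_function \<phi>'" "test_function \<psi>'"
      by (auto simp: test_vectors_def)
    have "u + v = test_L2 (\<lambda>x. \<phi> x + \<phi>' x) + \<i> *\<^sub>C test_L2 (\<lambda>x. \<psi> x + \<psi>' x)"
      using u v by (simp add: test_L2_add[symmetric] L2.scale_right_distrib)
    then show "u + v \<in> test_vectors"
      using u v test_function_add unfolding test_vectors_def by blast
  next
    fix c :: real
    have "c *\<^sub>R u = test_L2 (\<lambda>x. c * \<phi> x) + \<i> *\<^sub>C test_L2 (\<lambda>x. c * \<psi> x)"
      using u by (simp add: test_L2_scaleR[symmetric] scaleR_add_right)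
        (simp add: scaleR_cscale L2.scale_left_commute mult.commute)
    then show "c *\<^sub>R u \<in> test_vectors"
      using u test_function_cmult unfolding test_vectors_def by blast
  }
qed

lemma L2_eq_0_if_orthogonal_test_vectors:
  assumes "\<And>v. v \<in> test_vectors \<Longrightarrow> v \<bullet> u = 0"
  shows "u = 0"
proof -
  have zero: "(\<integral>x. \<phi> x *\<^sub>R rep_L2 u x \<partial>lebesgue) = 0" if "test_function \<phi>" for \<phi>
    using assms[OF test_L2_in_test_vectors[OF that]] assms[OF i_test_L2_in_test_vectors[OF that]]
    by (simp add: inner_test_L2[OF that] inner_i_test_L2[OF that] complex_eq_iff)
  have int: "integrable lebesgue (\<lambda>x. \<phi> x *\<^sub>R rep_L2 u x)" if "test_function \<phi>" for \<phi>
  proof -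
    have "integrable lebesgue (\<lambda>x. of_real (\<phi> x) \<bullet> rep_L2 u x)"
         "integrable lebesgue (\<lambda>x. (\<i> * of_real (\<phi> x)) \<bullet> rep_L2 u x)"
      by (intro integrable_inner_L2 rep_L2_square_integrable square_integrable_mult
            square_integrable_test_function that)+
    then have "integrable lebesgue (\<lambda>x. complex_of_real (of_real (\<phi> x) \<bullet> rep_L2 u x) +
        \<i> * complex_of_real ((\<i> * of_real (\<phi> x)) \<bullet> rep_L2 u x))"
      by (intro Bochner_Integration.integrable_add integrable_mult_right integrable_of_real)
    moreover have "complex_of_real (of_real (\<phi> x) \<bullet> rep_L2 u x) +
        \<i> * complex_of_real ((\<i> * of_real (\<phi> x)) \<bullet> rep_L2 u x) = \<phi> x *\<^sub>R rep_L2 u x" for x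
      by (simp add: complex_eq_iff inner_complex_def)
    ultimately show ?thesis by simp
  qed
  have sq: "integrable lebesgue (\<lambda>x. (Re (rep_L2 u x))\<^sup>2)" "integrable lebesgue (\<lambda>x. (Im (rep_L2 u x))\<^sup>2)"
    by (auto intro!: Bochner_Integration.integrable_bound[OF rep_L2_integrable[of u]] simp: cmod_power2)
  have "AE x in lebesgue. Re (rep_L2 u x) = 0"
  proof (rule AE_0_if_test_integrals_0)
    show "(\<integral>x. \<phi> x * Re (rep_L2 u x) \<partial>lebesgue) = 0" if "test_function \<phi>" for \<phi>
      using zero[OF that] integral_Re[OF int[OF that]] by simp
  qed (use sq in auto)
  moreover have "AE x in lebesgue. Im (rep_L2 u x) = 0"
  proof (rule AE_0_if_test_integrals_0)
    show "(\<integral>x. \<phi> x * Im (rep_L2 u x) \<partial>lebesgue) = 0" if "test_function \<phi>" for \<phi>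
      using zero[OF that] integral_Im[OF int[OF that]] by simp
  qed (use sq in auto)
  ultimately show "u = 0"
  proof (intro L2_eqI)
    assume "AE x in lebesgue. Re (rep_L2 u x) = 0" "AE x in lebesgue. Im (rep_L2 u x) = 0"
    then show "AE x in lebesgue. rep_L2 u x = rep_L2 0 x"
      using rep_L2_zero by eventually_elim (simp add: complex_eq_iff)
  qed
qed

lemma subspace_closure:
  fixes S :: "'a::real_normed_vector set"
  assumes "subspace S" shows "subspace (closure S)"
  unfolding subspace_def
proof (intro conjI ballI allI)
  show "0 \<in> closure S" using subspace_0[OF assms] closure_subset by blast
  fix x c assume "x \<in> closure S"
  then obtain f where f: "\<And>n. f n \<in> S" "f \<longlonglongrightarrow> x" by (auto simp: closure_sequential)
  show "c *\<^sub>R x \<in> closure S"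
    unfolding closure_sequential
    using f by (intro exI[of _ "\<lambda>n. c *\<^sub>R f n"]) (auto intro: tendsto_intros subspace_scale[OF assms])
  fix y assume "y \<in> closure S"
  then obtain g where g: "\<And>n. g n \<in> S" "g \<longlonglongrightarrow> y" by (auto simp: closure_sequential)
  show "x + y \<in> closure S"
    unfolding closure_sequential
    using f g by (intro exI[of _ "\<lambda>n. f n + g n"]) (auto intro: tendsto_intros subspace_add[OF assms])
qed

text \<open>The difference between a vector and its projection onto \<open>closure S\<close> is
  orthogonal to \<open>S\<close>. All density statements of the development are reduced in this way
  to uniqueness statements.\<close>

lemma closure_eq_UNIV_if_orthogonal_trivial:
  fixes S :: "'a::{real_inner,complete_space} set"
  assumes "subspace S" "\<And>u. (\<And>v. v \<in> S \<Longrightarrow> v \<bullet> u = 0) \<Longrightarrow> u = 0"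
  shows "closure S = UNIV"
proof -
  have "x \<in> closure S" for x
  proof -
    obtain p where p: "p \<in> closure S" "\<And>s. s \<in> closure S \<Longrightarrow> (x - p) \<bullet> s = 0"
      using orthogonal_projection_exists[of "closure S" x] assms(1)
      by (auto simp: subspace_closure complete_eq_closed)
    have "x - p = 0"
      using p(2) closure_subset[of S] by (intro assms(2)) (auto simp: inner_commute)
    then show ?thesis using p(1) by simp
  qed
  then show ?thesis by blast
qed

lemma closure_test_vectors: "closure test_vectors = (UNIV :: 'a::euclidean_space L2 set)"
  by (intro closure_eq_UNIV_if_orthogonal_trivial subspace_test_vectors L2_eq_0_if_orthogonal_test_vectors)

section \<open>Translations and weak derivatives\<close>

text \<open>Continuity alone does not give measurability for the completed sigma-algebra; both facts
  are instances of the affine change of variables with all scaling factors equal to one.\<close>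

lemma translation_lebesgue_measurable [measurable]:
  "(\<lambda>x. x + a) \<in> lebesgue \<rightarrow>\<^sub>M (lebesgue :: 'a::euclidean_space measure)"
  and distr_lebesgue_translation: "distr lebesgue lebesgue (\<lambda>x. x + a) = (lebesgue :: 'a measure)"
proof -
  have eq: "(\<lambda>x::'a. a + (\<Sum>j\<in>Basis. (1 * (x \<bullet> j)) *\<^sub>R j)) = (\<lambda>x. x + a)"
    by (simp add: euclidean_representation add.commute)
  show "(\<lambda>x. x + a) \<in> lebesgue \<rightarrow>\<^sub>M (lebesgue :: 'a measure)"
    using lebesgue_affine_measurable[of "\<lambda>_. 1" a] unfolding eq by simp
  show "distr lebesgue lebesgue (\<lambda>x. x + a) = (lebesgue :: 'a measure)"
    using lebesgue_affine_euclidean[of "\<lambda>_. 1" a] unfolding eq by (simp add: density_1)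
qed

lemma AE_lebesgue_translation:
  fixes a :: "'a::euclidean_space"
  assumes "AE x in lebesgue. P x" shows "AE x in lebesgue. P (x + a)"
  using AE_distrD[of "\<lambda>x. x + a" lebesgue lebesgue P] assms
  unfolding distr_lebesgue_translation by (simp add: translation_lebesgue_measurable)

lemma square_integrable_translation:
  assumes "square_integrable f" shows "square_integrable (\<lambda>x. f (x + a))"
proof -
  have [measurable]: "f \<in> borel_measurable lebesgue"
    using assms by (simp add: square_integrable_def)
  have "integrable (distr lebesgue lebesgue (\<lambda>x. x + a)) (\<lambda>x. (cmod (f x))\<^sup>2)"
    using assms by (simp add: square_integrable_def distr_lebesgue_translation)
  then show ?thesis
    by (simp add: square_integrable_def integrable_distr_eq)
qed

lemma integral_lebesgue_translation:
  fixes f :: "_ \<Rightarrow> 'b::{banach, second_countable_topology}"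
  assumes [measurable]: "f \<in> borel_measurable lebesgue"
  shows "(\<integral>x. f (x + a) \<partial>lebesgue) = (\<integral>x. f x \<partial>lebesgue)"
proof -
  have "(\<integral>x. f x \<partial>lebesgue) = (\<integral>x. f x \<partial>distr lebesgue lebesgue (\<lambda>x. x + a))"
    by (simp add: distr_lebesgue_translation)
  also have "\<dots> = (\<integral>x. f (x + a) \<partial>lebesgue)"
    by (intro integral_distr) measurable
  finally show ?thesis ..
qed

definition translate :: "'a::euclidean_space \<Rightarrow> 'a L2 \<Rightarrow> 'a L2" where
  "translate a u = abs_L2 (\<lambda>x. rep_L2 u (x + a))"

lemma rep_translate: "AE x in lebesgue. rep_L2 (translate a u) x = rep_L2 u (x + a)"
  unfolding translate_def by (intro rep_abs_L2 square_integrable_translation rep_L2_square_integrable)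

lemma translate_abs_L2:
  assumes "square_integrable f" shows "translate a (abs_L2 f) = abs_L2 (\<lambda>x. f (x + a))"
  unfolding translate_def
  using AE_lebesgue_translation[OF rep_abs_L2[OF assms]]
  by (subst abs_L2_eq_iff) (auto intro: square_integrable_translation assms rep_L2_square_integrable)

lemma translate_0 [simp]: "translate 0 u = u"
  by (simp add: translate_def)

lemma translate_translate: "translate a (translate b u) = translate (a + b) u"
  unfolding translate_def[of b u]
  by (subst translate_abs_L2)
     (auto simp: translate_def add.assoc intro: square_integrable_translation rep_L2_square_integrable)

lemma translate_commute: "translate a (translate b u) = translate b (translate a u)"
  by (simp add: translate_translate add.commute)

lemma translate_add: "translate a (u + v) = translate a u + translate a v"
proof (rule L2_eqI)
  show "AE x in lebesgue. rep_L2 (translate a (u + v)) x = rep_L2 (translate a u + translate a v) x"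
    using rep_translate[of a "u + v"] AE_lebesgue_translation[OF rep_L2_add[of u v], of a]
      rep_L2_add[of "translate a u" "translate a v"] rep_translate[of a u] rep_translate[of a v]
    by eventually_elim simp
qed

lemma translate_cscale: "translate a (c *\<^sub>C u) = c *\<^sub>C translate a u"
proof (rule L2_eqI)
  show "AE x in lebesgue. rep_L2 (translate a (c *\<^sub>C u)) x = rep_L2 (c *\<^sub>C translate a u) x"
    using rep_translate[of a "c *\<^sub>C u"] AE_lebesgue_translation[OF rep_L2_cscale[of c u], of a]
      rep_L2_cscale[of c "translate a u"] rep_translate[of a u]
    by eventually_elim simp
qed

lemma inner_translate: "translate a u \<bullet> translate a v = u \<bullet> v"
  unfolding translate_def
  by (subst inner_abs_L2)
     (auto intro!: square_integrable_translation rep_L2_square_integrable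
        simp: inner_L2_eq integral_lebesgue_translation[of "\<lambda>x. rep_L2 u x \<bullet> rep_L2 v x"])

lemma norm_translate [simp]: "norm (translate a u) = norm u"
  by (simp add: norm_eq_sqrt_inner inner_translate)

lemma translate_adjoint: "translate a u \<bullet> v = u \<bullet> translate (- a) v"
  using inner_translate[of "- a" "translate a u" v] by (simp add: translate_translate)

lemma bounded_linear_translate: "bounded_linear (translate a)"
proof
  show "translate a (r *\<^sub>R u) = r *\<^sub>R translate a u" for r u
    by (simp add: scaleR_cscale translate_cscale)
  show "\<exists>K. \<forall>x. norm (translate a x) \<le> norm x * K"
    by (intro exI[of _ 1]) simp
qed (rule translate_add)

lemma translate_diff: "translate a (u - v) = translate a u - translate a v"
  by (rule linear_diff[OF bounded_linear.linear[OF bounded_linear_translate]])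

lemma translate_test_L2: "test_function \<phi> \<Longrightarrow> translate a (test_L2 \<phi>) = test_L2 (\<lambda>x. \<phi> (x + a))"
  by (simp add: test_L2_def translate_abs_L2 square_integrable_test_function)

lemma translate_test_vectors: "u \<in> test_vectors \<Longrightarrow> translate a u \<in> test_vectors"
  unfolding test_vectors_def
  by (force simp: translate_add translate_cscale translate_test_L2 intro: test_function_translate)

section \<open>Generators of the translation groups\<close>

text \<open>The strong derivative of the orbit at the origin. In this form linearity, uniqueness and
  commutation with bounded operators come from ordinary calculus, with no test functions
  involved.\<close>

definition has_L2_deriv :: "'a::euclidean_space \<Rightarrow> 'a L2 \<Rightarrow> 'a L2 \<Rightarrow> bool" where
  "has_L2_deriv b u v \<longleftrightarrow> ((\<lambda>s. translate (s *\<^sub>R b) u) has_vector_derivative v) (at 0)"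

lemma vector_derivative_bound:
  fixes f :: "real \<Rightarrow> 'b::real_normed_vector"
  assumes "\<And>r. \<bar>r\<bar> \<le> \<bar>s\<bar> \<Longrightarrow> (f has_vector_derivative f' r) (at r)"
    and "\<And>r. \<bar>r\<bar> \<le> \<bar>s\<bar> \<Longrightarrow> norm (f' r) \<le> C"
  shows "norm (f s - f 0) \<le> C * \<bar>s\<bar>"
proof -
  have "norm (f s - f 0) \<le> C * norm (s - 0)"
  proof (rule differentiable_bound[where S = "{- \<bar>s\<bar>..\<bar>s\<bar>}" and f' = "\<lambda>r h. h *\<^sub>R f' r"])
    fix r assume "r \<in> {- \<bar>s\<bar>..\<bar>s\<bar>}"
    then have r: "\<bar>r\<bar> \<le> \<bar>s\<bar>" by auto
    show "(f has_derivative (\<lambda>h. h *\<^sub>R f' r)) (at r within {- \<bar>s\<bar>..\<bar>s\<bar>})"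
      using assms(1)[OF r] unfolding has_vector_derivative_def by (rule has_derivative_at_withinI)
    show "onorm (\<lambda>h. h *\<^sub>R f' r) \<le> C"
      using assms(2)[OF r] by (intro onorm_le) (simp add: mult.commute[of C] mult_left_mono)
  qed auto
  then show ?thesis by simp
qed

lemma has_L2_deriv_alt:
  "has_L2_deriv b u v \<longleftrightarrow>
    (\<forall>e>0. \<exists>d>0. \<forall>s. \<bar>s\<bar> < d \<longrightarrow> norm (translate (s *\<^sub>R b) u - u - s *\<^sub>R v) \<le> e * \<bar>s\<bar>)"
  unfolding has_L2_deriv_def has_vector_derivative_def has_derivative_at_alt
  by (simp add: bounded_linear_scaleR_left)

lemma has_L2_deriv_unique: "has_L2_deriv b u v \<Longrightarrow> has_L2_deriv b u w \<Longrightarrow> v = w"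
  unfolding has_L2_deriv_def by (rule vector_derivative_unique_at)

lemma has_L2_deriv_add:
  "has_L2_deriv b u v \<Longrightarrow> has_L2_deriv b u' v' \<Longrightarrow> has_L2_deriv b (u + u') (v + v')"
  unfolding has_L2_deriv_def translate_add by (rule has_vector_derivative_add)

lemma has_L2_deriv_bounded_linear:
  assumes "has_L2_deriv b u v" "bounded_linear T" "\<And>a w. translate a (T w) = T (translate a w)"
  shows "has_L2_deriv b (T u) (T v)"
  using assms(1) unfolding has_L2_deriv_def assms(3)
  by (rule bounded_linear.has_vector_derivative[OF assms(2)])

lemma has_L2_deriv_cscale: "has_L2_deriv b u v \<Longrightarrow> has_L2_deriv b (c *\<^sub>C u) (c *\<^sub>C v)"
  by (erule has_L2_deriv_bounded_linear) (rule bounded_linear_cscale translate_cscale)+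

lemma has_L2_deriv_scaleR: "has_L2_deriv b u v \<Longrightarrow> has_L2_deriv b (r *\<^sub>R u) (r *\<^sub>R v)"
  unfolding scaleR_cscale by (rule has_L2_deriv_cscale)

lemma has_L2_deriv_diff:
  assumes "has_L2_deriv b u v" "has_L2_deriv b u' v'"
  shows "has_L2_deriv b (u - u') (v - v')"
  using has_L2_deriv_add[OF assms(1) has_L2_deriv_scaleR[OF assms(2), of "-1"]] by simp

lemma has_L2_deriv_translate: "has_L2_deriv b u v \<Longrightarrow> has_L2_deriv b (translate a u) (translate a v)"
  by (erule has_L2_deriv_bounded_linear) (rule bounded_linear_translate translate_commute)+

text \<open>The group law moves the derivative from the origin to any other parameter.\<close>

lemma has_L2_deriv_at:
  assumes "has_L2_deriv b u v"
  shows "((\<lambda>s. translate (s *\<^sub>R b) u) has_vector_derivative translate (t *\<^sub>R b) v) (at t)"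
proof -
  have "((\<lambda>s. translate (s *\<^sub>R b) (translate (t *\<^sub>R b) u)) has_vector_derivative translate (t *\<^sub>R b) v)
      (at (t - t))"
    using has_L2_deriv_translate[OF assms, of "t *\<^sub>R b"] unfolding has_L2_deriv_def by simp
  moreover have "((\<lambda>s. s - t) has_vector_derivative 1) (at t)"
    by (auto intro!: derivative_eq_intros)
  ultimately have "((\<lambda>s. translate (s *\<^sub>R b) (translate (t *\<^sub>R b) u)) \<circ> (\<lambda>s. s - t)
     has_vector_derivative 1 *\<^sub>R translate (t *\<^sub>R b) v) (at t)"
    by (rule vector_diff_chain_at[rotated])
  then show ?thesis by (simp add: o_def translate_translate flip: scaleR_add_left)
qed

lemma has_L2_deriv_norm_le:
  assumes "has_L2_deriv b u v"
  shows "norm (translate (s *\<^sub>R b) u - u) \<le> norm v * \<bar>s\<bar>"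
  using vector_derivative_bound[OF has_L2_deriv_at[OF assms], of s "norm v"] by simp

text \<open>Integration by parts without integrals: translations are isometries, so \<open>translate
  (s *\<^sub>R b) u \<bullet> translate (s *\<^sub>R b) u'\<close> is constant in \<open>s\<close>,
  and its derivative at the origin is the sum of the two terms.\<close>

lemma has_L2_deriv_skew:
  assumes "has_L2_deriv b u v" "has_L2_deriv b u' v'"
  shows "v \<bullet> u' = - (u \<bullet> v')"
proof -
  have "((\<lambda>s. translate (s *\<^sub>R b) u \<bullet> translate (s *\<^sub>R b) u') has_vector_derivative
      (u \<bullet> v' + v \<bullet> u')) (at 0)"
    using bounded_bilinear.has_vector_derivative[OF bounded_bilinear_inner
        assms[unfolded has_L2_deriv_def]] by simp
  moreover have "((\<lambda>s. translate (s *\<^sub>R b) u \<bullet> translate (s *\<^sub>R b) u') has_vector_derivative 0) (at 0)"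
    by (simp add: inner_translate)
  ultimately have "u \<bullet> v' + v \<bullet> u' = 0" by (rule vector_derivative_unique_at)
  then show ?thesis by simp
qed

text \<open>The partial derivative is uniformly continuous, so the mean value inequality bounds the
  Taylor remainder uniformly by a small multiple of \<open>\<bar>s\<bar>\<close>; it is supported in
  a fixed ball, which turns the uniform bound into an \<open>L2\<close> bound.\<close>

lemma has_L2_deriv_test_L2:
  assumes \<phi>: "test_function \<phi>" and b: "b \<in> Basis"
  shows "has_L2_deriv b (test_L2 \<phi>) (test_L2 (\<lambda>x. frechet_derivative \<phi> (at x) b))"
  unfolding has_L2_deriv_alt
proof (intro allI impI)
  fix e :: real assume e: "0 < e"
  define g where "g x = frechet_derivative \<phi> (at x) b" for x
  have g: "test_function g" unfolding g_def using \<phi> b by (rule test_function_deriv)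
  have nb: "norm b = 1" using b by simp
  obtain K L where K: "compact K" "\<And>x. x \<notin> K \<Longrightarrow> \<phi> x = 0" and L: "compact L" "\<And>x. x \<notin> L \<Longrightarrow> g x = 0"
    using test_functionE[OF \<phi>] test_functionE[OF g] by metis
  obtain R where R: "K \<union> L \<subseteq> cball 0 R"
    using K(1) L(1) using bounded_Un[of K L] bounded_subset_ballD[of "K \<union> L" 0] ball_subset_cball K(1) L(1)
    by (metis compact_imp_bounded order_trans)
  \<comment> \<open>For \<open>\<bar>s\<bar> < 1\<close> the remainder vanishes outside the ball of
    radius \<open>R + 1\<close>, whose measure is \<open>M\<close>. The added one in
    \<open>e'\<close> keeps the quotient meaningful and gives \<open>e' * sqrt M \<le> e\<close>.
    Uniform continuity is taken on radius \<open>R + 2\<close> so that the shifted points stay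
    inside.\<close>
  define M where "M = measure lborel (cball (0::'a) (R + 1))"
  have M0: "0 \<le> M" by (simp add: M_def)
  define e' where "e' = e / (sqrt M + 1)"
  have e': "0 < e'" using e M0 by (simp add: e'_def add_nonneg_pos)
  have "uniformly_continuous_on (cball 0 (R + 2)) g"
    by (intro compact_uniformly_continuous test_function_continuous[OF g]) simp
  then obtain d0 where d0: "d0 > 0"
    "\<And>x y. x \<in> cball 0 (R + 2) \<Longrightarrow> y \<in> cball 0 (R + 2) \<Longrightarrow> dist y x < d0 \<Longrightarrow> dist (g y) (g x) < e'"
    using e' unfolding uniformly_continuous_on_def by metis
  define d where "d = min d0 1"
  have d: "0 < d" "d \<le> d0" "d \<le> 1" using d0(1) by (auto simp: d_def)
  have pw: "\<bar>\<phi> (x + s *\<^sub>R b) - \<phi> x - s * g x\<bar> \<le> (e' * \<bar>s\<bar>) * indicator (cball 0 (R + 1)) x"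
    if s: "\<bar>s\<bar> < d" for s x
  proof (cases "x \<in> cball 0 (R + 1)")
    case False
    have "norm x \<le> norm (x + s *\<^sub>R b) + \<bar>s\<bar>"
      using norm_triangle_ineq4[of "x + s *\<^sub>R b" "s *\<^sub>R b"] nb by simp
    then have "x + s *\<^sub>R b \<notin> cball 0 R" "x \<notin> cball 0 R"
      using False s d by auto
    then have "\<phi> (x + s *\<^sub>R b) = 0" "\<phi> x = 0" "g x = 0"
      using R by (auto intro!: K(2) L(2))
    then show ?thesis using False by simp
  next
    case True
    have "norm ((\<phi> (x + s *\<^sub>R b) - s * g x) - (\<phi> (x + 0 *\<^sub>R b) - 0 * g x)) \<le> e' * \<bar>s\<bar>"
    proof (rule vector_derivative_bound[where f' = "\<lambda>r. g (x + r *\<^sub>R b) - g x"])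
      fix r assume r: "\<bar>r\<bar> \<le> \<bar>s\<bar>"
      have "((\<lambda>r. x + r *\<^sub>R b) has_derivative (\<lambda>h. h *\<^sub>R b)) (at r)"
        by (auto intro!: derivative_eq_intros)
      from has_derivative_compose[OF this test_function_has_derivative[OF \<phi>]]
      have "((\<lambda>r. \<phi> (x + r *\<^sub>R b)) has_derivative
          (\<lambda>h. frechet_derivative \<phi> (at (x + r *\<^sub>R b)) (h *\<^sub>R b))) (at r)" .
      moreover have "frechet_derivative \<phi> (at (x + r *\<^sub>R b)) (h *\<^sub>R b) = h *\<^sub>R g (x + r *\<^sub>R b)" for h
        unfolding g_def
        by (rule linear_scale[OF has_derivative_linear[OF test_function_has_derivative[OF \<phi>]]])
      ultimately have "((\<lambda>r. \<phi> (x + r *\<^sub>R b)) has_vector_derivative g (x + r *\<^sub>R b)) (at r)"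
        by (simp add: has_vector_derivative_def)
      moreover have "((\<lambda>r. r * g x) has_vector_derivative g x) (at r)"
        by (auto intro!: derivative_eq_intros simp: has_vector_derivative_def)
      ultimately show "((\<lambda>r. \<phi> (x + r *\<^sub>R b) - r * g x) has_vector_derivative g (x + r *\<^sub>R b) - g x) (at r)"
        by (rule has_vector_derivative_diff)
      have "norm (x + r *\<^sub>R b) \<le> norm x + \<bar>r\<bar>"
        using norm_triangle_ineq[of x "r *\<^sub>R b"] nb by simp
      then have "x + r *\<^sub>R b \<in> cball 0 (R + 2)" "x \<in> cball 0 (R + 2)"
        using True r s d by auto
      moreover have "dist (x + r *\<^sub>R b) x < d0"
        using r s d nb by (simp add: dist_norm)
      ultimately show "norm (g (x + r *\<^sub>R b) - g x) \<le> e'"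
        using d0(2)[of x "x + r *\<^sub>R b"] by (simp add: dist_norm)
    qed
    then show ?thesis using True by (simp add: algebra_simps)
  qed
  show "\<exists>d>0. \<forall>s. \<bar>s\<bar> < d \<longrightarrow> norm (translate (s *\<^sub>R b) (test_L2 \<phi>) - test_L2 \<phi> -
      s *\<^sub>R test_L2 (\<lambda>x. frechet_derivative \<phi> (at x) b)) \<le> e * \<bar>s\<bar>"
  proof (intro exI[of _ d] conjI allI impI)
    show "0 < d" by (rule d)
    fix s assume s: "\<bar>s\<bar> < d"
    let ?\<psi> = "\<lambda>x. \<phi> (x + s *\<^sub>R b) + (- 1) * \<phi> x + (- s) * g x"
    have \<psi>: "test_function ?\<psi>"
      by (intro test_function_add test_function_cmult test_function_translate \<phi> g)
    have "translate (s *\<^sub>R b) (test_L2 \<phi>) - test_L2 \<phi> - s *\<^sub>R test_L2 g =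
        translate (s *\<^sub>R b) (test_L2 \<phi>) + (- 1) *\<^sub>R test_L2 \<phi> + (- s) *\<^sub>R test_L2 g"
      by simp
    also have "\<dots> = test_L2 ?\<psi>"
      using \<phi> g by (simp only: translate_test_L2 test_L2_scaleR test_L2_add test_function_add
          test_function_cmult test_function_translate)
    finally have eq: "translate (s *\<^sub>R b) (test_L2 \<phi>) - test_L2 \<phi> - s *\<^sub>R test_L2 g = test_L2 ?\<psi>" .
    have "norm (test_L2 ?\<psi>) \<le> e' * \<bar>s\<bar> * sqrt M"
      unfolding test_L2_def
    proof (rule norm_abs_L2_le[OF square_integrable_test_function[OF \<psi>]])
      show "0 \<le> e' * \<bar>s\<bar> * sqrt M" using e' M0 by simp
      have "(\<integral>\<^sup>+x. ennreal ((cmod (complex_of_real (?\<psi> x)))\<^sup>2) \<partial>lebesgue)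
         \<le> (\<integral>\<^sup>+x. ennreal ((e' * \<bar>s\<bar>)\<^sup>2) * indicator (cball (0::'a) (R + 1)) x \<partial>lebesgue)"
      proof (intro nn_integral_mono)
        fix x
        have "\<bar>?\<psi> x\<bar>\<^sup>2 \<le> ((e' * \<bar>s\<bar>) * indicator (cball 0 (R + 1)) x)\<^sup>2"
          using pw[OF s, of x] by (intro power_mono) auto
        then show "ennreal ((cmod (complex_of_real (?\<psi> x)))\<^sup>2)
            \<le> ennreal ((e' * \<bar>s\<bar>)\<^sup>2) * indicator (cball 0 (R + 1)) x"
          by (cases "x \<in> cball 0 (R + 1)") (simp_all only: norm_of_real indicator_simps mult_1_right
              mult_zero_right power_zero_numeral ennreal_leI, simp)
      qed
      also have "\<dots> = ennreal ((e' * \<bar>s\<bar>)\<^sup>2) * emeasure lebesgue (cball (0::'a) (R + 1))"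
        by (rule nn_integral_cmult_indicator) simp
      also have "emeasure lebesgue (cball (0::'a) (R + 1)) = ennreal M"
        unfolding M_def
        using emeasure_eq_ennreal_measure[of lborel "cball (0::'a) (R + 1)"]
          emeasure_compact_finite[OF compact_cball, of "0::'a" "R + 1"] by auto
      also have "ennreal ((e' * \<bar>s\<bar>)\<^sup>2) * ennreal M = ennreal ((e' * \<bar>s\<bar> * sqrt M)\<^sup>2)"
        using M0 by (simp add: ennreal_mult[symmetric] power_mult_distrib)
      finally show "(\<integral>\<^sup>+x. ennreal ((cmod (complex_of_real (?\<psi> x)))\<^sup>2) \<partial>lebesgue)
         \<le> ennreal ((e' * \<bar>s\<bar> * sqrt M)\<^sup>2)" .
    qed
    also have "\<dots> \<le> e * \<bar>s\<bar>"
    proof -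
      have "0 < sqrt M + 1" using M0 by (simp add: add_nonneg_pos)
      then have "e' * sqrt M \<le> e" using e by (simp add: e'_def pos_divide_le_eq distrib_left)
      then show ?thesis using mult_right_mono[of "e' * sqrt M" e "\<bar>s\<bar>"] by (simp add: mult_ac)
    qed
    finally show "norm (translate (s *\<^sub>R b) (test_L2 \<phi>) - test_L2 \<phi> -
      s *\<^sub>R test_L2 (\<lambda>x. frechet_derivative \<phi> (at x) b)) \<le> e * \<bar>s\<bar>"
      using eq unfolding g_def by simp
  qed
qed

text \<open>Rewrites the weak derivative as an adjointness relation against test vectors. From here
  on, integrals and representatives no longer occur in the treatment of derivatives.\<close>

lemma has_weak_deriv_inner:
  assumes b: "b \<in> Basis"
  shows "has_weak_deriv b u v \<longleftrightarrow> (\<forall>\<tau> \<tau>'. \<tau> \<in> test_vectors \<longrightarrow> has_L2_deriv b \<tau> \<tau>' \<longrightarrow> \<tau>' \<bullet> u = - (\<tau> \<bullet> v))"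
    (is "_ \<longleftrightarrow> ?R")
proof
  assume w: "has_weak_deriv b u v"
  have eq: "test_L2 (\<lambda>x. frechet_derivative \<phi> (at x) b) \<bullet> u = - (test_L2 \<phi> \<bullet> v)"
    "(\<i> *\<^sub>C test_L2 (\<lambda>x. frechet_derivative \<phi> (at x) b)) \<bullet> u = - ((\<i> *\<^sub>C test_L2 \<phi>) \<bullet> v)"
    if "test_function \<phi>" for \<phi>
    using w that by (simp_all add: has_weak_deriv_def inner_test_L2 inner_i_test_L2 test_function_deriv b)
  show ?R
  proof (intro allI impI)
    fix \<tau> \<tau>' assume \<tau>: "\<tau> \<in> test_vectors" and \<tau>': "has_L2_deriv b \<tau> \<tau>'"
    obtain \<phi> \<psi> where \<phi>: "\<tau> = test_L2 \<phi> + \<i> *\<^sub>C test_L2 \<psi>" "test_function \<phi>" "test_function \<psi>"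
      using \<tau> by (auto simp: test_vectors_def)
    have "has_L2_deriv b \<tau> (test_L2 (\<lambda>x. frechet_derivative \<phi> (at x) b) +
        \<i> *\<^sub>C test_L2 (\<lambda>x. frechet_derivative \<psi> (at x) b))"
      unfolding \<phi>(1) by (intro has_L2_deriv_add has_L2_deriv_cscale has_L2_deriv_test_L2 \<phi> b)
    then have "\<tau>' = test_L2 (\<lambda>x. frechet_derivative \<phi> (at x) b) +
        \<i> *\<^sub>C test_L2 (\<lambda>x. frechet_derivative \<psi> (at x) b)"
      using \<tau>' by (rule has_L2_deriv_unique[rotated])
    then show "\<tau>' \<bullet> u = - (\<tau> \<bullet> v)"
      using eq[OF \<phi>(2)] eq[OF \<phi>(3)] \<phi>(1) by (simp add: inner_add_left)
  qed
next
  assume R: ?R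
  show "has_weak_deriv b u v"
    unfolding has_weak_deriv_def
  proof (intro allI impI)
    fix \<phi> :: "'a \<Rightarrow> real" assume \<phi>: "test_function \<phi>"
    have d: "has_L2_deriv b (test_L2 \<phi>) (test_L2 (\<lambda>x. frechet_derivative \<phi> (at x) b))"
      using \<phi> b by (rule has_L2_deriv_test_L2)
    have "test_L2 (\<lambda>x. frechet_derivative \<phi> (at x) b) \<bullet> u = - (test_L2 \<phi> \<bullet> v)"
      using R d test_L2_in_test_vectors[OF \<phi>] by blast
    moreover have "(\<i> *\<^sub>C test_L2 (\<lambda>x. frechet_derivative \<phi> (at x) b)) \<bullet> u = - ((\<i> *\<^sub>C test_L2 \<phi>) \<bullet> v)"
      using R has_L2_deriv_cscale[OF d] i_test_L2_in_test_vectors[OF \<phi>] by blast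
    ultimately show "(\<integral>x. frechet_derivative \<phi> (at x) b *\<^sub>R rep_L2 u x \<partial>lebesgue) =
        - (\<integral>x. \<phi> x *\<^sub>R rep_L2 v x \<partial>lebesgue)"
      using \<phi> by (simp add: complex_eq_iff inner_test_L2 inner_i_test_L2 test_function_deriv b)
  qed
qed

lemma test_vectors_deriv:
  assumes "\<tau> \<in> test_vectors" "b \<in> Basis"
  obtains \<tau>' where "\<tau>' \<in> test_vectors" "has_L2_deriv b \<tau> \<tau>'"
proof -
  obtain \<phi> \<psi> where \<phi>: "\<tau> = test_L2 \<phi> + \<i> *\<^sub>C test_L2 \<psi>" "test_function \<phi>" "test_function \<psi>"
    using assms by (auto simp: test_vectors_def)
  show thesis
  proof (rule that)
    show "has_L2_deriv b \<tau> (test_L2 (\<lambda>x. frechet_derivative \<phi> (at x) b) +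
        \<i> *\<^sub>C test_L2 (\<lambda>x. frechet_derivative \<psi> (at x) b))"
      unfolding \<phi>(1) by (intro has_L2_deriv_add has_L2_deriv_cscale has_L2_deriv_test_L2 \<phi> assms)
    show "test_L2 (\<lambda>x. frechet_derivative \<phi> (at x) b) +
        \<i> *\<^sub>C test_L2 (\<lambda>x. frechet_derivative \<psi> (at x) b) \<in> test_vectors"
      unfolding test_vectors_def using \<phi> test_function_deriv assms by blast
  qed
qed

text \<open>Strong continuity of the group: test vectors are dense and have differentiable orbits,
  and since translations are isometries the approximation error is the same before and after
  translating.\<close>

lemma translate_continuous_at_0:
  assumes b: "b \<in> Basis" and e: "e > 0"
  shows "\<exists>d>0. \<forall>s. \<bar>s\<bar> < d \<longrightarrow> norm (translate (s *\<^sub>R b) u - u) \<le> e"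
proof -
  have "u \<in> closure test_vectors" unfolding closure_test_vectors by (rule UNIV_I)
  then have "\<exists>\<tau>\<in>test_vectors. dist \<tau> u < e / 3"
    using e by (intro closure_approachable[THEN iffD1, rule_format]) auto
  then obtain \<tau> where \<tau>: "\<tau> \<in> test_vectors" "dist \<tau> u < e / 3" by (rule bexE)
  obtain \<tau>' where "\<tau>' \<in> test_vectors" and \<tau>': "has_L2_deriv b \<tau> \<tau>'"
    by (rule test_vectors_deriv[OF \<tau>(1) b])
  define d where "d = e / 3 / (norm \<tau>' + 1)"
  have n: "0 < norm \<tau>' + 1" by (simp add: add_nonneg_pos)
  have "norm (translate (s *\<^sub>R b) u - u) \<le> e" if s: "\<bar>s\<bar> < d" for s
  proof -
    have "norm \<tau>' * \<bar>s\<bar> \<le> (norm \<tau>' + 1) * d"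
      using s by (intro mult_mono) auto
    also have "\<dots> = e / 3" using n nonzero_mult_div_cancel_left[of "norm \<tau>' + 1" "e / 3"] by (simp add: d_def)
    finally have 1: "norm (translate (s *\<^sub>R b) \<tau> - \<tau>) \<le> e / 3"
      using has_L2_deriv_norm_le[OF \<tau>', of s] by linarith
    have "translate (s *\<^sub>R b) u - u = translate (s *\<^sub>R b) (u - \<tau>) + (translate (s *\<^sub>R b) \<tau> - \<tau>) + (\<tau> - u)"
      by (simp add: translate_diff)
    then have "norm (translate (s *\<^sub>R b) u - u) \<le> norm (u - \<tau>) + norm (translate (s *\<^sub>R b) \<tau> - \<tau>) + norm (\<tau> - u)"
      using norm_triangle_ineq[of "translate (s *\<^sub>R b) (u - \<tau>) + (translate (s *\<^sub>R b) \<tau> - \<tau>)" "\<tau> - u"]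
        norm_triangle_ineq[of "translate (s *\<^sub>R b) (u - \<tau>)" "translate (s *\<^sub>R b) \<tau> - \<tau>"]
      by simp
    then show ?thesis using 1 \<tau>(2) by (simp add: dist_norm norm_minus_commute)
  qed
  moreover have "0 < d" using e n by (simp add: d_def)
  ultimately show ?thesis by blast
qed

text \<open>The inequality is a closed condition on \<open>\<tau>\<close>, so density allows the
  choice \<open>\<tau> = z\<close>.\<close>

lemma norm_le_if_inner_test_vectors_le:
  assumes "\<And>\<tau>. \<tau> \<in> test_vectors \<Longrightarrow> \<tau> \<bullet> z \<le> norm \<tau> * C" "0 \<le> C"
  shows "norm z \<le> C"
proof -
  have "closed {\<tau>. \<tau> \<bullet> z \<le> norm \<tau> * C}"
    by (intro closed_Collect_le continuous_intros)
  then have "closure test_vectors \<subseteq> {\<tau>. \<tau> \<bullet> z \<le> norm \<tau> * C}"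
    using assms(1) by (intro closure_minimal) auto
  then have "z \<bullet> z \<le> norm z * C" by (auto simp: closure_test_vectors)
  then have "norm z * norm z \<le> norm z * C" by (simp add: power2_norm_eq_inner[symmetric] power2_eq_square)
  then show ?thesis
    using assms(2) by (cases "norm z = 0") (auto simp: mult_le_cancel_left)
qed

text \<open>Weak equals strong. By duality the remainder only has to be tested against
  \<open>\<tau>\<close>, which gives a scalar function of \<open>s\<close> to which the mean value
  inequality applies; strong continuity at \<open>v\<close> makes its derivative small.\<close>

lemma has_weak_deriv_imp_has_L2_deriv:
  assumes b: "b \<in> Basis" and w: "has_weak_deriv b u v"
  shows "has_L2_deriv b u v"
  unfolding has_L2_deriv_alt
proof (intro allI impI)
  fix e :: real assume "0 < e"
  then obtain d where d: "d > 0" "\<And>s. \<bar>s\<bar> < d \<Longrightarrow> norm (translate (s *\<^sub>R b) v - v) \<le> e"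
    using translate_continuous_at_0[OF b, of e v] by blast
  have "norm (translate (s *\<^sub>R b) u - u - s *\<^sub>R v) \<le> e * \<bar>s\<bar>" if s: "\<bar>s\<bar> < d" for s
  proof (rule norm_le_if_inner_test_vectors_le)
    fix \<tau> :: "'a L2" assume \<tau>: "\<tau> \<in> test_vectors"
    obtain \<tau>' where "\<tau>' \<in> test_vectors" and \<tau>': "has_L2_deriv b \<tau> \<tau>'"
      by (rule test_vectors_deriv[OF \<tau> b])
    \<comment> \<open>The translation has been moved onto \<open>\<tau>\<close>, with reversed sign,
      so that \<open>f\<close> is differentiable although nothing is known yet about the orbit of
      \<open>u\<close>. The translated \<open>\<tau>\<close> is again a test vector, hence the weak
      relation computes the derivative.\<close>
    define f where "f s = translate (- s *\<^sub>R b) \<tau> \<bullet> u - s * (\<tau> \<bullet> v)" for s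
    have "norm (f s - f 0) \<le> (norm \<tau> * e) * \<bar>s\<bar>"
    proof (rule vector_derivative_bound[where f' = "\<lambda>r. \<tau> \<bullet> (translate (r *\<^sub>R b) v - v)"])
      fix r assume r: "\<bar>r\<bar> \<le> \<bar>s\<bar>"
      have 1: "((\<lambda>s. translate (- s *\<^sub>R b) \<tau>) has_vector_derivative - translate (- r *\<^sub>R b) \<tau>') (at r)"
      proof -
        have "(uminus has_vector_derivative - 1) (at r)"
          by (auto intro!: derivative_eq_intros)
        from vector_diff_chain_at[OF this has_L2_deriv_at[OF \<tau>', of "- r"]]
        show ?thesis by (simp add: o_def)
      qed
      have "translate (- r *\<^sub>R b) \<tau>' \<bullet> u = - (translate (- r *\<^sub>R b) \<tau> \<bullet> v)"
        using w translate_test_vectors[OF \<tau>] has_L2_deriv_translate[OF \<tau>']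
        unfolding has_weak_deriv_inner[OF b] by blast
      then have 2: "- translate (- r *\<^sub>R b) \<tau>' \<bullet> u - \<tau> \<bullet> v = \<tau> \<bullet> (translate (r *\<^sub>R b) v - v)"
        by (simp add: translate_adjoint inner_diff_right)
      show "(f has_vector_derivative \<tau> \<bullet> (translate (r *\<^sub>R b) v - v)) (at r)"
        unfolding f_def[abs_def] 2[symmetric]
      proof (rule has_vector_derivative_diff)
        show "((\<lambda>s. translate (- s *\<^sub>R b) \<tau> \<bullet> u) has_vector_derivative - translate (- r *\<^sub>R b) \<tau>' \<bullet> u) (at r)"
          by (rule bounded_linear.has_vector_derivative[OF bounded_linear_inner_left 1])
        show "((\<lambda>s. s * (\<tau> \<bullet> v)) has_vector_derivative \<tau> \<bullet> v) (at r)"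
          by (auto intro!: derivative_eq_intros simp: has_vector_derivative_def)
      qed
      have "norm (translate (r *\<^sub>R b) v - v) \<le> e" using r s by (intro d) auto
      then show "norm (\<tau> \<bullet> (translate (r *\<^sub>R b) v - v)) \<le> norm \<tau> * e"
        using Cauchy_Schwarz_ineq2[of \<tau> "translate (r *\<^sub>R b) v - v"]
          mult_left_mono[of "norm (translate (r *\<^sub>R b) v - v)" e "norm \<tau>"]
        unfolding real_norm_def by (meson norm_ge_zero order_trans)
    qed
    then have "f s - f 0 \<le> norm \<tau> * (e * \<bar>s\<bar>)" by (simp add: mult.assoc)
    moreover have "f s - f 0 = \<tau> \<bullet> (translate (s *\<^sub>R b) u - u - s *\<^sub>R v)"
      by (simp add: f_def translate_adjoint inner_diff_right)
    ultimately show "\<tau> \<bullet> (translate (s *\<^sub>R b) u - u - s *\<^sub>R v) \<le> norm \<tau> * (e * \<bar>s\<bar>)" by simp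
  qed (use \<open>0 < e\<close> in simp)
  with d(1) show "\<exists>d>0. \<forall>s. \<bar>s\<bar> < d \<longrightarrow> norm (translate (s *\<^sub>R b) u - u - s *\<^sub>R v) \<le> e * \<bar>s\<bar>"
    by blast
qed

lemma has_weak_deriv_iff_has_L2_deriv:
  assumes "b \<in> Basis" shows "has_weak_deriv b u v \<longleftrightarrow> has_L2_deriv b u v"
proof
  assume "has_L2_deriv b u v"
  then show "has_weak_deriv b u v"
    unfolding has_weak_deriv_inner[OF assms] by (blast intro: has_L2_deriv_skew)
qed (rule has_weak_deriv_imp_has_L2_deriv[OF assms])

text \<open>The weak relation involves the limits only through continuous functionals, so it
  survives the limit, and weak derivatives are strong.\<close>

lemma has_L2_deriv_closed:
  assumes b: "b \<in> Basis" and d: "\<And>n. has_L2_deriv b (f n) (g n)"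
    and f: "f \<longlonglongrightarrow> u" and g: "g \<longlonglongrightarrow> v"
  shows "has_L2_deriv b u v"
proof (rule has_weak_deriv_imp_has_L2_deriv[OF b], unfold has_weak_deriv_inner[OF b], intro allI impI)
  fix \<tau> \<tau>' assume \<tau>: "has_L2_deriv b \<tau> \<tau>'"
  have "(\<lambda>n. \<tau>' \<bullet> f n) \<longlonglongrightarrow> \<tau>' \<bullet> u" by (intro tendsto_intros f)
  moreover have "(\<lambda>n. \<tau>' \<bullet> f n) \<longlonglongrightarrow> - (\<tau> \<bullet> v)"
    unfolding has_L2_deriv_skew[OF \<tau> d] by (intro tendsto_intros g)
  ultimately show "\<tau>' \<bullet> u = - (\<tau> \<bullet> v)" by (rule LIMSEQ_unique)
qed

section \<open>The Laplacian\<close>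

lemma weak_deriv_eq:
  assumes "b \<in> Basis" "has_L2_deriv b u v" shows "weak_deriv b u = v"
  unfolding weak_deriv_def has_weak_deriv_iff_has_L2_deriv[OF assms(1)]
  using assms(2) has_L2_deriv_unique by blast

lemma H1_iff: "u \<in> H1 \<longleftrightarrow> (\<forall>b\<in>Basis. has_L2_deriv b u (weak_deriv b u))"
  unfolding H1_def using weak_deriv_eq has_weak_deriv_iff_has_L2_deriv by blast

lemma H1D: "u \<in> H1 \<Longrightarrow> b \<in> Basis \<Longrightarrow> has_L2_deriv b u (weak_deriv b u)"
  by (simp add: H1_iff)

lemma H1I: "(\<And>b. b \<in> Basis \<Longrightarrow> \<exists>v. has_L2_deriv b u v) \<Longrightarrow> u \<in> H1"
  unfolding H1_def using has_weak_deriv_iff_has_L2_deriv by blast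

lemma H2_H1: "u \<in> H2 \<Longrightarrow> u \<in> H1"
  by (simp add: H2_def)

lemma H2_weak_deriv: "u \<in> H2 \<Longrightarrow> b \<in> Basis \<Longrightarrow> weak_deriv b u \<in> H1"
  by (simp add: H2_def)

lemma weak_deriv_add:
  "u \<in> H1 \<Longrightarrow> v \<in> H1 \<Longrightarrow> b \<in> Basis \<Longrightarrow> weak_deriv b (u + v) = weak_deriv b u + weak_deriv b v"
  by (intro weak_deriv_eq has_L2_deriv_add H1D)

lemma weak_deriv_diff:
  "u \<in> H1 \<Longrightarrow> v \<in> H1 \<Longrightarrow> b \<in> Basis \<Longrightarrow> weak_deriv b (u - v) = weak_deriv b u - weak_deriv b v"
  by (intro weak_deriv_eq has_L2_deriv_diff H1D)

lemma weak_deriv_cscale: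
  "u \<in> H1 \<Longrightarrow> b \<in> Basis \<Longrightarrow> weak_deriv b (c *\<^sub>C u) = c *\<^sub>C weak_deriv b u"
  by (intro weak_deriv_eq has_L2_deriv_cscale H1D)

lemma weak_deriv_skew:
  "u \<in> H1 \<Longrightarrow> v \<in> H1 \<Longrightarrow> b \<in> Basis \<Longrightarrow> weak_deriv b u \<bullet> v = - (u \<bullet> weak_deriv b v)"
  by (rule has_L2_deriv_skew[of b]) (simp_all add: H1D)

lemma H1_add: "u \<in> H1 \<Longrightarrow> v \<in> H1 \<Longrightarrow> u + v \<in> H1"
  by (meson H1I H1D has_L2_deriv_add)

lemma H1_cscale: "u \<in> H1 \<Longrightarrow> c *\<^sub>C u \<in> H1"
  by (meson H1I H1D has_L2_deriv_cscale)

lemma H2_add: "u \<in> H2 \<Longrightarrow> v \<in> H2 \<Longrightarrow> u + v \<in> H2"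
  by (simp add: H2_def H1_add weak_deriv_add)

lemma H2_cscale: "u \<in> H2 \<Longrightarrow> c *\<^sub>C u \<in> H2"
  by (simp add: H2_def H1_cscale weak_deriv_cscale)

lemma has_L2_deriv_0: "has_L2_deriv b 0 0"
  using has_L2_deriv_cscale[of b _ _ 0] unfolding has_L2_deriv_alt
  by (simp add: linear_0[OF bounded_linear.linear[OF bounded_linear_translate]] exI[of _ 1])

lemma weak_deriv_0: "b \<in> Basis \<Longrightarrow> weak_deriv b 0 = 0"
  by (intro weak_deriv_eq has_L2_deriv_0)

lemma H2_0: "0 \<in> H2"
  by (auto simp: H2_def weak_deriv_0 intro!: H1I exI[of _ 0] has_L2_deriv_0)

lemma laplacian_add: "u \<in> H2 \<Longrightarrow> v \<in> H2 \<Longrightarrow> laplacian (u + v) = laplacian u + laplacian v"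
  by (simp add: laplacian_def weak_deriv_add H2_H1 H2_weak_deriv sum.distrib)

lemma laplacian_diff: "u \<in> H2 \<Longrightarrow> v \<in> H2 \<Longrightarrow> laplacian (u - v) = laplacian u - laplacian v"
  by (simp add: laplacian_def weak_deriv_diff H2_H1 H2_weak_deriv sum_subtractf)

lemma laplacian_cscale: "u \<in> H2 \<Longrightarrow> laplacian (c *\<^sub>C u) = c *\<^sub>C laplacian u"
  by (simp add: laplacian_def weak_deriv_cscale H2_H1 H2_weak_deriv L2.scale_sum_right)

lemma laplacian_scaleR: "u \<in> H2 \<Longrightarrow> laplacian (r *\<^sub>R u) = r *\<^sub>R laplacian u"
  unfolding scaleR_cscale by (rule laplacian_cscale)

lemma inner_laplacian:
  assumes "u \<in> H2" "v \<in> H1"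
  shows "laplacian u \<bullet> v = - (\<Sum>b\<in>Basis. weak_deriv b u \<bullet> weak_deriv b v)"
  using assms by (simp add: laplacian_def inner_sum_left weak_deriv_skew H2_weak_deriv sum_negf)

lemma laplacian_symmetric:
  assumes "u \<in> H2" "v \<in> H2" shows "laplacian u \<bullet> v = u \<bullet> laplacian v"
  using inner_laplacian[of u v] inner_laplacian[of v u] assms
  by (simp add: H2_H1 inner_commute)

lemma test_vectors_H1: "\<tau> \<in> test_vectors \<Longrightarrow> \<tau> \<in> H1"
  by (rule H1I) (meson test_vectors_deriv)

lemma weak_deriv_test_vectors:
  assumes "\<tau> \<in> test_vectors" "b \<in> Basis" shows "weak_deriv b \<tau> \<in> test_vectors"
  by (rule test_vectors_deriv[OF assms]) (simp add: weak_deriv_eq[OF assms(2)])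

lemma test_vectors_H2: "\<tau> \<in> test_vectors \<Longrightarrow> \<tau> \<in> H2"
  by (simp add: H2_def test_vectors_H1 weak_deriv_test_vectors)

lemma has_L2_deriv_LIMSEQ:
  assumes "has_L2_deriv b u v"
  shows "(\<lambda>n. real (Suc n) *\<^sub>R (translate (inverse (real (Suc n)) *\<^sub>R b) u - u)) \<longlonglongrightarrow> v"
proof (rule LIMSEQ_I)
  fix e :: real assume "0 < e"
  then obtain d where d: "d > 0"
    "\<And>s. \<bar>s\<bar> < d \<Longrightarrow> norm (translate (s *\<^sub>R b) u - u - s *\<^sub>R v) \<le> e / 2 * \<bar>s\<bar>"
    using assms unfolding has_L2_deriv_alt by (metis half_gt_zero)
  obtain N where N: "inverse (real (Suc N)) < d" using reals_Archimedean[OF d(1)] by blast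
  show "\<exists>N. \<forall>n\<ge>N. norm (real (Suc n) *\<^sub>R (translate (inverse (real (Suc n)) *\<^sub>R b) u - u) - v) < e"
  proof (intro exI allI impI)
    fix n assume "N \<le> n"
    define s where "s = inverse (real (Suc n))"
    have "inverse (real (Suc n)) \<le> inverse (real (Suc N))"
      using \<open>N \<le> n\<close> by (intro le_imp_inverse_le) auto
    then have s: "0 < s" "s < d" "real (Suc n) * s = 1"
      using N by (auto simp only: s_def inverse_positive_iff_positive of_nat_0_less_iff zero_less_Suc
          of_nat_eq_0_iff right_inverse)
    have "real (Suc n) *\<^sub>R (translate (s *\<^sub>R b) u - u) - v = real (Suc n) *\<^sub>R (translate (s *\<^sub>R b) u - u - s *\<^sub>R v)"
      using s(3) by (simp only: scaleR_diff_right scaleR_scaleR scaleR_one)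
    then have "norm (real (Suc n) *\<^sub>R (translate (s *\<^sub>R b) u - u) - v)
        = real (Suc n) * norm (translate (s *\<^sub>R b) u - u - s *\<^sub>R v)" by simp
    also have "\<dots> \<le> real (Suc n) * (e / 2 * \<bar>s\<bar>)"
      using s by (intro mult_left_mono d(2)) auto
    also have "\<dots> = e / 2" using s by (simp add: mult.left_commute)
    also have "\<dots> < e" using \<open>0 < e\<close> by simp
    finally show "norm (real (Suc n) *\<^sub>R (translate (inverse (real (Suc n)) *\<^sub>R b) u - u) - v) < e"
      by (simp only: s_def)
  qed
qed

text \<open>\<open>ua\<close> is the limit of difference quotients of \<open>u\<close> in direction
  \<open>a\<close>. Their derivatives in direction \<open>b\<close> are the same difference
  quotients of \<open>ub\<close>, which tend to \<open>uab\<close>; closedness of the derivative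
  concludes.\<close>

lemma has_L2_deriv_commute:
  assumes "b \<in> Basis" and "has_L2_deriv a u ua" "has_L2_deriv b u ub" "has_L2_deriv a ub uab"
  shows "has_L2_deriv b ua uab"
  by (rule has_L2_deriv_closed[OF assms(1) _ has_L2_deriv_LIMSEQ[OF assms(2)] has_L2_deriv_LIMSEQ[OF assms(4)]])
     (intro has_L2_deriv_scaleR has_L2_deriv_diff has_L2_deriv_translate assms(3))

text \<open>The shift is performed one coordinate at a time; each stage costs one directional
  derivative, and isometry prevents the earlier shifts from affecting the later ones.\<close>

lemma norm_translate_diff_le:
  assumes u: "u \<in> H1"
  shows "norm (translate a u - u) \<le> (\<Sum>b\<in>Basis. \<bar>a \<bullet> b\<bar> * norm (weak_deriv b u))"
proof -
  have "norm (translate (\<Sum>b\<in>B. (a \<bullet> b) *\<^sub>R b) u - u) \<le> (\<Sum>b\<in>B. \<bar>a \<bullet> b\<bar> * norm (weak_deriv b u))"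
    if "B \<subseteq> Basis" "finite B" for B
    using that(2,1)
  proof (induction B rule: finite_induct)
    case (insert b B)
    let ?c = "(a \<bullet> b) *\<^sub>R b" and ?r = "\<Sum>b\<in>B. (a \<bullet> b) *\<^sub>R b"
    have "translate (?c + ?r) u - u = translate ?c (translate ?r u - u) + (translate ?c u - u)"
      by (simp add: translate_diff translate_translate)
    then have "norm (translate (?c + ?r) u - u) \<le> norm (translate ?r u - u) + norm (translate ?c u - u)"
      using norm_triangle_ineq[of "translate ?c (translate ?r u - u)" "translate ?c u - u"]
      by (simp only: norm_translate)
    also have "norm (translate ?c u - u) \<le> \<bar>a \<bullet> b\<bar> * norm (weak_deriv b u)"
      using has_L2_deriv_norm_le[OF H1D[OF u, of b]] insert by (simp add: mult.commute)
    finally show ?case using insert by simp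
  qed simp
  from this[of Basis] show ?thesis by (simp add: euclidean_representation)
qed

lemma continuous_on_translate:
  assumes u: "u \<in> H1"
  shows "continuous_on S (\<lambda>a. translate a u)"
proof -
  define L where "L = (\<Sum>b\<in>Basis. norm (weak_deriv b u))"
  have "norm (translate a u - translate a' u) \<le> L * norm (a - a')" for a a'
  proof -
    have "translate a u - translate a' u = translate a' (translate (a - a') u - u)"
      by (simp add: translate_diff translate_translate)
    then have "norm (translate a u - translate a' u) = norm (translate (a - a') u - u)" by simp
    also have "\<dots> \<le> (\<Sum>b\<in>Basis. \<bar>(a - a') \<bullet> b\<bar> * norm (weak_deriv b u))"
      by (rule norm_translate_diff_le[OF u])
    also have "\<dots> \<le> (\<Sum>b\<in>Basis. norm (a - a') * norm (weak_deriv b u))"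
      by (intro sum_mono mult_right_mono Basis_le_norm) auto
    finally show ?thesis by (simp add: L_def sum_distrib_left mult.commute sum_distrib_right)
  qed
  then have "L-lipschitz_on S (\<lambda>a. translate a u)"
    by (intro lipschitz_onI) (auto simp: dist_norm L_def sum_nonneg)
  then show ?thesis by (rule lipschitz_on_continuous_on)
qed

section \<open>Surjectivity of the shifted Laplacian\<close>

lemma second_derivative_nonpos_at_max:
  fixes f :: "real \<Rightarrow> real"
  assumes f: "\<And>s. (f has_real_derivative f' s) (at s)" and f': "(f' has_real_derivative D) (at 0)"
    and max: "\<And>s. f s \<le> f 0"
  shows "D \<le> 0"
proof (rule ccontr)
  assume "\<not> D \<le> 0"
  then obtain d where d: "d > 0" "\<And>h. 0 < h \<Longrightarrow> h < d \<Longrightarrow> f' 0 < f' (0 + h)"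
    using DERIV_pos_inc_right[OF f'] by (auto simp: not_le)
  have 0: "f' 0 = 0"
    using DERIV_local_max[OF f[of 0], of 1] max by auto
  obtain z where z: "0 < z" "z < d / 2" "f (d / 2) - f 0 = (d / 2 - 0) * f' z"
    using MVT2[of 0 "d / 2" f f'] d(1) f by auto
  have "0 < (d / 2 - 0) * f' z"
    using d(1) d(2)[of z] z 0 by (intro mult_pos_pos) auto
  then show False using z(3) max[of "d / 2"] by simp
qed

text \<open>If \<open>w\<close> is orthogonal to the range, then \<open>a \<mapsto> \<langle>translate a \<tau>, w\<rangle>\<close> is a bounded solution
  of \<open>\<Delta>G = t G\<close> on the whole space, and such a solution vanishes by the maximum principle.\<close>

lemma range_laplacian_test_vectors_dense:
  fixes w :: "'a::euclidean_space L2"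
  assumes t: "t > 0" and orth: "\<And>\<tau>. \<tau> \<in> test_vectors \<Longrightarrow> (t *\<^sub>R \<tau> - laplacian \<tau>) \<bullet> w = 0"
  shows "w = 0"
proof (rule L2_eq_0_if_orthogonal_test_vectors)
  have le: "\<tau> \<bullet> w \<le> 0" if \<tau>: "\<tau> \<in> test_vectors" for \<tau>
  proof (rule ccontr)
    assume "\<not> \<tau> \<bullet> w \<le> 0"
    define g where "g = \<tau> \<bullet> w"
    define B where "B = norm \<tau> * norm w"
    \<comment> \<open>Chosen so that \<open>2 * \<epsilon>\<close>, summed over the
      \<open>DIM('a)\<close> directions, equals \<open>t * g / 2\<close>, which is strictly less
      than \<open>t * g\<close>.\<close>
    define \<epsilon> where "\<epsilon> = t * g / (4 * DIM('a))"
    have g: "g > 0" using \<open>\<not> \<tau> \<bullet> w \<le> 0\<close> by (simp add: g_def)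
    have \<epsilon>: "\<epsilon> > 0" using t g by (simp add: \<epsilon>_def)
    define G where "G a = translate a \<tau> \<bullet> w" for a
    \<comment> \<open>\<open>G\<close> is bounded but need not attain its supremum. The quadratic
      penalty forces a maximum: outside the ball of radius \<open>R\<close> it exceeds the bound
      \<open>B\<close> for \<open>G\<close>, so \<open>F\<close> is nonpositive there, whereas
      \<open>F 0 = g\<close> is positive.\<close>
    define F where "F a = G a - \<epsilon> * (norm a)\<^sup>2" for a
    define R where "R = sqrt (B / \<epsilon>)"
    have G_le: "G a \<le> B" for a
      using Cauchy_Schwarz_ineq2[of "translate a \<tau>" w] by (simp add: G_def B_def)
    have "0 \<le> B" by (simp add: B_def)
    have "continuous_on (cball 0 R) F"
      unfolding F_def G_def
      by (intro continuous_intros continuous_on_translate test_vectors_H1 \<tau>)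
    moreover have "0 \<le> R" using \<open>0 \<le> B\<close> \<epsilon> by (simp add: R_def)
    ultimately obtain a0 where a0: "a0 \<in> cball 0 R" "\<And>a. a \<in> cball 0 R \<Longrightarrow> F a \<le> F a0"
      using continuous_attains_sup[of "cball 0 R" F] by auto
    have "F 0 \<le> F a0" using a0(2)[of 0] \<open>0 \<le> R\<close> by simp
    moreover have "F 0 = g" by (simp add: F_def G_def g_def)
    ultimately have Fa0: "g \<le> F a0" by simp
    have max: "F a \<le> F a0" for a
    proof (cases "a \<in> cball 0 R")
      case False
      then have "R\<^sup>2 \<le> (norm a)\<^sup>2" using \<open>0 \<le> R\<close> by (intro power_mono) auto
      then have "B \<le> \<epsilon> * (norm a)\<^sup>2"
        using \<epsilon> \<open>0 \<le> B\<close> by (simp add: R_def pos_divide_le_eq mult.commute)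
      then have "F a \<le> 0" using G_le[of a] by (simp add: F_def)
      then show ?thesis using Fa0 g by simp
    qed (rule a0)
    \<comment> \<open>Recentring at the maximum: derivatives of \<open>G\<close> at
      \<open>a0\<close> become derivatives of the orbit of \<open>\<sigma>\<close> at the origin. As
      \<open>\<sigma>\<close> is again a test vector, the orthogonality hypothesis applies to
      it.\<close>
    define \<sigma> where "\<sigma> = translate a0 \<tau>"
    have \<sigma>: "\<sigma> \<in> test_vectors" unfolding \<sigma>_def using \<tau> by (rule translate_test_vectors)
    have D: "weak_deriv b (weak_deriv b \<sigma>) \<bullet> w \<le> 2 * \<epsilon>" if b: "b \<in> Basis" for b
    proof -
      define f where "f s = F (a0 + s *\<^sub>R b)" for s
      have f_eq: "f s = translate (s *\<^sub>R b) \<sigma> \<bullet> w - \<epsilon> * ((norm a0)\<^sup>2 + 2 * s * (a0 \<bullet> b) + s\<^sup>2)" for s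
      proof -
        have "(norm (a0 + s *\<^sub>R b))\<^sup>2 = (norm a0)\<^sup>2 + 2 * s * (a0 \<bullet> b) + s\<^sup>2"
          using b unfolding power2_norm_eq_inner
          by (simp add: inner_add_left inner_add_right inner_commute power2_eq_square)
        then show ?thesis
          by (simp add: f_def F_def G_def \<sigma>_def translate_translate add.commute)
      qed
      have tr: "((\<lambda>s. translate (s *\<^sub>R b) \<rho> \<bullet> w) has_real_derivative translate (s *\<^sub>R b) (weak_deriv b \<rho>) \<bullet> w) (at s)"
        if "\<rho> \<in> test_vectors" for \<rho> s
        unfolding has_real_derivative_iff_has_vector_derivative
        using that b
        by (intro bounded_linear.has_vector_derivative[OF bounded_linear_inner_left] has_L2_deriv_at H1D test_vectors_H1)
      define f' where "f' s = translate (s *\<^sub>R b) (weak_deriv b \<sigma>) \<bullet> w - \<epsilon> * (2 * (a0 \<bullet> b) + 2 * s)" for s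
      have "weak_deriv b (weak_deriv b \<sigma>) \<bullet> w - \<epsilon> * 2 \<le> 0"
      proof (rule second_derivative_nonpos_at_max)
        show "(f has_real_derivative f' s) (at s)" for s
          unfolding f_eq[abs_def] f'_def
          by (intro DERIV_diff tr \<sigma>) (auto intro!: derivative_eq_intros)
        show "(f' has_real_derivative weak_deriv b (weak_deriv b \<sigma>) \<bullet> w - \<epsilon> * 2) (at 0)"
        proof -
          have "((\<lambda>s. translate (s *\<^sub>R b) (weak_deriv b \<sigma>) \<bullet> w) has_real_derivative
              weak_deriv b (weak_deriv b \<sigma>) \<bullet> w) (at 0)"
            using tr[OF weak_deriv_test_vectors[OF \<sigma> b], of 0] by simp
          then show ?thesis
            unfolding f'_def[abs_def] by (rule DERIV_diff) (auto intro!: derivative_eq_intros)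
        qed
        show "f s \<le> f 0" for s using max by (simp add: f_def)
      qed
      then show ?thesis by simp
    qed
    have "t * g \<le> t * (\<sigma> \<bullet> w)"
    proof -
      have "F a0 \<le> \<sigma> \<bullet> w" using \<epsilon> by (simp add: F_def G_def \<sigma>_def)
      then show ?thesis using Fa0 t by simp
    qed
    also have "\<dots> = laplacian \<sigma> \<bullet> w"
      using orth[OF \<sigma>] by (simp add: inner_diff_left)
    also have "\<dots> = (\<Sum>b\<in>Basis. weak_deriv b (weak_deriv b \<sigma>) \<bullet> w)"
      by (simp add: laplacian_def inner_sum_left)
    also have "\<dots> \<le> (\<Sum>b\<in>(Basis :: 'a set). 2 * \<epsilon>)"
      by (intro sum_mono D)
    also have "\<dots> = t * g / 2" by (simp add: \<epsilon>_def)
    finally have "t * g \<le> t * g / 2" .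
    moreover have "t * g > 0" using t g by simp
    ultimately show False by linarith
  qed
  fix \<tau> :: "'a L2" assume \<tau>: "\<tau> \<in> test_vectors"
  have "- \<tau> \<in> test_vectors" using subspace_neg[OF subspace_test_vectors \<tau>] .
  from le[OF this] le[OF \<tau>] show "\<tau> \<bullet> w = 0" by simp
qed

text \<open>The cross term is the Dirichlet form, by integration by parts. For
  \<open>t \<ge> 0\<close> all three terms are nonnegative, so each of them is controlled by the
  left-hand side.\<close>

lemma norm_shifted_laplacian:
  assumes "u \<in> H2"
  shows "(norm (t *\<^sub>R u - laplacian u))\<^sup>2 =
    t\<^sup>2 * (norm u)\<^sup>2 + 2 * t * (\<Sum>b\<in>Basis. (norm (weak_deriv b u))\<^sup>2) + (norm (laplacian u))\<^sup>2"
proof -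
  let ?S = "\<Sum>b\<in>Basis. (norm (weak_deriv b u))\<^sup>2"
  have 1: "laplacian u \<bullet> u = - ?S"
    using inner_laplacian[OF assms H2_H1[OF assms]] by (simp add: power2_norm_eq_inner)
  then have 2: "u \<bullet> laplacian u = - ?S" by (simp add: inner_commute)
  have "(norm (t *\<^sub>R u - laplacian u))\<^sup>2
      = t * (t * (u \<bullet> u)) - t * (u \<bullet> laplacian u) - (t * (laplacian u \<bullet> u) - laplacian u \<bullet> laplacian u)"
    unfolding power2_norm_eq_inner by (simp add: inner_diff_left inner_diff_right algebra_simps)
  then show ?thesis
    unfolding 1 2 power2_norm_eq_inner[symmetric] by (simp add: power2_eq_square[of t])
qed

lemma norm_shifted_laplacian_ge:
  assumes "u \<in> H2" "t \<ge> 0"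
  shows "t * norm u \<le> norm (t *\<^sub>R u - laplacian u)" "norm (laplacian u) \<le> norm (t *\<^sub>R u - laplacian u)"
    "b \<in> Basis \<Longrightarrow> sqrt (2 * t) * norm (weak_deriv b u) \<le> norm (t *\<^sub>R u - laplacian u)"
proof -
  let ?S = "\<Sum>b\<in>Basis. (norm (weak_deriv b u))\<^sup>2"
  have S: "0 \<le> 2 * t * ?S" using assms(2) by (intro mult_nonneg_nonneg sum_nonneg) auto
  note eq = norm_shifted_laplacian[OF assms(1), of t]
  have "(t * norm u)\<^sup>2 \<le> (norm (t *\<^sub>R u - laplacian u))\<^sup>2"
    using S unfolding eq power_mult_distrib by simp
  then show "t * norm u \<le> norm (t *\<^sub>R u - laplacian u)" by (rule power2_le_imp_le) simp
  have "(norm (laplacian u))\<^sup>2 \<le> (norm (t *\<^sub>R u - laplacian u))\<^sup>2"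
    using S unfolding eq by simp
  then show "norm (laplacian u) \<le> norm (t *\<^sub>R u - laplacian u)" by (rule power2_le_imp_le) simp
  assume b: "b \<in> Basis"
  have "(norm (weak_deriv b u))\<^sup>2 \<le> ?S"
    using b by (intro member_le_sum) auto
  then have "2 * t * (norm (weak_deriv b u))\<^sup>2 \<le> 2 * t * ?S"
    using assms(2) by (intro mult_left_mono) auto
  then have "(sqrt (2 * t) * norm (weak_deriv b u))\<^sup>2 \<le> (norm (t *\<^sub>R u - laplacian u))\<^sup>2"
    using assms(2) unfolding eq power_mult_distrib by (simp add: add_increasing add_increasing2)
  then show "sqrt (2 * t) * norm (weak_deriv b u) \<le> norm (t *\<^sub>R u - laplacian u)"
    by (rule power2_le_imp_le) simp
qed

text \<open>Integrating by parts twice and commuting derivatives turns the squared norm of a mixed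
  derivative into \<open>weak_deriv b (weak_deriv b \<tau>) \<bullet> weak_deriv a (weak_deriv a
  \<tau>)\<close>; summed over all pairs of directions this is exactly the squared norm of the
  Laplacian.\<close>

lemma norm_second_derivs_le:
  assumes \<tau>: "\<tau> \<in> test_vectors" and ab: "a \<in> Basis" "b \<in> Basis"
  shows "norm (weak_deriv a (weak_deriv b \<tau>)) \<le> norm (laplacian \<tau>)"
proof -
  note T = weak_deriv_test_vectors and H = test_vectors_H1
  have comm: "weak_deriv a (weak_deriv b \<rho>) = weak_deriv b (weak_deriv a \<rho>)"
    if "\<rho> \<in> test_vectors" "a \<in> Basis" "b \<in> Basis" for \<rho> a b
    using has_L2_deriv_commute[OF that(3) H1D[OF H[OF that(1)] that(2)] H1D[OF H[OF that(1)] that(3)]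
        H1D[OF H[OF T[OF that(1,3)]] that(2)]]
    by (rule weak_deriv_eq[OF that(3), symmetric])
  have eq: "weak_deriv a (weak_deriv b \<tau>) \<bullet> weak_deriv a (weak_deriv b \<tau>)
      = weak_deriv b (weak_deriv b \<tau>) \<bullet> weak_deriv a (weak_deriv a \<tau>)" if ab: "a \<in> Basis" "b \<in> Basis" for a b
  proof -
    have "weak_deriv a (weak_deriv b \<tau>) \<bullet> weak_deriv a (weak_deriv b \<tau>)
      = - (weak_deriv b \<tau> \<bullet> weak_deriv a (weak_deriv a (weak_deriv b \<tau>)))"
      using \<tau> ab by (simp add: weak_deriv_skew H T)
    also have "weak_deriv a (weak_deriv a (weak_deriv b \<tau>)) = weak_deriv b (weak_deriv a (weak_deriv a \<tau>))"
      using \<tau> ab by (simp add: comm[of _ a b] T)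
    also have "- (weak_deriv b \<tau> \<bullet> weak_deriv b (weak_deriv a (weak_deriv a \<tau>)))
      = weak_deriv b (weak_deriv b \<tau>) \<bullet> weak_deriv a (weak_deriv a \<tau>)"
      using \<tau> ab by (simp add: weak_deriv_skew H T)
    finally show ?thesis .
  qed
  have "(norm (weak_deriv a (weak_deriv b \<tau>)))\<^sup>2 \<le> (\<Sum>a\<in>Basis. (norm (weak_deriv a (weak_deriv b \<tau>)))\<^sup>2)"
    using ab by (intro member_le_sum) auto
  also have "\<dots> \<le> (\<Sum>b\<in>Basis. \<Sum>a\<in>Basis. (norm (weak_deriv a (weak_deriv b \<tau>)))\<^sup>2)"
    using ab by (intro member_le_sum[of b Basis "\<lambda>b. \<Sum>a\<in>Basis. (norm (weak_deriv a (weak_deriv b \<tau>)))\<^sup>2"])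
      (auto intro: sum_nonneg)
  also have "\<dots> = (\<Sum>b\<in>Basis. \<Sum>a\<in>Basis. weak_deriv b (weak_deriv b \<tau>) \<bullet> weak_deriv a (weak_deriv a \<tau>))"
    by (intro sum.cong refl) (simp add: power2_norm_eq_inner eq)
  also have "\<dots> = (norm (laplacian \<tau>))\<^sup>2"
    unfolding power2_norm_eq_inner laplacian_def inner_sum_left by (simp only: inner_sum_right)
  finally show ?thesis by (rule power2_le_imp_le) simp
qed

lemma convergent_if_norm_diff_le:
  fixes x :: "nat \<Rightarrow> 'b::banach" and g :: "nat \<Rightarrow> 'c::real_normed_vector"
  assumes g: "g \<longlonglongrightarrow> f" and le: "\<And>m n. norm (x m - x n) \<le> C * norm (g m - g n)"
  shows "convergent x"
proof -
  have "Cauchy x"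
  proof (rule CauchyI)
    fix e :: real assume e: "0 < e"
    have "0 < \<bar>C\<bar> + 1" by simp
    then obtain N where N: "\<And>m n. m \<ge> N \<Longrightarrow> n \<ge> N \<Longrightarrow> norm (g m - g n) < e / (\<bar>C\<bar> + 1)"
      using CauchyD[OF LIMSEQ_imp_Cauchy[OF g], of "e / (\<bar>C\<bar> + 1)"] e by auto
    show "\<exists>M. \<forall>m\<ge>M. \<forall>n\<ge>M. norm (x m - x n) < e"
    proof (intro exI allI impI)
      fix m n assume mn: "N \<le> m" "N \<le> n"
      have "norm (x m - x n) \<le> C * norm (g m - g n)" by (rule le)
      also have "\<dots> \<le> (\<bar>C\<bar> + 1) * norm (g m - g n)" by (intro mult_right_mono) auto
      also have "\<dots> < e" using N[OF mn] by (simp add: pos_less_divide_eq mult.commute)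
      finally show "norm (x m - x n) < e" .
    qed
  qed
  then show ?thesis by (rule Cauchy_convergent)
qed

text \<open>Solutions for a dense set of right-hand sides are passed to the limit. Membership in
  \<open>H2\<close> demands mixed second derivatives too, so convergence of
  \<open>laplacian (x n)\<close> alone is not enough: every derivative up to order two must
  converge, and closedness then identifies the limits.\<close>

lemma shifted_laplacian_surj:
  fixes f :: "'a::euclidean_space L2"
  assumes t: "t > 0"
  obtains u where "u \<in> H2" "t *\<^sub>R u - laplacian u = f"
proof -
  let ?L = "\<lambda>\<tau>::'a L2. t *\<^sub>R \<tau> - laplacian \<tau>"
  have diff: "?L (u - v) = ?L u - ?L v" "u - v \<in> test_vectors"
    if "u \<in> test_vectors" "v \<in> test_vectors" for u v
    using that by (simp_all add: laplacian_diff test_vectors_H2 scaleR_diff_right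
        subspace_diff[OF subspace_test_vectors])
  have sub: "subspace (?L ` test_vectors)"
    unfolding subspace_def
  proof (intro conjI ballI allI)
    have "?L 0 = 0" using laplacian_diff[OF H2_0 H2_0] by simp
    then show "0 \<in> ?L ` test_vectors"
      using subspace_0[OF subspace_test_vectors] by (intro image_eqI[of _ _ 0]) simp_all
    fix x assume "x \<in> ?L ` test_vectors"
    then obtain u where u: "u \<in> test_vectors" "x = ?L u" by (rule imageE)
    {
      fix y assume "y \<in> ?L ` test_vectors"
      then obtain v where v: "v \<in> test_vectors" "y = ?L v" by (rule imageE)
      show "x + y \<in> ?L ` test_vectors"
        using u v subspace_add[OF subspace_test_vectors u(1) v(1)]
        by (intro image_eqI[of _ _ "u + v"]) (simp_all add: laplacian_add test_vectors_H2 scaleR_add_right)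
    next
      fix r
      show "r *\<^sub>R x \<in> ?L ` test_vectors"
        using u subspace_scale[OF subspace_test_vectors u(1), of r]
        by (intro image_eqI[of _ _ "r *\<^sub>R u"])
          (simp_all add: laplacian_scaleR test_vectors_H2 scaleR_diff_right mult.commute)
    }
  qed
  have "closure (?L ` test_vectors) = UNIV"
    using range_laplacian_test_vectors_dense[OF t]
    by (intro closure_eq_UNIV_if_orthogonal_trivial sub) auto
  then have "f \<in> closure (?L ` test_vectors)" by simp
  then obtain g where g: "\<And>n. g n \<in> ?L ` test_vectors" "g \<longlonglongrightarrow> f"
    unfolding closure_sequential by blast
  have "\<forall>n. \<exists>\<tau>. \<tau> \<in> test_vectors \<and> g n = ?L \<tau>" using g(1) by blast
  from choice[OF this] obtain x where x: "\<And>n. x n \<in> test_vectors" "\<And>n. g n = ?L (x n)"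
    by blast
  have d: "x m - x n \<in> test_vectors" "g m - g n = ?L (x m - x n)" for m n
    using diff x by auto
  have H1x: "x n \<in> H1" "b \<in> Basis \<Longrightarrow> weak_deriv b (x n) \<in> H1" for n b
    using x(1) by (auto intro: test_vectors_H1 weak_deriv_test_vectors)
  have "convergent x"
  proof (rule convergent_if_norm_diff_le[OF g(2)])
    show "norm (x m - x n) \<le> 1 / t * norm (g m - g n)" for m n
      using norm_shifted_laplacian_ge(1)[OF test_vectors_H2[OF d(1)], of t m n] t
      by (simp add: d field_simps)
  qed
  then obtain u where u: "x \<longlonglongrightarrow> u" by (auto simp: convergent_def)
  have "convergent (\<lambda>n. weak_deriv b (x n))" if b: "b \<in> Basis" for b
  proof (rule convergent_if_norm_diff_le[OF g(2)])
    show "norm (weak_deriv b (x m) - weak_deriv b (x n)) \<le> 1 / sqrt (2 * t) * norm (g m - g n)" for m n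
      using norm_shifted_laplacian_ge(3)[OF test_vectors_H2[OF d(1)] _ b, of t m n] t
      by (simp add: d weak_deriv_diff[OF H1x(1) H1x(1) b] field_simps)
  qed
  then obtain v where v: "\<And>b. b \<in> Basis \<Longrightarrow> (\<lambda>n. weak_deriv b (x n)) \<longlonglongrightarrow> v b"
    unfolding convergent_def by metis
  have "convergent (\<lambda>n. weak_deriv a (weak_deriv b (x n)))" if ab: "a \<in> Basis" "b \<in> Basis" for a b
  proof (rule convergent_if_norm_diff_le[OF g(2)])
    have "weak_deriv a (weak_deriv b (x m)) - weak_deriv a (weak_deriv b (x n))
      = weak_deriv a (weak_deriv b (x m - x n))" for m n
      using ab by (simp add: weak_deriv_diff H1x)
    then show "norm (weak_deriv a (weak_deriv b (x m)) - weak_deriv a (weak_deriv b (x n))) \<le> 1 * norm (g m - g n)" for m n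
      using norm_second_derivs_le[OF d(1) ab, of m n]
        norm_shifted_laplacian_ge(2)[OF test_vectors_H2[OF d(1)], of t m n] t
      by (simp add: d)
  qed
  then obtain w where w: "\<And>a b. a \<in> Basis \<Longrightarrow> b \<in> Basis \<Longrightarrow>
      (\<lambda>n. weak_deriv a (weak_deriv b (x n))) \<longlonglongrightarrow> w a b"
    unfolding convergent_def by metis
  have uv: "has_L2_deriv b u (v b)" if "b \<in> Basis" for b
    using that by (intro has_L2_deriv_closed[OF that H1D[OF H1x(1)] u v])
  have vw: "has_L2_deriv a (v b) (w a b)" if "a \<in> Basis" "b \<in> Basis" for a b
    using that by (intro has_L2_deriv_closed[OF that(1) H1D[OF H1x(2)] v w])
  have "u \<in> H2"
    unfolding H2_def using uv vw by (auto simp: weak_deriv_eq[OF _ uv] intro!: H1I)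
  have "laplacian u = (\<Sum>b\<in>Basis. w b b)"
    unfolding laplacian_def by (intro sum.cong refl) (simp add: weak_deriv_eq[OF _ uv] weak_deriv_eq[OF _ vw])
  moreover have "(\<lambda>n. laplacian (x n)) \<longlonglongrightarrow> (\<Sum>b\<in>Basis. w b b)"
    unfolding laplacian_def by (intro tendsto_sum w)
  ultimately have "g \<longlonglongrightarrow> ?L u"
    unfolding x(2)[abs_def] using u by (auto intro!: tendsto_intros)
  then have "?L u = f" using g(2) by (rule LIMSEQ_unique)
  with \<open>u \<in> H2\<close> show ?thesis by (rule that)
qed

section \<open>Compactness on sets of finite measure\<close>

text \<open>The integer index of the half-open cube of side \<open>\<rho>\<close> that contains the
  point, stored as a vector so that cells are fibres of a measurable map.\<close>

definition cell :: "real \<Rightarrow> 'a::euclidean_space \<Rightarrow> 'a" where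
  "cell \<rho> x = (\<Sum>b\<in>Basis. real_of_int \<lfloor>x \<bullet> b / \<rho>\<rfloor> *\<^sub>R b)"

lemma cell_inner: "b \<in> Basis \<Longrightarrow> cell \<rho> x \<bullet> b = real_of_int \<lfloor>x \<bullet> b / \<rho>\<rfloor>"
  by (simp add: cell_def inner_sum_left_Basis)

lemma cell_measurable [measurable]: "cell \<rho> \<in> borel_measurable borel"
  unfolding cell_def[abs_def] by measurable

lemma cell_eq_iff:
  "cell \<rho> y = cell \<rho> x \<longleftrightarrow> (\<forall>b\<in>Basis. \<lfloor>y \<bullet> b / \<rho>\<rfloor> = \<lfloor>x \<bullet> b / \<rho>\<rfloor>)"
  by (auto simp: euclidean_eq_iff[where 'a = 'a] cell_inner)

lemma cell_eq_bound:
  assumes "\<rho> > 0" "cell \<rho> y = cell \<rho> x" "b \<in> Basis"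
  shows "\<bar>(y - x) \<bullet> b\<bar> \<le> \<rho>"
proof -
  have "\<lfloor>y \<bullet> b / \<rho>\<rfloor> = \<lfloor>x \<bullet> b / \<rho>\<rfloor>" using assms by (simp add: cell_eq_iff)
  then have "\<bar>y \<bullet> b / \<rho> - x \<bullet> b / \<rho>\<bar> \<le> 1" by linarith
  then have "\<bar>(y - x) \<bullet> b / \<rho>\<bar> \<le> 1" by (simp add: inner_diff_left diff_divide_distrib)
  then show ?thesis using assms(1) by (simp add: abs_divide)
qed

lemma emeasure_cell:
  fixes x :: "'a::euclidean_space"
  assumes \<rho>: "\<rho> > 0"
  shows "emeasure lborel {y. cell \<rho> y = cell \<rho> x} = ennreal (\<rho> ^ DIM('a))"
proof (rule antisym)
  define l where "l = \<rho> *\<^sub>R cell \<rho> x"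
  define r where "r = l + \<rho> *\<^sub>R One"
  have lr: "r \<bullet> b = l \<bullet> b + \<rho>" "l \<bullet> b = \<rho> * real_of_int \<lfloor>x \<bullet> b / \<rho>\<rfloor>" if "b \<in> Basis" for b
    using that by (simp_all add: r_def l_def inner_add_left cell_inner)
  have box: "emeasure lborel (box l r) = ennreal (\<rho> ^ DIM('a))" "emeasure lborel (cbox l r) = ennreal (\<rho> ^ DIM('a))"
    using \<rho> by (simp_all add: emeasure_lborel_box_eq emeasure_lborel_cbox_eq lr inner_diff_left)
  have "{y. cell \<rho> y = cell \<rho> x} \<subseteq> cbox l r"
  proof (intro subsetI)
    fix y assume "y \<in> {y. cell \<rho> y = cell \<rho> x}"
    then have *: "\<lfloor>y \<bullet> b / \<rho>\<rfloor> = \<lfloor>x \<bullet> b / \<rho>\<rfloor>" if "b \<in> Basis" for b using that by (auto simp: cell_eq_iff)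
    have "l \<bullet> b \<le> y \<bullet> b \<and> y \<bullet> b \<le> r \<bullet> b" if b: "b \<in> Basis" for b
    proof -
      have "real_of_int \<lfloor>x \<bullet> b / \<rho>\<rfloor> \<le> y \<bullet> b / \<rho>" "y \<bullet> b / \<rho> \<le> real_of_int \<lfloor>x \<bullet> b / \<rho>\<rfloor> + 1"
        unfolding *[OF b, symmetric] by linarith+
      then show ?thesis using \<rho> by (simp add: lr[OF b] pos_le_divide_eq pos_divide_le_eq algebra_simps)
    qed
    then show "y \<in> cbox l r" by (simp add: mem_box)
  qed
  then show "emeasure lborel {y. cell \<rho> y = cell \<rho> x} \<le> ennreal (\<rho> ^ DIM('a))"
    unfolding box(2)[symmetric] by (rule emeasure_mono) simp
  have "box l r \<subseteq> {y. cell \<rho> y = cell \<rho> x}"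
  proof (intro subsetI)
    fix y assume y: "y \<in> box l r"
    have "\<lfloor>y \<bullet> b / \<rho>\<rfloor> = \<lfloor>x \<bullet> b / \<rho>\<rfloor>" if b: "b \<in> Basis" for b
    proof -
      have "l \<bullet> b < y \<bullet> b" "y \<bullet> b < r \<bullet> b" using y b by (auto simp: mem_box)
      then have "real_of_int \<lfloor>x \<bullet> b / \<rho>\<rfloor> < y \<bullet> b / \<rho>" "y \<bullet> b / \<rho> < real_of_int \<lfloor>x \<bullet> b / \<rho>\<rfloor> + 1"
        using \<rho> by (simp_all add: lr[OF b] pos_less_divide_eq pos_divide_less_eq algebra_simps)
      then show ?thesis by linarith
    qed
    then show "y \<in> {y. cell \<rho> y = cell \<rho> x}" by (simp add: cell_eq_iff)
  qed
  then show "ennreal (\<rho> ^ DIM('a)) \<le> emeasure lborel {y. cell \<rho> y = cell \<rho> x}"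
    unfolding box(1)[symmetric] by (rule emeasure_mono) measurable
qed

section \<open>Averages over cells\<close>

lemma norm_set_integral_power2_le:
  fixes f :: "'a \<Rightarrow> 'b::{banach, second_countable_topology}"
  assumes [measurable]: "f \<in> borel_measurable M" "Q \<in> sets M"
    and int: "integrable M (\<lambda>y. indicator Q y *\<^sub>R f y)"
  shows "ennreal ((norm (\<integral>y. indicator Q y *\<^sub>R f y \<partial>M))\<^sup>2)
    \<le> emeasure M Q * (\<integral>\<^sup>+y. indicator Q y * ennreal ((norm (f y))\<^sup>2) \<partial>M)"
proof -
  have "ennreal ((norm (\<integral>y. indicator Q y *\<^sub>R f y \<partial>M))\<^sup>2)
      = (ennreal (norm (\<integral>y. indicator Q y *\<^sub>R f y \<partial>M)))\<^sup>2"
    by (simp add: ennreal_power)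
  also have "\<dots> \<le> (\<integral>\<^sup>+y. ennreal (norm (indicator Q y *\<^sub>R f y)) \<partial>M)\<^sup>2"
    using integral_norm_bound_ennreal[OF int] by (rule power_mono) simp
  also have "(\<integral>\<^sup>+y. ennreal (norm (indicator Q y *\<^sub>R f y)) \<partial>M)
      = (\<integral>\<^sup>+y. indicator Q y * (indicator Q y * ennreal (norm (f y))) \<partial>M)"
    by (intro nn_integral_cong) (auto split: split_indicator)
  also have "\<dots>\<^sup>2 \<le> (\<integral>\<^sup>+y. (indicator Q y)\<^sup>2 \<partial>M) * (\<integral>\<^sup>+y. (indicator Q y * ennreal (norm (f y)))\<^sup>2 \<partial>M)"
    by (intro Cauchy_Schwarz_nn_integral) measurable
  also have "(\<integral>\<^sup>+y. (indicator Q y)\<^sup>2 \<partial>M) = (\<integral>\<^sup>+y. indicator Q y \<partial>M)"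
    by (intro nn_integral_cong) (auto split: split_indicator)
  also have "\<dots> = emeasure M Q" by simp
  also have "(\<integral>\<^sup>+y. (indicator Q y * ennreal (norm (f y)))\<^sup>2 \<partial>M)
      = (\<integral>\<^sup>+y. indicator Q y * ennreal ((norm (f y))\<^sup>2) \<partial>M)"
    by (intro nn_integral_cong) (auto split: split_indicator simp: ennreal_power)
  finally show ?thesis .
qed

lemma integrable_indicator_square:
  fixes f :: "'a \<Rightarrow> 'b::{banach, second_countable_topology}"
  assumes [measurable]: "f \<in> borel_measurable M" "Q \<in> sets M"
    and fin: "(\<integral>\<^sup>+y. ennreal ((norm (f y))\<^sup>2) \<partial>M) < \<infinity>" "emeasure M Q < \<infinity>"
  shows "integrable M (\<lambda>y. indicator Q y *\<^sub>R f y)"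
proof (rule Bochner_Integration.integrable_bound)
  have "integrable M (\<lambda>y. (norm (f y))\<^sup>2)"
    using fin(1) by (intro integrableI_bounded) auto
  then show "integrable M (\<lambda>y. indicator Q y + (norm (f y))\<^sup>2)"
    using fin(2) by (intro Bochner_Integration.integrable_add) auto
  have "\<bar>y\<bar> \<le> 1 + y\<^sup>2" for y :: real
    using sum_squares_bound[of "\<bar>y\<bar>" 1] by simp
  from this[of "norm (f y)" for y]
  show "AE y in M. norm (indicator Q y *\<^sub>R f y) \<le> norm (indicator Q y + (norm (f y))\<^sup>2)"
    by (auto split: split_indicator)
qed measurable

lemma norm_power2_add_le: "(norm (a + b))\<^sup>2 \<le> 2 * (norm a)\<^sup>2 + 2 * (norm b)\<^sup>2"
  for a b :: "'b::real_normed_vector"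
proof -
  have "(norm (a + b))\<^sup>2 \<le> (norm a + norm b)\<^sup>2"
    by (intro power_mono norm_triangle_ineq) simp
  also have "\<dots> \<le> 2 * (norm a)\<^sup>2 + 2 * (norm b)\<^sup>2"
    using sum_squares_bound[of "norm a" "norm b"] by (simp add: power2_sum)
  finally show ?thesis .
qed

text \<open>A function is split into its cell averages, which are controlled by finitely many of them
  and by the tail of \<open>A\<close>, and its deviation from them, which is controlled by the differences
  to its translates.\<close>

lemma cell_average_inequality:
  fixes f :: "'a::euclidean_space \<Rightarrow> complex"
  assumes fm [measurable]: "f \<in> borel_measurable borel"
    and fin: "(\<integral>\<^sup>+x. ennreal ((cmod (f x))\<^sup>2) \<partial>lborel) < \<infinity>"
    and \<rho>: "\<rho> > 0" and A [measurable]: "A \<in> sets borel" and K: "finite K"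
    and tail: "\<And>k. k \<notin> K \<Longrightarrow> emeasure lborel (A \<inter> {x. cell \<rho> x = k}) \<le> ennreal \<eta>"
    and trans: "\<And>s. (\<And>b. b \<in> Basis \<Longrightarrow> \<bar>s \<bullet> b\<bar> \<le> \<rho>) \<Longrightarrow>
      (\<integral>\<^sup>+x. ennreal ((cmod (f (x + s) - f x))\<^sup>2) \<partial>lborel) \<le> ennreal M"
  defines "v \<equiv> \<rho> ^ DIM('a)"
  shows "ennreal v * (\<integral>\<^sup>+x. indicator A x * ennreal ((cmod (f x))\<^sup>2) \<partial>lborel)
    \<le> 2 * (\<Sum>k\<in>K. ennreal ((cmod (\<integral>y. indicator {y. cell \<rho> y = k} y *\<^sub>R f y \<partial>lborel))\<^sup>2))
      + 2 * (ennreal \<eta> * (\<integral>\<^sup>+x. ennreal ((cmod (f x))\<^sup>2) \<partial>lborel))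
      + 2 * (ennreal ((2 * \<rho>) ^ DIM('a)) * ennreal M)"
proof -
  define Q where "Q k = {y. cell \<rho> y = k}" for k :: 'a
  have [measurable]: "Q k \<in> sets borel" for k unfolding Q_def by measurable
  define I where "I k = (\<integral>y. indicator (Q k) y *\<^sub>R f y \<partial>lborel)" for k
  \<comment> \<open>The symmetric kernel of the relation of lying in one cell. It writes an integral
    over the cell of \<open>x\<close> with a jointly measurable integrand, so that Tonelli's theorem
    can exchange \<open>x\<close> and \<open>y\<close>.\<close>
  define e :: "'a \<Rightarrow> 'a \<Rightarrow> ennreal" where "e x y = (if cell \<rho> x = cell \<rho> y then 1 else 0)" for x y
  have [measurable]: "Measurable.pred (borel \<Otimes>\<^sub>M borel) (\<lambda>p. cell \<rho> (fst p :: 'a) = cell \<rho> (snd p))"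
  proof -
    have "closed {p :: 'a \<times> 'a. fst p = snd p}"
      by (intro closed_Collect_eq continuous_intros)
    then have [measurable]: "Measurable.pred borel (\<lambda>p :: 'a \<times> 'a. fst p = snd p)"
      by (simp add: pred_def)
    have "(\<lambda>p. (cell \<rho> (fst p :: 'a), cell \<rho> (snd p :: 'a))) \<in> borel_measurable (borel \<Otimes>\<^sub>M borel)"
      by measurable
    from measurable_compose[OF this, of "\<lambda>p. fst p = snd p"] show ?thesis by simp
  qed
  have em [measurable]: "(\<lambda>p. e (fst p) (snd p)) \<in> borel_measurable (borel \<Otimes>\<^sub>M borel)"
    unfolding e_def by measurable
  have v: "v > 0" using \<rho> by (simp add: v_def)
  have Qv: "emeasure lborel (Q (cell \<rho> x)) = ennreal v" for x
    unfolding Q_def v_def by (rule emeasure_cell[OF \<rho>])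
  have Qle: "emeasure lborel (Q k) \<le> ennreal v" for k
  proof (cases "Q k = {}")
    case False
    then obtain x where "k = cell \<rho> x" by (auto simp: Q_def)
    then show ?thesis using Qv by simp
  qed simp
  have e_ind: "indicator (Q (cell \<rho> x)) y = e x y" for x y
    by (simp add: e_def Q_def indicator_def eq_commute)
  have intQ: "integrable lborel (\<lambda>y. indicator (Q k) y *\<^sub>R f y)" for k
    using fin Qle[of k] by (intro integrable_indicator_square) (auto intro: le_less_trans)
  have avg: "ennreal ((cmod (I (cell \<rho> x)))\<^sup>2 / v) \<le> (\<integral>\<^sup>+y. e x y * ennreal ((cmod (f y))\<^sup>2) \<partial>lborel)" for x
  proof -
    have "ennreal ((cmod (I (cell \<rho> x)))\<^sup>2)
        \<le> ennreal v * (\<integral>\<^sup>+y. e x y * ennreal ((cmod (f y))\<^sup>2) \<partial>lborel)"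
      using norm_set_integral_power2_le[OF _ _ intQ[of "cell \<rho> x"]] unfolding I_def Qv e_ind by simp
    then have "ennreal (1 / v) * ennreal ((cmod (I (cell \<rho> x)))\<^sup>2)
        \<le> ennreal (1 / v) * (ennreal v * (\<integral>\<^sup>+y. e x y * ennreal ((cmod (f y))\<^sup>2) \<partial>lborel))"
      by (rule mult_left_mono) simp
    then show ?thesis using v by (simp add: ennreal_mult[symmetric] mult.assoc[symmetric])
  qed
  \<comment> \<open>\<open>v\<close> times the deviation from the cell average is the integral of
    \<open>f x - f y\<close> over the cell; Cauchy-Schwarz costs the cell volume \<open>v\<close>,
    one factor of which cancels.\<close>
  have dev: "ennreal (v * (cmod (f x - I (cell \<rho> x) /\<^sub>R v))\<^sup>2)
      \<le> (\<integral>\<^sup>+y. e x y * ennreal ((cmod (f x - f y))\<^sup>2) \<partial>lborel)" for x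
  proof -
    have ind: "integrable lborel (\<lambda>y. indicator (Q (cell \<rho> x)) y *\<^sub>R f x)"
      using Qv[of x] by (intro integrable_scaleR_left) auto
    have int: "integrable lborel (\<lambda>y. indicator (Q (cell \<rho> x)) y *\<^sub>R (f x - f y))"
      unfolding scaleR_diff_right by (intro Bochner_Integration.integrable_diff ind intQ)
    have "measure lborel (Q (cell \<rho> x)) = v" using Qv[of x] v by (simp add: measure_def)
    moreover have "(\<integral>y. indicator (Q (cell \<rho> x)) y *\<^sub>R f x \<partial>lborel)
        = (\<integral>y. indicator (Q (cell \<rho> x)) y \<partial>lborel) *\<^sub>R f x"
      using Qv[of x] by (intro integral_scaleR_left) auto
    ultimately have "(\<integral>y. indicator (Q (cell \<rho> x)) y *\<^sub>R f x \<partial>lborel) = v *\<^sub>R f x"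
      by simp
    then have "(\<integral>y. indicator (Q (cell \<rho> x)) y *\<^sub>R (f x - f y) \<partial>lborel) = v *\<^sub>R f x - I (cell \<rho> x)"
      unfolding scaleR_diff_right I_def using Bochner_Integration.integral_diff[OF ind intQ] by simp
    also have "\<dots> = v *\<^sub>R (f x - I (cell \<rho> x) /\<^sub>R v)"
      using v by (simp add: scaleR_diff_right)
    finally have "cmod (\<integral>y. indicator (Q (cell \<rho> x)) y *\<^sub>R (f x - f y) \<partial>lborel)
        = v * cmod (f x - I (cell \<rho> x) /\<^sub>R v)" using v by simp
    then have "ennreal ((v * cmod (f x - I (cell \<rho> x) /\<^sub>R v))\<^sup>2)
        \<le> ennreal v * (\<integral>\<^sup>+y. e x y * ennreal ((cmod (f x - f y))\<^sup>2) \<partial>lborel)"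
      using norm_set_integral_power2_le[OF _ _ int] unfolding Qv e_ind by simp
    then have "ennreal (1 / v) * ennreal ((v * cmod (f x - I (cell \<rho> x) /\<^sub>R v))\<^sup>2)
        \<le> ennreal (1 / v) * (ennreal v * (\<integral>\<^sup>+y. e x y * ennreal ((cmod (f x - f y))\<^sup>2) \<partial>lborel))"
      by (rule mult_left_mono) simp
    then show ?thesis
      using v by (simp add: ennreal_mult[symmetric] mult.assoc[symmetric] power_mult_distrib power2_eq_square[of v])
  qed
  \<comment> \<open>Three contributions: averages over the finitely many cells in \<open>K\<close>
    are kept exactly, averages over the other cells are estimated by the mass of \<open>f\<close>
    there, and \<open>U\<close> measures the deviation from the average.\<close>
  define S where "S x = (\<Sum>k\<in>K. indicator (Q k) x * ennreal ((cmod (I k))\<^sup>2 / v))" for x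
  define T where "T x = indicator (- K) (cell \<rho> x) * (\<integral>\<^sup>+y. e x y * ennreal ((cmod (f y))\<^sup>2) \<partial>lborel)" for x
  define U where "U x = (\<integral>\<^sup>+y. e x y * ennreal ((cmod (f x - f y))\<^sup>2) \<partial>lborel)" for x
  have Km [measurable]: "K \<in> sets borel" using K by (simp add: finite_imp_closed)
  have [measurable]: "S \<in> borel_measurable borel" unfolding S_def by measurable
  have [measurable]: "(\<lambda>p. e (fst p) (snd p) * ennreal ((cmod (f (snd p)))\<^sup>2)) \<in> borel_measurable (borel \<Otimes>\<^sub>M lborel)"
    "(\<lambda>p. e (fst p) (snd p) * ennreal ((cmod (f (fst p) - f (snd p)))\<^sup>2)) \<in> borel_measurable (borel \<Otimes>\<^sub>M lborel)"
    using em by (simp_all cong: measurable_cong_sets)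
  have Tm [measurable]: "T \<in> borel_measurable borel"
    unfolding T_def
    by (intro borel_measurable_times_ennreal lborel.borel_measurable_nn_integral) (simp_all add: split_beta')
  have Um [measurable]: "U \<in> borel_measurable borel"
    unfolding U_def by (intro lborel.borel_measurable_nn_integral) (simp add: split_beta')
  have pw: "ennreal v * ennreal ((cmod (f x))\<^sup>2) \<le> 2 * S x + 2 * T x + 2 * U x" for x
  proof -
    have "(cmod (f x))\<^sup>2 \<le> 2 * (cmod (I (cell \<rho> x) /\<^sub>R v))\<^sup>2 + 2 * (cmod (f x - I (cell \<rho> x) /\<^sub>R v))\<^sup>2"
      using norm_power2_add_le[of "I (cell \<rho> x) /\<^sub>R v" "f x - I (cell \<rho> x) /\<^sub>R v"] by simp
    then have "v * (cmod (f x))\<^sup>2 \<le> v * (2 * (cmod (I (cell \<rho> x) /\<^sub>R v))\<^sup>2 + 2 * (cmod (f x - I (cell \<rho> x) /\<^sub>R v))\<^sup>2)"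
      using v by (intro mult_left_mono) auto
    also have "\<dots> = 2 * ((cmod (I (cell \<rho> x)))\<^sup>2 / v) + 2 * (v * (cmod (f x - I (cell \<rho> x) /\<^sub>R v))\<^sup>2)"
      using v by (simp add: power_mult_distrib power2_eq_square[of "inverse v"] divide_inverse algebra_simps)
    finally have "ennreal (v * (cmod (f x))\<^sup>2)
        \<le> ennreal (2 * ((cmod (I (cell \<rho> x)))\<^sup>2 / v) + 2 * (v * (cmod (f x - I (cell \<rho> x) /\<^sub>R v))\<^sup>2))"
      by (rule ennreal_leI)
    also have "\<dots> = 2 * ennreal ((cmod (I (cell \<rho> x)))\<^sup>2 / v) + 2 * ennreal (v * (cmod (f x - I (cell \<rho> x) /\<^sub>R v))\<^sup>2)"
      using v by (subst ennreal_plus) (simp_all only: ennreal_mult' ennreal_numeral zero_le_numeral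
          mult_nonneg_nonneg divide_nonneg_nonneg zero_le_power2 less_imp_le)
    also have "\<dots> \<le> 2 * (S x + T x) + 2 * U x"
    proof (intro add_mono mult_left_mono)
      show "ennreal (v * (cmod (f x - I (cell \<rho> x) /\<^sub>R v))\<^sup>2) \<le> U x"
        unfolding U_def by (rule dev)
      show "ennreal ((cmod (I (cell \<rho> x)))\<^sup>2 / v) \<le> S x + T x"
      proof (cases "cell \<rho> x \<in> K")
        case True
        have "ennreal ((cmod (I (cell \<rho> x)))\<^sup>2 / v)
            = indicator (Q (cell \<rho> x)) x * ennreal ((cmod (I (cell \<rho> x)))\<^sup>2 / v)"
          by (simp add: Q_def)
        also have "\<dots> \<le> S x"
          unfolding S_def using K True by (intro member_le_sum) auto
        finally show ?thesis by (simp add: add_increasing2)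
      next
        case False
        then have "T x = (\<integral>\<^sup>+y. e x y * ennreal ((cmod (f y))\<^sup>2) \<partial>lborel)" by (simp add: T_def)
        then show ?thesis using avg[of x] by (simp add: add_increasing)
      qed
    qed auto
    finally show ?thesis using v by (simp add: ennreal_mult distrib_left)
  qed
  have iS: "(\<integral>\<^sup>+x. indicator A x * S x \<partial>lborel) \<le> (\<Sum>k\<in>K. ennreal ((cmod (I k))\<^sup>2))"
  proof -
    have "(\<integral>\<^sup>+x. indicator A x * S x \<partial>lborel)
        \<le> (\<integral>\<^sup>+x. (\<Sum>k\<in>K. ennreal ((cmod (I k))\<^sup>2 / v) * indicator (Q k) x) \<partial>lborel)"
      unfolding S_def by (intro nn_integral_mono) (auto split: split_indicator simp: mult.commute intro!: sum_mono)
    also have "\<dots> = (\<Sum>k\<in>K. ennreal ((cmod (I k))\<^sup>2 / v) * emeasure lborel (Q k))"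
      by (subst nn_integral_sum) (simp_all add: nn_integral_cmult_indicator)
    also have "\<dots> \<le> (\<Sum>k\<in>K. ennreal ((cmod (I k))\<^sup>2 / v) * ennreal v)"
      by (intro sum_mono mult_left_mono Qle) simp
    also have "\<dots> = (\<Sum>k\<in>K. ennreal ((cmod (I k))\<^sup>2))"
      using v by (simp add: ennreal_mult[symmetric])
    finally show ?thesis .
  qed
  \<comment> \<open>After exchanging the integrals, \<open>x\<close> ranges over the part of
    \<open>A\<close> in the cell of \<open>y\<close>, which has measure at most
    \<open>\<eta>\<close> because that cell is not in \<open>K\<close>.\<close>
  have iT: "(\<integral>\<^sup>+x. indicator A x * T x \<partial>lborel) \<le> ennreal \<eta> * (\<integral>\<^sup>+x. ennreal ((cmod (f x))\<^sup>2) \<partial>lborel)"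
  proof -
    have "(\<integral>\<^sup>+x. indicator A x * T x \<partial>lborel) = (\<integral>\<^sup>+x. \<integral>\<^sup>+y.
        indicator A x * indicator (- K) (cell \<rho> x) * (e x y * ennreal ((cmod (f y))\<^sup>2)) \<partial>lborel \<partial>lborel)"
      unfolding T_def
      by (intro nn_integral_cong) (auto simp: nn_integral_cmult mult.assoc split: split_indicator)
    also have "\<dots> = (\<integral>\<^sup>+y. \<integral>\<^sup>+x.
        indicator A x * indicator (- K) (cell \<rho> x) * (e x y * ennreal ((cmod (f y))\<^sup>2)) \<partial>lborel \<partial>lborel)"
      by (rule lborel_pair.Fubini'[symmetric]) (simp add: split_beta' cong: measurable_cong_sets)
    also have "\<dots> \<le> (\<integral>\<^sup>+y. ennreal \<eta> * ennreal ((cmod (f y))\<^sup>2) \<partial>lborel)"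
    proof (intro nn_integral_mono)
      fix y :: 'a
      have "(\<integral>\<^sup>+x. indicator A x * indicator (- K) (cell \<rho> x) * (e x y * ennreal ((cmod (f y))\<^sup>2)) \<partial>lborel)
          = (\<integral>\<^sup>+x. (indicator (- K) (cell \<rho> y) * ennreal ((cmod (f y))\<^sup>2)) * indicator (A \<inter> {x. cell \<rho> x = cell \<rho> y}) x \<partial>lborel)"
        by (intro nn_integral_cong) (auto simp: e_def split: split_indicator)
      also have "\<dots> = (indicator (- K) (cell \<rho> y) * ennreal ((cmod (f y))\<^sup>2)) * emeasure lborel (A \<inter> {x. cell \<rho> x = cell \<rho> y})"
        by (rule nn_integral_cmult_indicator) measurable
      also have "\<dots> \<le> ennreal \<eta> * ennreal ((cmod (f y))\<^sup>2)"
        using tail[of "cell \<rho> y"]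
        by (cases "cell \<rho> y \<in> K") (simp_all add: mult.commute[of "ennreal \<eta>"] mult_left_mono)
      finally show "(\<integral>\<^sup>+x. indicator A x * indicator (- K) (cell \<rho> x) * (e x y * ennreal ((cmod (f y))\<^sup>2)) \<partial>lborel)
          \<le> ennreal \<eta> * ennreal ((cmod (f y))\<^sup>2)" .
    qed
    also have "\<dots> = ennreal \<eta> * (\<integral>\<^sup>+x. ennreal ((cmod (f x))\<^sup>2) \<partial>lborel)"
      by (intro nn_integral_cmult) measurable
    finally show ?thesis .
  qed
  have iU: "(\<integral>\<^sup>+x. indicator A x * U x \<partial>lborel) \<le> ennreal ((2 * \<rho>) ^ DIM('a)) * ennreal M"
  proof -
    \<comment> \<open>Two points of one cell differ by a vector of this cube of side
      \<open>2 * \<rho>\<close>. Enlarging the cell to a translate of \<open>C\<close> makes the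
      domain independent of the position of \<open>x\<close>, so that the deviation becomes an
      average of translation differences.\<close>
    define C where "C = cbox (- \<rho> *\<^sub>R One) (\<rho> *\<^sub>R One :: 'a)"
    have C: "s \<in> C \<longleftrightarrow> (\<forall>b\<in>Basis. \<bar>s \<bullet> b\<bar> \<le> \<rho>)" for s
      by (auto simp: C_def mem_box abs_le_iff minus_le_iff)
    have Cm: "emeasure lborel C = ennreal ((2 * \<rho>) ^ DIM('a))"
    proof -
      have "(\<Prod>b\<in>Basis. (\<rho> *\<^sub>R One - - \<rho> *\<^sub>R One :: 'a) \<bullet> b) = (\<Prod>b\<in>(Basis :: 'a set). 2 * \<rho>)"
        by (intro prod.cong refl) (simp add: inner_diff_left inner_add_left)
      then show ?thesis using \<rho> by (simp add: C_def emeasure_lborel_cbox_eq)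
    qed
    have [measurable]: "C \<in> sets borel" by (simp add: C_def)
    have "(\<integral>\<^sup>+x. indicator A x * U x \<partial>lborel)
      \<le> (\<integral>\<^sup>+x. \<integral>\<^sup>+s. indicator C s * ennreal ((cmod (f (x + s) - f x))\<^sup>2) \<partial>lborel \<partial>lborel)"
    proof (intro nn_integral_mono)
      fix x :: 'a
      have "indicator A x * U x \<le> U x" by (simp split: split_indicator)
      also have "U x \<le> (\<integral>\<^sup>+y. indicator C (y - x) * ennreal ((cmod (f y - f x))\<^sup>2) \<partial>lborel)"
        unfolding U_def
      proof (intro nn_integral_mono)
        fix y :: 'a
        show "e x y * ennreal ((cmod (f x - f y))\<^sup>2) \<le> indicator C (y - x) * ennreal ((cmod (f y - f x))\<^sup>2)"
        proof (cases "cell \<rho> x = cell \<rho> y")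
          case True
          then have "y - x \<in> C" unfolding C using cell_eq_bound[OF \<rho>, of y x] by auto
          then show ?thesis by (simp add: e_def norm_minus_commute)
        qed (simp add: e_def)
      qed
      also have "\<dots> = (\<integral>\<^sup>+y. indicator C (y - x) * ennreal ((cmod (f y - f x))\<^sup>2) \<partial>distr lborel borel ((+) x))"
        by (simp add: lborel_distr_plus)
      also have "\<dots> = (\<integral>\<^sup>+s. indicator C s * ennreal ((cmod (f (x + s) - f x))\<^sup>2) \<partial>lborel)"
        by (subst nn_integral_distr) simp_all
      finally show "indicator A x * U x
          \<le> (\<integral>\<^sup>+s. indicator C s * ennreal ((cmod (f (x + s) - f x))\<^sup>2) \<partial>lborel)" .
    qed
    also have "\<dots> = (\<integral>\<^sup>+s. \<integral>\<^sup>+x. indicator C s * ennreal ((cmod (f (x + s) - f x))\<^sup>2) \<partial>lborel \<partial>lborel)"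
      by (rule lborel_pair.Fubini'[symmetric]) (simp add: split_beta' cong: measurable_cong_sets)
    also have "\<dots> \<le> (\<integral>\<^sup>+s. ennreal M * indicator C s \<partial>lborel)"
    proof (intro nn_integral_mono)
      fix s :: 'a
      show "(\<integral>\<^sup>+x. indicator C s * ennreal ((cmod (f (x + s) - f x))\<^sup>2) \<partial>lborel) \<le> ennreal M * indicator C s"
        using trans[of s] C[of s] by (cases "s \<in> C") simp_all
    qed
    also have "\<dots> = ennreal ((2 * \<rho>) ^ DIM('a)) * ennreal M"
      by (simp add: nn_integral_cmult_indicator Cm mult.commute)
    finally show ?thesis .
  qed
  have "ennreal v * (\<integral>\<^sup>+x. indicator A x * ennreal ((cmod (f x))\<^sup>2) \<partial>lborel)
      = (\<integral>\<^sup>+x. indicator A x * (ennreal v * ennreal ((cmod (f x))\<^sup>2)) \<partial>lborel)"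
    by (subst nn_integral_cmult[symmetric]) (auto intro!: nn_integral_cong simp: mult_ac)
  also have "\<dots> \<le> (\<integral>\<^sup>+x. 2 * (indicator A x * S x) + 2 * (indicator A x * T x) + 2 * (indicator A x * U x) \<partial>lborel)"
    using pw by (intro nn_integral_mono) (auto split: split_indicator)
  also have "\<dots> = 2 * (\<integral>\<^sup>+x. indicator A x * S x \<partial>lborel) + 2 * (\<integral>\<^sup>+x. indicator A x * T x \<partial>lborel)
      + 2 * (\<integral>\<^sup>+x. indicator A x * U x \<partial>lborel)"
    by (simp add: nn_integral_add nn_integral_cmult)
  also have "\<dots> \<le> 2 * (\<Sum>k\<in>K. ennreal ((cmod (I k))\<^sup>2))
      + 2 * (ennreal \<eta> * (\<integral>\<^sup>+x. ennreal ((cmod (f x))\<^sup>2) \<partial>lborel))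
      + 2 * (ennreal ((2 * \<rho>) ^ DIM('a)) * ennreal M)"
    by (intro add_mono mult_left_mono iS iT iU) simp_all
  finally show ?thesis unfolding I_def Q_def .
qed

text \<open>The cell estimate applies Tonelli's theorem to the product of Borel sigma-algebras, so
  classes and sets are first given Borel versions.\<close>

lemma borel_representative:
  obtains f :: "'a::euclidean_space \<Rightarrow> complex"
  where "f \<in> borel_measurable borel" "AE x in lebesgue. rep_L2 u x = f x"
proof -
  obtain g h where gh: "g \<in> borel_measurable lborel" "AE x in lborel. Re (rep_L2 u x) = g x"
    "h \<in> borel_measurable lborel" "AE x in lborel. Im (rep_L2 u x) = h x"
    using completion_ex_borel_measurable_real[of "\<lambda>x. Re (rep_L2 u x)" lborel]
      completion_ex_borel_measurable_real[of "\<lambda>x. Im (rep_L2 u x)" lborel] by auto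
  show ?thesis
  proof (rule that)
    show "(\<lambda>x. complex_of_real (g x) + \<i> * complex_of_real (h x)) \<in> borel_measurable borel"
      using gh by simp
    have "AE x in lborel. rep_L2 u x = complex_of_real (g x) + \<i> * complex_of_real (h x)"
      using gh(2,4) by eventually_elim (simp add: complex_eq_iff)
    then show "AE x in lebesgue. rep_L2 u x = complex_of_real (g x) + \<i> * complex_of_real (h x)"
      by (simp add: AE_completion)
  qed
qed

lemma borel_representative_set:
  assumes "A \<in> sets lebesgue"
  obtains A' where "A' \<in> sets borel" "AE x in lebesgue. x \<in> A \<longleftrightarrow> x \<in> A'"
    "emeasure lborel A' = emeasure lebesgue A"
proof -
  have "(indicator A :: 'a \<Rightarrow> real) \<in> borel_measurable lebesgue" using assms by measurable
  then obtain h :: "'a \<Rightarrow> real" where h [measurable]: "h \<in> borel_measurable lborel"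
    and ae: "AE x in lborel. indicator A x = h x"
    using completion_ex_borel_measurable_real by blast
  have ae': "AE x in lebesgue. x \<in> A \<longleftrightarrow> x \<in> {x. h x = 1}"
    using AE_completion[OF ae] by eventually_elim (auto simp: indicator_def split: if_splits)
  have B: "{x. h x = 1} \<in> sets borel" by simp
  have "emeasure lborel {x. h x = 1} = emeasure lebesgue {x. h x = 1}"
    using B by (simp add: emeasure_completion main_part_sets)
  also have "\<dots> = emeasure lebesgue A"
    using ae' assms B by (intro emeasure_eq_AE) (auto elim: eventually_mono)
  finally show ?thesis using that[OF B ae'] by blast
qed

text \<open>The only use of finite measure: cells are disjoint, so at most
  \<open>measure lborel A / \<eta>\<close> of them can hold more than \<open>\<eta>\<close> of
  \<open>A\<close>.\<close>

lemma finite_large_cells: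
  fixes A :: "'a::euclidean_space set"
  assumes [measurable]: "A \<in> sets borel" and fin: "emeasure lborel A < \<infinity>" and \<eta>: "\<eta> > 0"
  shows "finite {k. \<not> emeasure lborel (A \<inter> {x. cell \<rho> x = k}) \<le> ennreal \<eta>}"
proof -
  let ?m = "\<lambda>k. emeasure lborel (A \<inter> {x. cell \<rho> x = k})"
  let ?K = "{k. \<not> ?m k \<le> ennreal \<eta>}"
  have "finite ?K \<and> card ?K \<le> nat \<lceil>measure lborel A / \<eta>\<rceil>"
  proof (rule finite_if_finite_subsets_card_bdd)
    fix G assume G: "G \<subseteq> ?K" "finite G"
    have "ennreal (real (card G) * \<eta>) = (\<Sum>k\<in>G. ennreal \<eta>)"
      using \<eta> by (simp add: ennreal_mult ennreal_of_nat_eq_real_of_nat)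
    also have "\<dots> \<le> (\<Sum>k\<in>G. ?m k)"
      using G by (intro sum_mono) auto
    also have "\<dots> = emeasure lborel (\<Union>k\<in>G. A \<inter> {x. cell \<rho> x = k})"
      using G(2) by (intro sum_emeasure) (auto simp: disjoint_family_on_def)
    also have "\<dots> \<le> emeasure lborel A"
      by (intro emeasure_mono) auto
    also have "\<dots> = ennreal (measure lborel A)"
      using fin by (intro emeasure_eq_ennreal_measure) simp
    finally have "real (card G) * \<eta> \<le> measure lborel A" by (simp add: ennreal_le_iff)
    then have "real (card G) \<le> measure lborel A / \<eta>" using \<eta> by (simp add: pos_le_divide_eq)
    then show "card G \<le> nat \<lceil>measure lborel A / \<eta>\<rceil>" by linarith
  qed
  then show ?thesis ..
qed

lemma square_integrable_indicator:
  assumes "Q \<in> sets borel" "emeasure lborel Q < \<infinity>"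
  shows "square_integrable (\<lambda>x. indicator Q x :: complex)"
proof (rule square_integrableI)
  show "(\<lambda>x. indicator Q x :: complex) \<in> borel_measurable lebesgue"
    using assms(1) by (intro borel_measurable_lebesgueI) simp
  have "(\<integral>\<^sup>+x. ennreal ((cmod (indicator Q x))\<^sup>2) \<partial>lebesgue) = (\<integral>\<^sup>+x. indicator Q x \<partial>lebesgue)"
    by (intro nn_integral_cong) (auto split: split_indicator)
  also have "\<dots> < \<infinity>" using assms by (simp add: nn_integral_completion)
  finally show "(\<integral>\<^sup>+x. ennreal ((cmod (indicator Q x))\<^sup>2) \<partial>lebesgue) < \<infinity>" .
qed

lemma inner_indicator_L2:
  fixes Q :: "'a::euclidean_space set"
  assumes Q: "Q \<in> sets borel" "emeasure lborel Q < \<infinity>"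
    and f: "f \<in> borel_measurable borel" "AE x in lebesgue. rep_L2 u x = f x"
    and int: "integrable lborel (\<lambda>y. indicator Q y *\<^sub>R f y)"
  defines "w \<equiv> abs_L2 (\<lambda>x. indicator Q x)"
  shows "(cmod (\<integral>y. indicator Q y *\<^sub>R f y \<partial>lborel))\<^sup>2 = (w \<bullet> u)\<^sup>2 + ((\<i> *\<^sub>C w) \<bullet> u)\<^sup>2"
proof -
  note sq = square_integrable_indicator[OF Q]
  let ?J = "\<integral>y. indicator Q y *\<^sub>R f y \<partial>lborel"
  note [measurable] = Q(1) f(1)
  have m: "(\<lambda>x. g x \<bullet> rep_L2 u x) \<in> borel_measurable lebesgue"
    if "g \<in> borel_measurable borel" for g :: "'a \<Rightarrow> complex"
    by (intro borel_measurable_inner borel_measurable_lebesgueI that rep_L2_measurable)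
  have "w \<bullet> u = (\<integral>x. Re (indicator Q x *\<^sub>R f x) \<partial>lebesgue)"
    unfolding w_def inner_abs_L2_left[OF sq] using f(2)
    by (intro integral_cong_AE m borel_measurable_lebesgueI) (auto elim!: eventually_mono simp: inner_complex_def split: split_indicator)
  also have "\<dots> = (\<integral>x. Re (indicator Q x *\<^sub>R f x) \<partial>lborel)"
    by (rule integral_completion) simp
  also have "\<dots> = Re ?J" using int by (rule integral_Re)
  finally have 1: "w \<bullet> u = Re ?J" .
  have "(\<i> *\<^sub>C w) \<bullet> u = (\<integral>x. Im (indicator Q x *\<^sub>R f x) \<partial>lebesgue)"
    unfolding w_def abs_L2_cscale[OF sq] inner_abs_L2_left[OF square_integrable_mult[OF sq]] using f(2)
    by (intro integral_cong_AE m borel_measurable_lebesgueI) (auto elim!: eventually_mono simp: inner_complex_def split: split_indicator)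
  also have "\<dots> = (\<integral>x. Im (indicator Q x *\<^sub>R f x) \<partial>lborel)"
    by (rule integral_completion) simp
  also have "\<dots> = Im ?J" using int by (rule integral_Im)
  finally have 2: "(\<i> *\<^sub>C w) \<bullet> u = Im ?J" .
  show ?thesis unfolding 1 2 by (rule cmod_power2)
qed

lemma nn_integral_borel_representative:
  assumes "f \<in> borel_measurable borel" "AE x in lebesgue. rep_L2 u x = f x"
  shows "(\<integral>\<^sup>+x. ennreal ((cmod (f x))\<^sup>2) \<partial>lborel) = ennreal ((norm u)\<^sup>2)"
proof -
  have "(\<integral>\<^sup>+x. ennreal ((cmod (f x))\<^sup>2) \<partial>lborel) = (\<integral>\<^sup>+x. ennreal ((cmod (f x))\<^sup>2) \<partial>lebesgue)"
    by (simp add: nn_integral_completion)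
  also have "\<dots> = (\<integral>\<^sup>+x. ennreal ((cmod (rep_L2 u x))\<^sup>2) \<partial>lebesgue)"
    using assms(2) by (intro nn_integral_cong_AE) (auto elim: eventually_mono)
  finally show ?thesis by (simp add: nn_integral_rep_L2)
qed

text \<open>A quantitative form of the compactness of \<open>1\<^sub>A : H\<^sup>1 \<rightarrow> L\<^sup>2\<close>.\<close>

lemma compactness_on_finite_measure:
  fixes A :: "'a::euclidean_space set"
  assumes A: "A \<in> sets lebesgue" "emeasure lebesgue A < \<infinity>" and \<epsilon>: "\<epsilon> > 0"
  obtains F :: "'a L2 set" and C where "finite F" "C \<ge> 0"
    "\<And>u. u \<in> H1 \<Longrightarrow> (\<integral>x. indicator A x * (cmod (rep_L2 u x))\<^sup>2 \<partial>lebesgue)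
      \<le> \<epsilon> * ((norm u)\<^sup>2 + (\<Sum>b\<in>Basis. (norm (weak_deriv b u))\<^sup>2)) + C * (\<Sum>w\<in>F. (w \<bullet> u)\<^sup>2)"
proof -
  obtain A' where A' [measurable]: "A' \<in> sets borel" and AE_A: "AE x in lebesgue. x \<in> A \<longleftrightarrow> x \<in> A'"
    and mA: "emeasure lborel A' = emeasure lebesgue A"
    using borel_representative_set[OF A(1)] by blast
  define n where "n = DIM('a)"
  have n: "n > 0" by (simp add: n_def)
  \<comment> \<open>Makes the deviation term \<open>2 * ((2 * \<rho>) ^ n * M)\<close> equal to
    \<open>v * (\<epsilon> * D)\<close>, since \<open>M\<close> carries the factor
    \<open>\<rho>\<^sup>2 * n\<close>.\<close>
  define \<rho> where "\<rho> = sqrt (\<epsilon> / (2 ^ Suc n * n))"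
  have \<rho>: "\<rho> > 0" using \<epsilon> n by (simp add: \<rho>_def)
  have \<rho>2: "2 ^ Suc n * n * \<rho>\<^sup>2 = \<epsilon>" using \<epsilon> n by (simp add: \<rho>_def)
  define v where "v = \<rho> ^ n"
  have v: "v > 0" using \<rho> by (simp add: v_def)
  \<comment> \<open>Makes the tail term \<open>2 * (\<eta> * (norm u)\<^sup>2)\<close> equal to
    \<open>v * (\<epsilon> * (norm u)\<^sup>2)\<close>.\<close>
  define \<eta> where "\<eta> = \<epsilon> / 2 * v"
  have \<eta>: "\<eta> > 0" using \<epsilon> v by (simp add: \<eta>_def)
  define Q where "Q k = {x::'a. cell \<rho> x = k}" for k
  define K where "K = {k. \<not> emeasure lborel (A' \<inter> Q k) \<le> ennreal \<eta>}"
  have K: "finite K"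
    unfolding K_def Q_def using A(2) mA \<eta> by (intro finite_large_cells) auto
  have Qm: "Q k \<in> sets borel" for k unfolding Q_def by measurable
  have Qfin: "emeasure lborel (Q k) < \<infinity>" for k
  proof (cases "Q k = {}")
    case False
    then obtain x where "k = cell \<rho> x" by (auto simp: Q_def)
    then show ?thesis using emeasure_cell[OF \<rho>, of x] by (simp add: Q_def)
  qed simp
  define w where "w k = abs_L2 (\<lambda>x. indicator (Q k) x)" for k
  \<comment> \<open>Each complex cell integral is encoded by two real functionals.\<close>
  define F where "F = w ` K \<union> (\<lambda>k. \<i> *\<^sub>C w k) ` K"
  have F: "finite F" using K by (simp add: F_def)
  show ?thesis
  proof (rule that[OF F])
    \<comment> \<open>In this constant \<open>2 / v\<close> comes from the averaging inequality, and
      each of the \<open>card K\<close> cell integrals has squared modulus at most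
      \<open>2 * \<Sigma>\<close>.\<close>
    show "0 \<le> 2 / v * (2 * real (card K))" using v by simp
    fix u :: "'a L2" assume u: "u \<in> H1"
    obtain f where f [measurable]: "f \<in> borel_measurable borel" and uf: "AE x in lebesgue. rep_L2 u x = f x"
      by (rule borel_representative)
    define D where "D = (\<Sum>b\<in>Basis. (norm (weak_deriv b u))\<^sup>2)"
    have D: "0 \<le> D" by (simp add: D_def sum_nonneg)
    \<comment> \<open>The displacement is at most \<open>\<rho>\<close> in each of \<open>n\<close>
      directions; Cauchy-Schwarz for the sum over directions supplies the factor
      \<open>n\<close>.\<close>
    define M where "M = \<rho>\<^sup>2 * (n * D)"
    have M: "0 \<le> M" using D by (simp add: M_def)
    have norm_f: "(\<integral>\<^sup>+x. ennreal ((cmod (f x))\<^sup>2) \<partial>lborel) = ennreal ((norm u)\<^sup>2)"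
      by (rule nn_integral_borel_representative[OF f uf])
    have trans: "(\<integral>\<^sup>+x. ennreal ((cmod (f (x + s) - f x))\<^sup>2) \<partial>lborel) \<le> ennreal M"
      if s: "\<And>b. b \<in> Basis \<Longrightarrow> \<bar>s \<bullet> b\<bar> \<le> \<rho>" for s
    proof -
      have "AE x in lebesgue. rep_L2 (translate s u - u) x = f (x + s) - f x"
        using rep_L2_diff[of "translate s u" u] rep_translate[of s u] uf AE_lebesgue_translation[OF uf, of s]
        by eventually_elim simp
      then have "(\<integral>\<^sup>+x. ennreal ((cmod (f (x + s) - f x))\<^sup>2) \<partial>lborel) = ennreal ((norm (translate s u - u))\<^sup>2)"
        by (intro nn_integral_borel_representative) measurable
      also have "\<dots> \<le> ennreal M"
      proof (rule ennreal_leI)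
        have "norm (translate s u - u) \<le> (\<Sum>b\<in>Basis. \<rho> * norm (weak_deriv b u))"
          using norm_translate_diff_le[OF u, of s] s
          by (elim order_trans) (intro sum_mono mult_right_mono, auto)
        then have "(norm (translate s u - u))\<^sup>2 \<le> (\<Sum>b\<in>Basis. \<rho> * norm (weak_deriv b u))\<^sup>2"
          by (rule power_mono) simp
        also have "\<dots> = \<rho>\<^sup>2 * (\<Sum>b\<in>Basis. norm (weak_deriv b u))\<^sup>2"
          by (simp add: sum_distrib_left[symmetric] power_mult_distrib)
        also have "\<dots> \<le> \<rho>\<^sup>2 * (n * D)"
          using sum_squared_le_sum_of_squares[of "\<lambda>b. norm (weak_deriv b u)" Basis]
          unfolding n_def D_def by (intro mult_left_mono) (simp_all add: mult.commute)
        finally show "(norm (translate s u - u))\<^sup>2 \<le> M" by (simp add: M_def)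
      qed
      finally show ?thesis .
    qed
    define J where "J k = (cmod (\<integral>y. indicator (Q k) y *\<^sub>R f y \<partial>lborel))\<^sup>2" for k
    define X where "X = (\<integral>x. indicator A x * (cmod (rep_L2 u x))\<^sup>2 \<partial>lebesgue)"
    define \<Sigma> where "\<Sigma> = (\<Sum>w\<in>F. (w \<bullet> u)\<^sup>2)"
    have iX: "integrable lebesgue (\<lambda>x. indicator A x * (cmod (rep_L2 u x))\<^sup>2)"
      using integrable_real_mult_indicator[OF A(1) rep_L2_integrable[of u]] by (simp add: mult.commute)
    have X0: "0 \<le> X" unfolding X_def by (intro integral_nonneg_AE) auto
    have "ennreal X = (\<integral>\<^sup>+x. ennreal (indicator A x * (cmod (rep_L2 u x))\<^sup>2) \<partial>lebesgue)"
      unfolding X_def using iX by (intro nn_integral_eq_integral[symmetric]) auto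
    also have "\<dots> = (\<integral>\<^sup>+x. indicator A' x * ennreal ((cmod (f x))\<^sup>2) \<partial>lebesgue)"
    proof (rule nn_integral_cong_AE)
      show "AE x in lebesgue. ennreal (indicator A x * (cmod (rep_L2 u x))\<^sup>2) = indicator A' x * ennreal ((cmod (f x))\<^sup>2)"
        using AE_A uf by eventually_elim (simp split: split_indicator)
    qed
    also have "\<dots> = (\<integral>\<^sup>+x. indicator A' x * ennreal ((cmod (f x))\<^sup>2) \<partial>lborel)"
      by (simp add: nn_integral_completion)
    finally have X: "(\<integral>\<^sup>+x. indicator A' x * ennreal ((cmod (f x))\<^sup>2) \<partial>lborel) = ennreal X" ..
    have "ennreal v * ennreal X \<le> 2 * (\<Sum>k\<in>K. ennreal (J k)) + 2 * (ennreal \<eta> * ennreal ((norm u)\<^sup>2))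
        + 2 * (ennreal ((2 * \<rho>) ^ n) * ennreal M)"
      using cell_average_inequality[OF f _ \<rho> A' K, of \<eta> M] trans
      unfolding X norm_f Q_def[symmetric] J_def[symmetric] n_def[symmetric] v_def[symmetric]
      by (auto simp: K_def)
    also have "\<dots> = ennreal (2 * (\<Sum>k\<in>K. J k) + 2 * (\<eta> * (norm u)\<^sup>2) + 2 * ((2 * \<rho>) ^ n * M))"
      using \<eta> M \<rho> by (simp add: J_def sum_nonneg ennreal_plus[symmetric] ennreal_mult'[symmetric]
          ennreal_mult[symmetric] sum_ennreal del: ennreal_plus flip: ennreal_numeral)
    finally have "ennreal (v * X) \<le> ennreal (2 * (\<Sum>k\<in>K. J k) + 2 * (\<eta> * (norm u)\<^sup>2) + 2 * ((2 * \<rho>) ^ n * M))"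
      using v X0 by (simp add: ennreal_mult)
    then have main: "v * X \<le> 2 * (\<Sum>k\<in>K. J k) + 2 * (\<eta> * (norm u)\<^sup>2) + 2 * ((2 * \<rho>) ^ n * M)"
      using \<eta> M \<rho> by (subst (asm) ennreal_le_iff) (auto simp: J_def intro!: add_nonneg_nonneg sum_nonneg)
    have JF: "J k \<le> 2 * \<Sigma>" if k: "k \<in> K" for k
    proof -
      have "integrable lborel (\<lambda>y. indicator (Q k) y *\<^sub>R f y)"
        using Qm Qfin norm_f by (intro integrable_indicator_square) auto
      then have "J k = (w k \<bullet> u)\<^sup>2 + ((\<i> *\<^sub>C w k) \<bullet> u)\<^sup>2"
        unfolding J_def w_def by (intro inner_indicator_L2 Qm Qfin f uf)
      moreover have "(w k \<bullet> u)\<^sup>2 \<le> \<Sigma>" "((\<i> *\<^sub>C w k) \<bullet> u)\<^sup>2 \<le> \<Sigma>"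
        unfolding \<Sigma>_def using k
        by (intro member_le_sum[of _ F "\<lambda>w. (w \<bullet> u)\<^sup>2"] F; simp add: F_def)+
      ultimately show ?thesis by simp
    qed
    have "(\<Sum>k\<in>K. J k) \<le> (\<Sum>k\<in>K. 2 * \<Sigma>)" by (intro sum_mono JF)
    then have "(\<Sum>k\<in>K. J k) \<le> card K * (2 * \<Sigma>)" by simp
    with main have "v * X \<le> 2 * (card K * (2 * \<Sigma>)) + 2 * (\<eta> * (norm u)\<^sup>2) + 2 * ((2 * \<rho>) ^ n * M)"
      by linarith
    also have "2 * ((2 * \<rho>) ^ n * M) = v * ((2 ^ Suc n * n * \<rho>\<^sup>2) * D)"
      by (simp add: power_mult_distrib v_def M_def)
    also have "2 * (\<eta> * (norm u)\<^sup>2) = v * (\<epsilon> * (norm u)\<^sup>2)"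
      by (simp add: \<eta>_def)
    also have "2 * (card K * (2 * \<Sigma>)) = v * (2 / v * (2 * card K) * \<Sigma>)"
      using v by simp
    finally have "v * X \<le> v * (2 / v * (2 * card K) * \<Sigma> + \<epsilon> * (norm u)\<^sup>2 + \<epsilon> * D)"
      unfolding \<rho>2 by (simp only: distrib_left)
    then have "X \<le> 2 / v * (2 * card K) * \<Sigma> + \<epsilon> * (norm u)\<^sup>2 + \<epsilon> * D"
      using v by simp
    then show "(\<integral>x. indicator A x * (cmod (rep_L2 u x))\<^sup>2 \<partial>lebesgue)
      \<le> \<epsilon> * ((norm u)\<^sup>2 + (\<Sum>b\<in>Basis. (norm (weak_deriv b u))\<^sup>2)) + 2 / v * (2 * real (card K)) * (\<Sum>w\<in>F. (w \<bullet> u)\<^sup>2)"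
      unfolding X_def \<Sigma>_def D_def by (simp add: distrib_left)
  qed
qed

section \<open>Essential spectra of self-adjoint operators\<close>

text \<open>Each functional in \<open>F\<close> lowers the dimension by at most one, so its kernel
  is handled by induction and one extra vector outside the kernel is added.\<close>

lemma subset_span_if_separated:
  fixes N :: "'b::real_inner set"
  assumes "finite F" "subspace N" "\<And>u. u \<in> N \<Longrightarrow> (\<And>w. w \<in> F \<Longrightarrow> w \<bullet> u = 0) \<Longrightarrow> u = 0"
  shows "\<exists>B. finite B \<and> N \<subseteq> span B"
  using assms
proof (induction F arbitrary: N rule: finite_induct)
  case empty
  then have "N \<subseteq> span {}" by auto
  then show ?case by blast
next
  case (insert w F)
  let ?N = "{u \<in> N. w \<bullet> u = 0}"
  have "subspace ?N"
    using insert.prems(1) by (auto simp: subspace_def inner_add_right)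
  then obtain B where B: "finite B" "?N \<subseteq> span B"
    using insert.IH[of ?N] insert.prems(2) by blast
  show ?case
  proof (cases "?N = N")
    case True
    then show ?thesis using B by auto
  next
    case False
    then obtain v where v: "v \<in> N" "w \<bullet> v \<noteq> 0" by blast
    have "u \<in> span (insert v B)" if u: "u \<in> N" for u
    proof -
      let ?r = "(w \<bullet> u) / (w \<bullet> v)"
      have "u - ?r *\<^sub>R v \<in> ?N"
        using insert.prems(1) u v by (auto simp: inner_diff_right intro!: subspace_diff subspace_scale)
      then have "u - ?r *\<^sub>R v \<in> span (insert v B)"
        using B(2) span_mono[of B "insert v B"] by blast
      moreover have "?r *\<^sub>R v \<in> span (insert v B)"
        by (intro span_scale span_base) simp
      ultimately have "(u - ?r *\<^sub>R v) + ?r *\<^sub>R v \<in> span (insert v B)" by (rule span_add)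
      then show ?thesis by simp
    qed
    then show ?thesis using B(1) by (intro exI[of _ "insert v B"]) auto
  qed
qed

text \<open>Finite dimension is obtained over the reals, whereas \<open>discrete_spectrum\<close>
  asks for a finite complex spanning set.\<close>

lemma span_subset_complex_span: "span B \<subseteq> L2.span (B :: 'a::euclidean_space L2 set)"
proof (rule span_minimal)
  show "subspace (L2.span B)"
    by (auto simp: subspace_def scaleR_cscale intro: L2.span_zero L2.span_add L2.span_scale)
qed (auto intro: L2.span_base)

text \<open>Bolzano-Weierstrass, applied to one functional after another; this takes the place of
  weak compactness of the unit ball.\<close>

lemma finite_functionals_convergent_subsequence:
  fixes u :: "nat \<Rightarrow> 'b::real_inner"
  assumes "finite F" "\<And>n. norm (u n) \<le> K"
  shows "\<exists>r. strict_mono r \<and> (\<forall>w\<in>F. convergent (\<lambda>n. w \<bullet> u (r n)))"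
  using assms(1)
proof (induction F rule: finite_induct)
  case empty
  then show ?case by (intro exI[of _ id]) (auto simp: strict_mono_def)
next
  case (insert w F)
  then obtain r where r: "strict_mono r" "\<forall>w\<in>F. convergent (\<lambda>n. w \<bullet> u (r n))" by blast
  have "bounded (range (\<lambda>n. w \<bullet> u (r n)))"
    unfolding bounded_iff
  proof (intro exI ballI; elim rangeE)
    fix x n assume x: "x = w \<bullet> u (r n)"
    have "\<bar>w \<bullet> u (r n)\<bar> \<le> norm w * norm (u (r n))" by (rule Cauchy_Schwarz_ineq2)
    also have "\<dots> \<le> norm w * K" by (intro mult_left_mono assms(2)) simp
    finally show "norm x \<le> norm w * K" using x by simp
  qed
  then obtain l s where s: "strict_mono s" "((\<lambda>n. w \<bullet> u (r n)) \<circ> s) \<longlonglongrightarrow> l"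
    using bounded_imp_convergent_subsequence by blast
  have "convergent (\<lambda>n. w' \<bullet> u ((r \<circ> s) n))" if w': "w' \<in> insert w F" for w'
  proof (cases "w' = w")
    case True
    then show ?thesis using s(2) by (auto simp: convergent_def o_def)
  next
    case False
    then obtain l' where "(\<lambda>n. w' \<bullet> u (r n)) \<longlonglongrightarrow> l'"
      using w' r(2) by (auto simp: convergent_def)
    then have "((\<lambda>n. w' \<bullet> u (r n)) \<circ> s) \<longlonglongrightarrow> l'" using s(1) by (rule LIMSEQ_subseq_LIMSEQ)
    then show ?thesis by (auto simp: convergent_def o_def)
  qed
  then show ?case using strict_mono_o[OF r(1) s(1)] by blast
qed

lemma inner_i_cscale_self: "u \<bullet> (\<i> *\<^sub>C u) = 0"
  using cscale_inner_adjoint[of \<i> u u] by (simp add: inner_commute L2.scale_minus_left)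

text \<open>Symmetry and surjectivity of a real translate make the operator self-adjoint.\<close>

locale self_adjoint_operator =
  fixes A :: "'a::euclidean_space L2 operator" and t m :: real
  assumes dom_add: "u \<in> dom A \<Longrightarrow> v \<in> dom A \<Longrightarrow> u + v \<in> dom A"
    and dom_cscale: "u \<in> dom A \<Longrightarrow> c *\<^sub>C u \<in> dom A"
    and app_add: "u \<in> dom A \<Longrightarrow> v \<in> dom A \<Longrightarrow> app A (u + v) = app A u + app A v"
    and app_cscale: "u \<in> dom A \<Longrightarrow> app A (c *\<^sub>C u) = c *\<^sub>C app A u"
    and dom_0: "0 \<in> dom A"
    and symmetric: "u \<in> dom A \<Longrightarrow> v \<in> dom A \<Longrightarrow> app A u \<bullet> v = u \<bullet> app A v"
    and surj: "\<exists>u\<in>dom A. app A u + t *\<^sub>R u = f"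
    and m_pos: "m > 0"
    and lower: "u \<in> dom A \<Longrightarrow> m * norm u \<le> norm (app A u + t *\<^sub>R u)"
begin

lemma dom_scaleR: "u \<in> dom A \<Longrightarrow> r *\<^sub>R u \<in> dom A"
  unfolding scaleR_cscale by (rule dom_cscale)

lemma app_scaleR: "u \<in> dom A \<Longrightarrow> app A (r *\<^sub>R u) = r *\<^sub>R app A u"
  unfolding scaleR_cscale by (rule app_cscale)

lemma dom_diff: "u \<in> dom A \<Longrightarrow> v \<in> dom A \<Longrightarrow> u - v \<in> dom A"
  using dom_add[of u "(- 1) *\<^sub>R v"] dom_scaleR[of v "- 1"] by simp

lemma app_diff: "u \<in> dom A \<Longrightarrow> v \<in> dom A \<Longrightarrow> app A (u - v) = app A u - app A v"
  using app_add[of u "(- 1) *\<^sub>R v"] dom_scaleR[of v "- 1"] app_scaleR[of v "- 1"] by simp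

lemma app_0: "app A 0 = 0"
  using app_diff[OF dom_0 dom_0] by simp

text \<open>The solution \<open>w\<close> of
  \<open>app A w + t *\<^sub>R w = y + t *\<^sub>R u\<close> is the only candidate, and the lower
  bound at \<open>- t\<close> forces the sequence to converge to it.\<close>

lemma closed_operator:
  assumes x: "\<And>n. x n \<in> dom A" "x \<longlonglongrightarrow> u" "(\<lambda>n. app A (x n)) \<longlonglongrightarrow> y"
  shows "u \<in> dom A \<and> app A u = y"
proof -
  obtain w where w: "w \<in> dom A" "app A w + t *\<^sub>R w = y + t *\<^sub>R u" using surj by blast
  have "(\<lambda>n. norm (app A (x n) + t *\<^sub>R x n - (y + t *\<^sub>R u)) / m) \<longlonglongrightarrow> norm (y + t *\<^sub>R u - (y + t *\<^sub>R u)) / m"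
    using m_pos by (intro tendsto_intros x) auto
  then have lim: "(\<lambda>n. norm (app A (x n) + t *\<^sub>R x n - (y + t *\<^sub>R u)) / m) \<longlonglongrightarrow> 0" by simp
  have "norm (x n - w) \<le> norm (app A (x n) + t *\<^sub>R x n - (y + t *\<^sub>R u)) / m" for n
  proof -
    have eq: "app A (x n - w) + t *\<^sub>R (x n - w) = app A (x n) + t *\<^sub>R x n - (y + t *\<^sub>R u)"
      unfolding w(2)[symmetric] by (simp add: app_diff x w(1) scaleR_diff_right)
    show ?thesis
      using lower[OF dom_diff[OF x(1)[of n] w(1)]] m_pos unfolding eq by (simp add: pos_le_divide_eq mult.commute)
  qed
  then have "(\<lambda>n. x n - w) \<longlonglongrightarrow> 0"
    by (intro Lim_null_comparison[OF _ lim]) auto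
  then have "x \<longlonglongrightarrow> w" by (simp add: LIM_zero_iff)
  then have "u = w" using x(2) LIMSEQ_unique by blast
  then show ?thesis using w by simp
qed

text \<open>A vector orthogonal to the range of \<open>A - z\<close> is an eigenvector of the
  adjoint. With \<open>w\<close> solving the shifted equation for the expected image of
  \<open>y\<close>, symmetry shows that \<open>w - y\<close> is orthogonal to the range of
  \<open>A + t\<close>, which is everything; so \<open>y = w\<close> lies in
  \<open>dom A\<close>.\<close>

lemma adjoint_eigenvector:
  assumes y: "\<And>u. u \<in> dom A \<Longrightarrow> (app A u - z *\<^sub>C u) \<bullet> y = 0"
  shows "y \<in> dom A \<and> app A y = cnj z *\<^sub>C y"
proof -
  obtain w where w: "w \<in> dom A" "app A w + t *\<^sub>R w = cnj z *\<^sub>C y + t *\<^sub>R y" using surj by blast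
  have *: "w \<bullet> (app A u + t *\<^sub>R u) = y \<bullet> (app A u + t *\<^sub>R u)" if u: "u \<in> dom A" for u
  proof -
    have "w \<bullet> (app A u + t *\<^sub>R u) = (app A w + t *\<^sub>R w) \<bullet> u"
      using symmetric[OF w(1) u] by (simp add: inner_add_left inner_add_right)
    also have "\<dots> = y \<bullet> (z *\<^sub>C u) + t * (y \<bullet> u)"
      unfolding w(2) inner_add_left cscale_inner_adjoint by simp
    also have "y \<bullet> (z *\<^sub>C u) = y \<bullet> app A u"
      using y[OF u] by (simp add: inner_diff_left inner_commute[of y])
    finally show ?thesis by (simp add: inner_add_right)
  qed
  obtain u where u: "u \<in> dom A" "app A u + t *\<^sub>R u = w - y" using surj by blast
  have "(w - y) \<bullet> (w - y) = 0"
    using *[OF u(1)] unfolding u(2) by (simp add: inner_diff_left)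
  then have "w = y" by simp
  then show ?thesis using w by simp
qed

text \<open>The bound at \<open>z\<close> gives injectivity, closed range and a bounded inverse; the
  bound at \<open>cnj z\<close> excludes vectors orthogonal to the range, which is therefore
  dense.\<close>

lemma resolvent_setI:
  assumes \<kappa>: "\<kappa> > 0" "\<And>u. u \<in> dom A \<Longrightarrow> \<kappa> * norm u \<le> norm (app A u - z *\<^sub>C u)"
    "\<And>u. u \<in> dom A \<Longrightarrow> \<kappa> * norm u \<le> norm (app A u - cnj z *\<^sub>C u)"
  shows "z \<in> resolvent_set A"
proof -
  define T where "T u = app A u - z *\<^sub>C u" for u
  have T_add: "T (u + v) = T u + T v" if "u \<in> dom A" "v \<in> dom A" for u v
    using that by (simp add: T_def app_add L2.scale_right_distrib)
  have T_scale: "T (r *\<^sub>R u) = r *\<^sub>R T u" if "u \<in> dom A" for u r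
    using that by (simp add: T_def app_scaleR scaleR_diff_right)
      (simp add: scaleR_cscale L2.scale_left_commute mult.commute)
  have T_diff: "T (u - v) = T u - T v" if "u \<in> dom A" "v \<in> dom A" for u v
    using that T_add[of u "(- 1) *\<^sub>R v"] T_scale[of v "- 1"] dom_scaleR[of v "- 1"] by simp
  have T_lower: "\<kappa> * norm u \<le> norm (T u)" if "u \<in> dom A" for u
    using \<kappa>(2)[OF that] by (simp add: T_def)
  have inj: "inj_on T (dom A)"
  proof (rule inj_onI)
    fix u v assume uv: "u \<in> dom A" "v \<in> dom A" "T u = T v"
    then have "\<kappa> * norm (u - v) \<le> 0" using T_lower[OF dom_diff[OF uv(1,2)]] by (simp add: T_diff)
    then show "u = v" using \<kappa>(1) by (simp add: mult_le_0_iff)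
  qed
  have sub: "subspace (T ` dom A)"
    unfolding subspace_def
  proof (intro conjI ballI allI)
    have "T 0 = 0" by (simp add: T_def app_0)
    then show "0 \<in> T ` dom A" using dom_0 by (metis image_eqI)
    fix x assume "x \<in> T ` dom A"
    then obtain u where u: "u \<in> dom A" "x = T u" by (rule imageE)
    {
      fix y assume "y \<in> T ` dom A"
      then obtain v where v: "v \<in> dom A" "y = T v" by (rule imageE)
      show "x + y \<in> T ` dom A"
        using u v T_add[OF u(1) v(1)] dom_add[OF u(1) v(1)] by (intro image_eqI[of _ _ "u + v"]) simp_all
    next
      fix r show "r *\<^sub>R x \<in> T ` dom A"
        using u T_scale[OF u(1)] dom_scaleR[OF u(1)] by (intro image_eqI[of _ _ "r *\<^sub>R u"]) simp_all
    }
  qed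
  have "closure (T ` dom A) = UNIV"
  proof (rule closure_eq_UNIV_if_orthogonal_trivial[OF sub])
    fix y assume "\<And>v. v \<in> T ` dom A \<Longrightarrow> v \<bullet> y = 0"
    then have "y \<in> dom A \<and> app A y = cnj z *\<^sub>C y"
      by (intro adjoint_eigenvector) (auto simp: T_def)
    then have "\<kappa> * norm y \<le> 0" using \<kappa>(3)[of y] by simp
    then show "y = 0" using \<kappa>(1) by (simp add: mult_le_0_iff)
  qed
  moreover have "closure (T ` dom A) \<subseteq> T ` dom A"
  proof
    fix f assume "f \<in> closure (T ` dom A)"
    then obtain g where g: "\<forall>n. g n \<in> T ` dom A" "g \<longlonglongrightarrow> f" unfolding closure_sequential by blast
    have "\<forall>n. \<exists>u. u \<in> dom A \<and> g n = T u" using g(1) by blast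
    from choice[OF this] obtain x where x: "\<And>n. x n \<in> dom A" "\<And>n. g n = T (x n)" by blast
    have "convergent x"
    proof (rule convergent_if_norm_diff_le[OF g(2)])
      show "norm (x k - x n) \<le> 1 / \<kappa> * norm (g k - g n)" for k n
        using T_lower[OF dom_diff[OF x(1)[of k] x(1)[of n]]] \<kappa>(1)
        by (simp add: x T_diff pos_le_divide_eq mult.commute)
    qed
    then obtain u where u: "x \<longlonglongrightarrow> u" by (auto simp: convergent_def)
    have "(\<lambda>n. z *\<^sub>C x n) \<longlonglongrightarrow> z *\<^sub>C u"
      by (rule bounded_linear.tendsto[OF bounded_linear_cscale u])
    then have "(\<lambda>n. g n + z *\<^sub>C x n) \<longlonglongrightarrow> f + z *\<^sub>C u" using g(2) by (intro tendsto_add)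
    then have "(\<lambda>n. app A (x n)) \<longlonglongrightarrow> f + z *\<^sub>C u" by (simp add: x(2) T_def)
    then have "u \<in> dom A" "app A u = f + z *\<^sub>C u" using closed_operator[OF x(1) u] by blast+
    then show "f \<in> T ` dom A" by (intro image_eqI[of _ _ u]) (simp_all add: T_def)
  qed
  ultimately have range: "T ` dom A = UNIV" by blast
  have bij: "bij_betw T (dom A) UNIV" using inj range by (simp add: bij_betw_def)
  define R where "R = resolvent A z"
  have R: "R f \<in> dom A" "T (R f) = f" for f
    using inv_into_into[of f T "dom A"] f_inv_into_f[of f T "dom A"] range
    unfolding R_def resolvent_def T_def[abs_def] by auto
  have R_T: "R f = u" if "u \<in> dom A" "T u = f" for u f
    using inj_onD[OF inj _ R(1) that(1)] R(2) that(2) by simp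
  have "bounded_linear R"
  proof
    show "R (f + g) = R f + R g" for f g
      by (intro R_T dom_add R) (simp add: T_add R)
    show "R (r *\<^sub>R f) = r *\<^sub>R R f" for r f
      by (intro R_T dom_scaleR R) (simp add: T_scale R)
    show "\<exists>K. \<forall>f. norm (R f) \<le> norm f * K"
      using T_lower[OF R(1)] \<kappa>(1)
      by (intro exI[of _ "1 / \<kappa>"]) (simp add: R(2) pos_le_divide_eq mult.commute)
  qed
  then show ?thesis using bij by (simp add: resolvent_set_def R_def T_def[abs_def])
qed

text \<open>By symmetry \<open>app A u - Re z *\<^sub>R u\<close> is orthogonal, in the real inner
  product, to \<open>\<i> *\<^sub>C u\<close>, so Pythagoras applies.\<close>

lemma norm_shifted_ge_Im:
  assumes u: "u \<in> dom A"
  shows "\<bar>Im z\<bar> * norm u \<le> norm (app A u - z *\<^sub>C u)"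
proof -
  define y where "y = app A u - Re z *\<^sub>R u"
  have z: "z *\<^sub>C u = Re z *\<^sub>R u + Im z *\<^sub>R (\<i> *\<^sub>C u)"
  proof -
    have "z = complex_of_real (Re z) + complex_of_real (Im z) * \<i>" by (simp add: complex_eq_iff)
    then have "z *\<^sub>C u = (complex_of_real (Re z) + complex_of_real (Im z) * \<i>) *\<^sub>C u" by simp
    also have "\<dots> = Re z *\<^sub>R u + Im z *\<^sub>R (\<i> *\<^sub>C u)"
      by (simp only: scaleR_cscale L2.scale_left_distrib L2.scale_scale)
    finally show ?thesis .
  qed
  have "app A u \<bullet> (\<i> *\<^sub>C u) = u \<bullet> (\<i> *\<^sub>C app A u)"
    using symmetric[OF u dom_cscale[OF u]] by (simp add: app_cscale[OF u])
  also have "\<dots> = - ((\<i> *\<^sub>C u) \<bullet> app A u)"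
    by (simp add: cscale_inner_adjoint L2.scale_minus_left)
  finally have "app A u \<bullet> (\<i> *\<^sub>C u) = 0" by (simp add: inner_commute)
  then have orth: "y \<bullet> (\<i> *\<^sub>C u) = 0"
    by (simp add: y_def inner_diff_left inner_i_cscale_self)
  have "app A u - z *\<^sub>C u = y - Im z *\<^sub>R (\<i> *\<^sub>C u)"
    by (simp add: z y_def)
  then have "(norm (app A u - z *\<^sub>C u))\<^sup>2 = (norm y)\<^sup>2 + (\<bar>Im z\<bar> * norm u)\<^sup>2"
    using orth norm_add_Pythagorean[of y "- (Im z *\<^sub>R (\<i> *\<^sub>C u))"] by (simp add: orthogonal_def)
  then have "(\<bar>Im z\<bar> * norm u)\<^sup>2 \<le> (norm (app A u - z *\<^sub>C u))\<^sup>2" by simp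
  then show ?thesis by (rule power2_le_imp_le) simp
qed

lemma nonreal_in_resolvent_set:
  assumes "Im z \<noteq> 0" shows "z \<in> resolvent_set A"
  using assms norm_shifted_ge_Im[of _ z] norm_shifted_ge_Im[of _ "cnj z"]
  by (intro resolvent_setI[of "\<bar>Im z\<bar>"]) auto

lemma eigenspace_cscale: "u \<in> eigenspace A z \<Longrightarrow> c *\<^sub>C u \<in> eigenspace A z"
  by (simp add: eigenspace_def dom_cscale app_cscale L2.scale_left_commute)

lemma subspace_eigenspace: "subspace (eigenspace A z)"
  unfolding subspace_def
proof (intro conjI ballI allI)
  show "0 \<in> eigenspace A z" by (simp add: eigenspace_def dom_0 app_0)
  fix u assume u: "u \<in> eigenspace A z"
  show "r *\<^sub>R u \<in> eigenspace A z" for r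
    unfolding scaleR_cscale using u by (rule eigenspace_cscale)
  fix v assume "v \<in> eigenspace A z"
  then show "u + v \<in> eigenspace A z"
    using u by (simp add: eigenspace_def dom_add app_add L2.scale_right_distrib)
qed

lemma complete_eigenspace: "complete (eigenspace A z)"
proof -
  have "closed (eigenspace A z)"
    unfolding closed_sequential_limits
  proof (intro allI impI; elim conjE)
    fix x u assume x: "\<forall>n. x n \<in> eigenspace A z" and u: "x \<longlonglongrightarrow> u"
    have "(\<lambda>n. z *\<^sub>C x n) \<longlonglongrightarrow> z *\<^sub>C u"
      by (rule bounded_linear.tendsto[OF bounded_linear_cscale u])
    then have "(\<lambda>n. app A (x n)) \<longlonglongrightarrow> z *\<^sub>C u"
      using x by (simp add: eigenspace_def)
    then show "u \<in> eigenspace A z"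
      using closed_operator[of x u] x u by (simp add: eigenspace_def)
  qed
  then show ?thesis by (simp add: complete_eq_closed)
qed

section \<open>Discreteness of the spectrum below a bound of finite-rank defect\<close>

context
  fixes E c C :: real and F :: "'a L2 set"
  assumes Ec: "E < c" and F: "finite F"
    and coercive: "\<And>u. u \<in> dom A \<Longrightarrow> c * (norm u)\<^sup>2 - C * (\<Sum>w\<in>F. (w \<bullet> u)\<^sup>2) \<le> app A u \<bullet> u"
begin

text \<open>An eigenvector annihilated by all of \<open>F\<close> would satisfy
  \<open>c * (norm u)\<^sup>2 \<le> E * (norm u)\<^sup>2\<close>, so \<open>F\<close> separates the
  eigenspace from zero.\<close>

lemma eigenspace_finite_dimensional: "\<exists>B. finite B \<and> eigenspace A (of_real E) \<subseteq> L2.span B"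
proof -
  have "u = 0" if u: "u \<in> eigenspace A (of_real E)" and w: "\<And>w. w \<in> F \<Longrightarrow> w \<bullet> u = 0" for u
  proof -
    have "app A u = E *\<^sub>R u" "u \<in> dom A" using u by (auto simp: eigenspace_def scaleR_cscale)
    then have "c * (norm u)\<^sup>2 \<le> E * (norm u)\<^sup>2"
      using coercive[of u] w by (simp add: power2_norm_eq_inner)
    then have "(c - E) * (norm u)\<^sup>2 \<le> 0" by (simp add: algebra_simps)
    then show ?thesis using Ec by (simp add: mult_le_0_iff)
  qed
  then show ?thesis
    using subset_span_if_separated[OF F subspace_eigenspace[of "of_real E"]]
      span_subset_complex_span by (meson subset_trans)
qed

text \<open>Otherwise there are unit vectors orthogonal to the eigenspace that are nearly
  eigenvectors. Along a subsequence the functionals in \<open>F\<close> converge, and coercivity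
  applied to differences makes the sequence Cauchy. Its limit is a unit eigenvector orthogonal to
  the eigenspace.\<close>

lemma orthogonal_lower_bound:
  obtains \<kappa> where "\<kappa> > 0"
    "\<And>u. u \<in> dom A \<Longrightarrow> (\<And>s. s \<in> eigenspace A (of_real E) \<Longrightarrow> u \<bullet> s = 0) \<Longrightarrow>
      \<kappa> * norm u \<le> norm (app A u - E *\<^sub>R u)"
proof -
  let ?N = "eigenspace A (of_real E)"
  have "\<exists>\<kappa>>0. \<forall>u\<in>dom A. (\<forall>s\<in>?N. u \<bullet> s = 0) \<longrightarrow> \<kappa> * norm u \<le> norm (app A u - E *\<^sub>R u)"
  proof (rule ccontr)
    assume neg: "\<not> ?thesis"
    have "\<exists>u. u \<in> dom A \<and> (\<forall>s\<in>?N. u \<bullet> s = 0) \<and> norm u = 1 \<and> norm (app A u - E *\<^sub>R u) \<le> inverse (real (Suc n))" for n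
    proof -
      obtain v where v: "v \<in> dom A" "\<forall>s\<in>?N. v \<bullet> s = 0"
        "norm (app A v - E *\<^sub>R v) < inverse (real (Suc n)) * norm v"
      proof -
        have "0 < inverse (real (Suc n))" by simp
        then have "\<not> (\<forall>u\<in>dom A. (\<forall>s\<in>?N. u \<bullet> s = 0) \<longrightarrow> inverse (real (Suc n)) * norm u \<le> norm (app A u - E *\<^sub>R u))"
          using neg by blast
        then show thesis using that not_le by blast
      qed
      have nv: "norm v > 0" using le_less_trans[OF norm_ge_zero v(3)] by (auto simp: zero_less_mult_iff)
      let ?u = "inverse (norm v) *\<^sub>R v"
      have "app A ?u - E *\<^sub>R ?u = inverse (norm v) *\<^sub>R (app A v - E *\<^sub>R v)"
        using v(1) by (simp add: app_scaleR scaleR_diff_right mult.commute)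
      then have "norm (app A ?u - E *\<^sub>R ?u) = norm (app A v - E *\<^sub>R v) / norm v"
        by (simp add: divide_inverse mult.commute)
      also have "\<dots> \<le> inverse (real (Suc n))"
        using v(3) nv by (simp add: pos_divide_le_eq)
      finally show ?thesis
        using v nv by (intro exI[of _ ?u]) (simp add: dom_scaleR)
    qed
    then have "\<forall>n. \<exists>u. u \<in> dom A \<and> (\<forall>s\<in>?N. u \<bullet> s = 0) \<and> norm u = 1 \<and>
        norm (app A u - E *\<^sub>R u) \<le> inverse (real (Suc n))" ..
    from choice[OF this] obtain x where x: "\<And>n. x n \<in> dom A" "\<And>n s. s \<in> ?N \<Longrightarrow> x n \<bullet> s = 0"
      "\<And>n. norm (x n) = 1" "\<And>n. norm (app A (x n) - E *\<^sub>R x n) \<le> inverse (real (Suc n))"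
      by blast
    obtain r where r: "strict_mono r" "\<And>w. w \<in> F \<Longrightarrow> convergent (\<lambda>n. w \<bullet> x (r n))"
      using finite_functionals_convergent_subsequence[OF F, of x 1] x(3) by auto
    define y where "y n = x (r n)" for n
    define q where "q n = app A (y n) - E *\<^sub>R y n" for n
    \<comment> \<open>Chosen so that pairing a difference of the \<open>p n\<close> with the
      corresponding difference of the \<open>y n\<close> gives precisely the sum of squares in the
      coercivity estimate.\<close>
    define p where "p n = (\<Sum>w\<in>F. (w \<bullet> y n) *\<^sub>R w)" for n
    have y: "y n \<in> dom A" "norm (y n) = 1" for n using x by (simp_all add: y_def)
    have q0: "q \<longlonglongrightarrow> 0"
    proof (rule Lim_null_comparison)
      show "\<forall>\<^sub>F n in sequentially. norm (q n) \<le> inverse (real (Suc (r n)))"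
        using x(4) by (simp add: q_def y_def)
      show "(\<lambda>n. inverse (real (Suc (r n)))) \<longlonglongrightarrow> 0"
        using LIMSEQ_subseq_LIMSEQ[OF LIMSEQ_inverse_real_of_nat r(1)] by (simp add: o_def)
    qed
    have "convergent p"
    proof -
      obtain l where "\<And>w. w \<in> F \<Longrightarrow> (\<lambda>n. w \<bullet> y n) \<longlonglongrightarrow> l w"
        using r(2) unfolding convergent_def y_def by metis
      then have "p \<longlonglongrightarrow> (\<Sum>w\<in>F. l w *\<^sub>R w)"
        unfolding p_def[abs_def] by (intro tendsto_sum tendsto_scaleR tendsto_const)
      then show ?thesis by (auto simp: convergent_def)
    qed
    then have pC: "Cauchy p" by (rule convergent_Cauchy)
    have qC: "Cauchy q" using q0 by (rule LIMSEQ_imp_Cauchy)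
    \<comment> \<open>Differences of unit vectors have norm at most two, which accounts for both
      summands.\<close>
    define K where "K = 2 * \<bar>C\<bar> + 2"
    have key: "(c - E) * (norm (y k - y n))\<^sup>2 \<le> K * (norm (q k - q n) + norm (p k - p n))" for k n
    proof -
      define d where "d = y k - y n"
      have d: "d \<in> dom A" "norm d \<le> 2"
        using y norm_triangle_ineq4[of "y k" "y n"] by (auto simp: d_def dom_diff)
      have qd: "q k - q n = app A d - E *\<^sub>R d"
        by (simp add: q_def d_def app_diff y scaleR_diff_right)
      have "p k - p n = (\<Sum>w\<in>F. (w \<bullet> d) *\<^sub>R w)"
        by (simp add: p_def d_def inner_diff_right scaleR_diff_left sum_subtractf)
      then have pd: "(p k - p n) \<bullet> d = (\<Sum>w\<in>F. (w \<bullet> d)\<^sup>2)"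
        by (simp add: inner_sum_left power2_eq_square)
      have bd: "\<bar>v \<bullet> d\<bar> \<le> 2 * norm v" for v
        using Cauchy_Schwarz_ineq2[of v d] mult_left_mono[OF d(2), of "norm v"] by (simp add: mult.commute)
      have "(c - E) * (norm d)\<^sup>2 \<le> (q k - q n) \<bullet> d + C * ((p k - p n) \<bullet> d)"
        using coercive[OF d(1)] unfolding pd qd
        by (simp add: inner_diff_left power2_norm_eq_inner algebra_simps)
      also have "C * ((p k - p n) \<bullet> d) \<le> \<bar>C\<bar> * \<bar>(p k - p n) \<bullet> d\<bar>"
        by (metis abs_ge_self abs_mult)
      also have "\<dots> \<le> \<bar>C\<bar> * (2 * norm (p k - p n))"
        by (intro mult_left_mono bd) simp
      also have "(q k - q n) \<bullet> d \<le> 2 * norm (q k - q n)"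
        using bd[of "q k - q n"] by simp
      also have "2 * norm (q k - q n) + \<bar>C\<bar> * (2 * norm (p k - p n)) \<le> K * (norm (q k - q n) + norm (p k - p n))"
        by (simp add: K_def distrib_left distrib_right)
      finally show ?thesis by (simp add: d_def)
    qed
    have "Cauchy y"
    proof (rule CauchyI)
      fix e :: real assume e: "0 < e"
      have K0: "K > 0" by (simp add: K_def add_nonneg_pos)
      define e' where "e' = (c - E) * e\<^sup>2 / (2 * K)"
      have e': "e' > 0" using e Ec K0 by (simp add: e'_def)
      obtain N1 where N1: "\<And>k n. k \<ge> N1 \<Longrightarrow> n \<ge> N1 \<Longrightarrow> norm (q k - q n) < e'"
        using CauchyD[OF qC e'] by blast
      obtain N2 where N2: "\<And>k n. k \<ge> N2 \<Longrightarrow> n \<ge> N2 \<Longrightarrow> norm (p k - p n) < e'"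
        using CauchyD[OF pC e'] by blast
      show "\<exists>M. \<forall>k\<ge>M. \<forall>n\<ge>M. norm (y k - y n) < e"
      proof (intro exI[of _ "max N1 N2"] allI impI)
        fix k n assume kn: "max N1 N2 \<le> k" "max N1 N2 \<le> n"
        have "(c - E) * (norm (y k - y n))\<^sup>2 \<le> K * (norm (q k - q n) + norm (p k - p n))" by (rule key)
        also have "\<dots> < K * (e' + e')"
          using N1[of k n] N2[of k n] kn K0 by (intro mult_strict_left_mono add_strict_mono) auto
        also have "\<dots> = (c - E) * e\<^sup>2" using K0 by (simp add: e'_def)
        finally have "(norm (y k - y n))\<^sup>2 < e\<^sup>2" using Ec by simp
        then show "norm (y k - y n) < e" using e by (simp add: power_less_imp_less_base)
      qed
    qed
    then obtain u where u: "y \<longlonglongrightarrow> u" using Cauchy_convergent by (auto simp: convergent_def)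
    have "(\<lambda>n. q n + E *\<^sub>R y n) \<longlonglongrightarrow> 0 + E *\<^sub>R u" by (intro tendsto_intros q0 u)
    then have "(\<lambda>n. app A (y n)) \<longlonglongrightarrow> E *\<^sub>R u" by (simp add: q_def)
    then have uN: "u \<in> ?N" using closed_operator[OF y(1) u] by (simp add: eigenspace_def scaleR_cscale)
    have "(\<lambda>n. y n \<bullet> u) \<longlonglongrightarrow> u \<bullet> u" by (intro tendsto_intros u)
    moreover have "y n \<bullet> u = 0" for n using x(2)[OF uN] by (simp add: y_def)
    ultimately have "u \<bullet> u = 0" by (simp add: LIMSEQ_const_iff)
    moreover have "norm u = 1"
      using tendsto_norm[OF u] y(2) by (simp add: LIMSEQ_const_iff)
    ultimately show False by simp
  qed
  then show ?thesis using that by blast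
qed

lemma in_discrete_spectrum:
  assumes spec: "complex_of_real E \<in> spectrum A"
  shows "complex_of_real E \<in> discrete_spectrum A"
proof -
  let ?N = "eigenspace A (of_real E)"
  obtain \<kappa> where \<kappa>: "\<kappa> > 0" "\<And>u. u \<in> dom A \<Longrightarrow> (\<And>s. s \<in> ?N \<Longrightarrow> u \<bullet> s = 0) \<Longrightarrow>
      \<kappa> * norm u \<le> norm (app A u - E *\<^sub>R u)"
    using orthogonal_lower_bound by blast
  have "?N \<noteq> {0}"
  proof
    assume "?N = {0}"
    then have "\<kappa> * norm u \<le> norm (app A u - complex_of_real E *\<^sub>C u)" if "u \<in> dom A" for u
      using \<kappa>(2)[OF that] by (simp add: scaleR_cscale)
    then have "complex_of_real E \<in> resolvent_set A"
      using \<kappa>(1) by (intro resolvent_setI) auto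
    then show False using spec by (simp add: spectrum_def)
  qed
  \<comment> \<open>Split \<open>u\<close> into its component \<open>p\<close> in the eigenspace and
    the orthogonal rest \<open>x\<close>. On \<open>p\<close> the operator \<open>A - z\<close> is
    multiplication by \<open>- \<zeta>\<close>; on \<open>x\<close> it is bounded below by
    \<open>\<kappa> - cmod \<zeta>\<close>, which is at least \<open>cmod \<zeta>\<close> within
    radius \<open>\<kappa> / 2\<close>. Symmetry keeps the two images orthogonal, so the bounds
    combine by Pythagoras.\<close>
  moreover have est: "cmod (z - of_real E) * norm u \<le> norm (app A u - z *\<^sub>C u)"
    if z: "cmod (z - of_real E) < \<kappa> / 2" and u: "u \<in> dom A" for z u
  proof -
    define \<zeta> where "\<zeta> = z - of_real E"
    obtain p where p: "p \<in> ?N" "\<And>s. s \<in> ?N \<Longrightarrow> (u - p) \<bullet> s = 0"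
      using orthogonal_projection_exists[OF subspace_eigenspace complete_eigenspace] by blast
    define x where "x = u - p"
    have pd: "p \<in> dom A" "app A p = E *\<^sub>R p" using p(1) by (auto simp: eigenspace_def scaleR_cscale)
    have xd: "x \<in> dom A" using u pd by (simp add: x_def dom_diff)
    have xN: "x \<bullet> s = 0" if "s \<in> ?N" for s using p(2)[OF that] by (simp add: x_def)
    define y where "y = app A x - E *\<^sub>R x - \<zeta> *\<^sub>C x"
    have z_eq: "z *\<^sub>C v = E *\<^sub>R v + \<zeta> *\<^sub>C v" for v
      by (simp add: \<zeta>_def scaleR_cscale L2.scale_left_distrib[symmetric])
    have "u = p + x" by (simp add: x_def)
    then have eq: "app A u - z *\<^sub>C u = y - \<zeta> *\<^sub>C p"
      using pd xd by (simp add: y_def z_eq app_add scaleR_add_right L2.scale_right_distrib)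
    have "y \<bullet> s = 0" if s: "s \<in> ?N" for s
    proof -
      have "app A s = E *\<^sub>R s" "s \<in> dom A" using s by (auto simp: eigenspace_def scaleR_cscale)
      then have "(app A x - E *\<^sub>R x) \<bullet> s = 0" using symmetric[OF xd] by (simp add: inner_diff_left)
      moreover have "(\<zeta> *\<^sub>C x) \<bullet> s = 0"
        unfolding cscale_inner_adjoint by (intro xN eigenspace_cscale s)
      ultimately show ?thesis by (simp add: y_def inner_diff_left)
    qed
    then have "y \<bullet> (\<zeta> *\<^sub>C p) = 0" using eigenspace_cscale p(1) by blast
    then have n1: "(norm (app A u - z *\<^sub>C u))\<^sup>2 = (norm y)\<^sup>2 + (cmod \<zeta> * norm p)\<^sup>2"
      unfolding eq using norm_add_Pythagorean[of y "- (\<zeta> *\<^sub>C p)"] by (simp add: orthogonal_def)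
    have n2: "(norm u)\<^sup>2 = (norm x)\<^sup>2 + (norm p)\<^sup>2"
      using norm_add_Pythagorean[of x p] xN[OF p(1)] by (simp add: orthogonal_def x_def)
    have "\<kappa> * norm x \<le> norm (app A x - E *\<^sub>R x)" using \<kappa>(2)[OF xd] xN by blast
    also have "\<dots> \<le> norm y + cmod \<zeta> * norm x"
      using norm_triangle_ineq[of y "\<zeta> *\<^sub>C x"] by (simp add: y_def)
    finally have "(\<kappa> - cmod \<zeta>) * norm x \<le> norm y" by (simp add: algebra_simps)
    moreover have "cmod \<zeta> * norm x \<le> (\<kappa> - cmod \<zeta>) * norm x"
      using z by (intro mult_right_mono) (auto simp: \<zeta>_def)
    ultimately have "cmod \<zeta> * norm x \<le> norm y" by linarith
    then have "(cmod \<zeta> * norm x)\<^sup>2 \<le> (norm y)\<^sup>2" by (intro power_mono) auto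
    then have "(cmod \<zeta> * norm u)\<^sup>2 \<le> (norm (app A u - z *\<^sub>C u))\<^sup>2"
      unfolding n1 by (simp add: power_mult_distrib n2 distrib_left)
    then show ?thesis unfolding \<zeta>_def by (rule power2_le_imp_le) simp
  qed
  moreover have "complex_of_real E isolated_in spectrum A"
    unfolding isolated_in_dist_Ex_iff
  \<comment> \<open>Since \<open>E\<close> is real, \<open>cnj z\<close> is as close to it as
    \<open>z\<close>, so the estimate supplies both bounds that membership in the resolvent set
    requires.\<close>
  proof (intro conjI spec exI[of _ "\<kappa> / 2"] ballI impI)
    show "0 < \<kappa> / 2" using \<kappa>(1) by simp
    fix z assume z: "z \<in> spectrum A" "dist (complex_of_real E) z < \<kappa> / 2"
    show "z = complex_of_real E"
    proof (rule ccontr)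
      assume ne: "z \<noteq> complex_of_real E"
      have d: "cmod (z - of_real E) < \<kappa> / 2" using z(2) by (simp add: dist_norm norm_minus_commute)
      have cn: "cmod (cnj z - of_real E) = cmod (z - of_real E)"
        by (metis complex_cnj_complex_of_real complex_cnj_diff complex_mod_cnj)
      have "z \<in> resolvent_set A"
      proof (rule resolvent_setI)
        show "0 < cmod (z - of_real E)" using ne by simp
        show "cmod (z - of_real E) * norm u \<le> norm (app A u - cnj z *\<^sub>C u)" if "u \<in> dom A" for u
          using est[of "cnj z" u] d cn that by simp
      qed (rule est[OF d])
      then show False using z(1) by (simp add: spectrum_def)
    qed
  qed
  ultimately show ?thesis
    using eigenspace_finite_dimensional by (simp add: discrete_spectrum_def)
qed

end

lemma ess_spectrum_subset:
  assumes coercive: "\<And>c'. c' < c \<Longrightarrow> \<exists>F C. finite F \<and>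
      (\<forall>u\<in>dom A. c' * (norm u)\<^sup>2 - C * (\<Sum>w\<in>F. (w \<bullet> u)\<^sup>2) \<le> app A u \<bullet> u)"
  shows "ess_spectrum A \<subseteq> complex_of_real ` {c..}"
proof
  fix z assume z: "z \<in> ess_spectrum A"
  then have "z \<in> spectrum A" by (simp add: ess_spectrum_def)
  then have "Im z = 0" using nonreal_in_resolvent_set by (auto simp: spectrum_def)
  then have zE: "z = complex_of_real (Re z)" by (simp add: complex_eq_iff)
  have "c \<le> Re z"
  proof (rule ccontr)
    assume "\<not> c \<le> Re z"
    then obtain c' where c': "Re z < c'" "c' < c" using dense not_le by blast
    obtain F C where FC: "finite F" "\<And>u. u \<in> dom A \<Longrightarrow> c' * (norm u)\<^sup>2 - C * (\<Sum>w\<in>F. (w \<bullet> u)\<^sup>2) \<le> app A u \<bullet> u"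
      using coercive[OF c'(2)] by blast
    have "complex_of_real (Re z) \<in> discrete_spectrum A"
      using in_discrete_spectrum[OF c'(1) FC] \<open>z \<in> spectrum A\<close> zE by simp
    then show False using z zE by (simp add: ess_spectrum_def)
  qed
  then show "z \<in> complex_of_real ` {c..}" using zE by blast
qed

end

section \<open>Schroedinger operators\<close>

text \<open>Written with \<open>- complex_of_real t\<close> to match \<open>resolvent\<close> at the
  point \<open>- t\<close>, which inverts \<open>-\<Delta> + t\<close>.\<close>

lemma shifted_laplacian_bij:
  assumes "t > 0"
  shows "bij_betw (\<lambda>u. - laplacian u - (- complex_of_real t) *\<^sub>C u) H2 (UNIV :: 'a::euclidean_space L2 set)"
proof -
  have eq: "- laplacian u - (- complex_of_real t) *\<^sub>C u = t *\<^sub>R u - laplacian u" for u :: "'a L2"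
    by (simp add: L2.scale_minus_left scaleR_cscale)
  have "inj_on (\<lambda>u::'a L2. t *\<^sub>R u - laplacian u) H2"
  proof (rule inj_onI)
    fix u v :: "'a L2" assume uv: "u \<in> H2" "v \<in> H2" "t *\<^sub>R u - laplacian u = t *\<^sub>R v - laplacian v"
    have d: "u - v \<in> H2"
      using H2_add[OF uv(1) H2_cscale[OF uv(2), of "- 1"]] by (simp add: L2.scale_minus_left)
    have "t *\<^sub>R (u - v) - laplacian (u - v) = 0"
    proof -
      have "t *\<^sub>R (u - v) - laplacian (u - v) = (t *\<^sub>R u - laplacian u) - (t *\<^sub>R v - laplacian v)"
        using uv(1,2) by (simp add: laplacian_diff scaleR_diff_right)
      then show ?thesis using uv(3) by simp
    qed
    then have "t * norm (u - v) \<le> 0"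
      using norm_shifted_laplacian_ge(1)[OF d, of t] assms by simp
    then show "u = v" using assms by (simp add: mult_le_0_iff)
  qed
  moreover have "f \<in> (\<lambda>u::'a L2. t *\<^sub>R u - laplacian u) ` H2" for f
    by (rule shifted_laplacian_surj[OF assms, of f]) blast
  then have "(\<lambda>u::'a L2. t *\<^sub>R u - laplacian u) ` H2 = UNIV" by blast
  ultimately show ?thesis unfolding eq bij_betw_def by blast
qed

lemma resolvent_neg_laplacian:
  assumes t: "t > 0"
  defines "R \<equiv> resolvent neg_laplacian (- complex_of_real t)"
  shows "R f \<in> H2" "t *\<^sub>R R f - laplacian (R f) = f" "bounded_linear R"
    "norm (R f) \<le> norm f / t" "norm (laplacian (R f)) \<le> norm f"
proof -
  note bij = shifted_laplacian_bij[OF t]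
  have R_def': "R = inv_into H2 (\<lambda>u. - laplacian u - (- complex_of_real t) *\<^sub>C u)"
    by (simp add: R_def resolvent_def neg_laplacian_def)
  have R: "R f \<in> H2" "t *\<^sub>R R f - laplacian (R f) = f" for f
  proof -
    show "R f \<in> H2"
      unfolding R_def' using bij_betw_inv_into[OF bij] by (auto simp: bij_betw_def)
    have "- laplacian (R f) - (- complex_of_real t) *\<^sub>C R f = f"
      unfolding R_def' by (rule bij_betw_inv_into_right[OF bij UNIV_I])
    then show "t *\<^sub>R R f - laplacian (R f) = f"
      by (simp add: L2.scale_minus_left scaleR_cscale)
  qed
  have R_eq: "R f = u" if "u \<in> H2" "t *\<^sub>R u - laplacian u = f" for u f
    unfolding R_def' using bij_betw_inv_into_left[OF bij that(1)] that(2)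
    by (simp add: L2.scale_minus_left scaleR_cscale)
  show "R f \<in> H2" "t *\<^sub>R R f - laplacian (R f) = f" by (rule R)+
  have bound: "norm (R f) \<le> norm f / t" "norm (laplacian (R f)) \<le> norm f" for f
    using norm_shifted_laplacian_ge(1,2)[OF R(1)[of f], of t] t unfolding R(2)
    by (simp_all add: pos_le_divide_eq mult.commute)
  show "norm (R f) \<le> norm f / t" "norm (laplacian (R f)) \<le> norm f" by (rule bound)+
  show "bounded_linear R"
  proof
    show "R (f + g) = R f + R g" for f g
    proof (rule R_eq)
      show "t *\<^sub>R (R f + R g) - laplacian (R f + R g) = f + g"
      proof -
        have "t *\<^sub>R (R f + R g) - laplacian (R f + R g)
            = (t *\<^sub>R R f - laplacian (R f)) + (t *\<^sub>R R g - laplacian (R g))"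
          by (simp add: laplacian_add R(1) scaleR_add_right)
        then show ?thesis by (simp only: R(2))
      qed
    qed (intro H2_add R)
    show "R (r *\<^sub>R f) = r *\<^sub>R R f" for r f
    proof (rule R_eq)
      show "r *\<^sub>R R f \<in> H2" unfolding scaleR_cscale by (intro H2_cscale R)
      have "t *\<^sub>R r *\<^sub>R R f - laplacian (r *\<^sub>R R f) = r *\<^sub>R (t *\<^sub>R R f - laplacian (R f))"
        by (simp add: laplacian_scaleR R(1) scaleR_diff_right mult.commute)
      then show "t *\<^sub>R r *\<^sub>R R f - laplacian (r *\<^sub>R R f) = r *\<^sub>R f" by (simp only: R(2))
    qed
    show "\<exists>K. \<forall>f. norm (R f) \<le> norm f * K"
      using bound(1) by (intro exI[of _ "1 / t"]) simp
  qed
qed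

section \<open>Multiplication by the potential\<close>

context
  fixes V :: "'a::euclidean_space \<Rightarrow> real"
  assumes V [measurable]: "V \<in> borel_measurable lebesgue"
begin

text \<open>Representatives of sums and multiples agree with the pointwise operations only almost
  everywhere, so domain and value of \<open>mult_op V\<close> must be transferable along such
  equalities.\<close>

lemma mult_op_square_integrable_cong:
  assumes "square_integrable f" "AE x in lebesgue. f x = complex_of_real (V x) * rep_L2 u x"
  shows "u \<in> dom (mult_op V)" "app (mult_op V) u = abs_L2 f"
proof -
  have m: "(\<lambda>x. complex_of_real (V x) * rep_L2 u x) \<in> borel_measurable lebesgue"
    by (intro borel_measurable_times rep_L2_measurable) measurable
  have "integrable lebesgue (\<lambda>x. (cmod (f x))\<^sup>2)" using assms(1) by (simp add: square_integrable_def)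
  then have "integrable lebesgue (\<lambda>x. (cmod (complex_of_real (V x) * rep_L2 u x))\<^sup>2)"
    by (rule integrable_cong_AE_imp) (use assms(2) m in \<open>auto elim: eventually_mono\<close>)
  then have sq: "square_integrable (\<lambda>x. complex_of_real (V x) * rep_L2 u x)"
    using m by (simp add: square_integrable_def)
  then show "u \<in> dom (mult_op V)" by (simp add: mult_op_def)
  show "app (mult_op V) u = abs_L2 f"
    using abs_L2_eq_iff[OF sq assms(1)] assms(2) by (auto simp: mult_op_def elim: eventually_mono)
qed

lemma mult_op_square_integrable:
  "u \<in> dom (mult_op V) \<Longrightarrow> square_integrable (\<lambda>x. complex_of_real (V x) * rep_L2 u x)"
  by (simp add: mult_op_def)

lemma mult_op_add:
  assumes "u \<in> dom (mult_op V)" "v \<in> dom (mult_op V)"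
  shows "u + v \<in> dom (mult_op V)" "app (mult_op V) (u + v) = app (mult_op V) u + app (mult_op V) v"
proof -
  note sq = assms[THEN mult_op_square_integrable]
  have ae: "AE x in lebesgue. complex_of_real (V x) * rep_L2 u x + complex_of_real (V x) * rep_L2 v x
      = complex_of_real (V x) * rep_L2 (u + v) x"
    using rep_L2_add[of u v] by eventually_elim (simp add: distrib_left)
  from mult_op_square_integrable_cong[OF square_integrable_add[OF sq] ae]
  show "u + v \<in> dom (mult_op V)" "app (mult_op V) (u + v) = app (mult_op V) u + app (mult_op V) v"
    using sq by (simp_all add: abs_L2_add[symmetric] mult_op_def)
qed

lemma mult_op_cscale:
  assumes "u \<in> dom (mult_op V)"
  shows "c *\<^sub>C u \<in> dom (mult_op V)" "app (mult_op V) (c *\<^sub>C u) = c *\<^sub>C app (mult_op V) u"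
proof -
  note sq = assms[THEN mult_op_square_integrable]
  have ae: "AE x in lebesgue. c * (complex_of_real (V x) * rep_L2 u x) = complex_of_real (V x) * rep_L2 (c *\<^sub>C u) x"
    using rep_L2_cscale[of c u] by eventually_elim simp
  from mult_op_square_integrable_cong[OF square_integrable_mult[OF sq] ae]
  show "c *\<^sub>C u \<in> dom (mult_op V)" "app (mult_op V) (c *\<^sub>C u) = c *\<^sub>C app (mult_op V) u"
    using sq by (simp_all add: abs_L2_cscale[symmetric] mult_op_def)
qed

lemma inner_mult_op:
  assumes "u \<in> dom (mult_op V)"
  shows "app (mult_op V) u \<bullet> v = (\<integral>x. V x * (rep_L2 u x \<bullet> rep_L2 v x) \<partial>lebesgue)"
    and "integrable lebesgue (\<lambda>x. V x * (rep_L2 u x \<bullet> rep_L2 v x))"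
proof -
  note sq = assms[THEN mult_op_square_integrable]
  have eq: "(complex_of_real (V x) * rep_L2 u x) \<bullet> rep_L2 v x = V x * (rep_L2 u x \<bullet> rep_L2 v x)" for x
    by (simp add: inner_complex_def algebra_simps)
  show "app (mult_op V) u \<bullet> v = (\<integral>x. V x * (rep_L2 u x \<bullet> rep_L2 v x) \<partial>lebesgue)"
    using inner_abs_L2_left[OF sq, of v] by (simp add: mult_op_def eq)
  show "integrable lebesgue (\<lambda>x. V x * (rep_L2 u x \<bullet> rep_L2 v x))"
    using integrable_inner_L2[OF sq rep_L2_square_integrable, of v] by (simp add: eq)
qed

lemma mult_op_symmetric:
  "u \<in> dom (mult_op V) \<Longrightarrow> v \<in> dom (mult_op V) \<Longrightarrow> app (mult_op V) u \<bullet> v = u \<bullet> app (mult_op V) v"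
  using inner_mult_op(1)[of u v] inner_mult_op(1)[of v u] by (simp add: inner_commute)

text \<open>Serves twice: with \<open>S\<close> empty it gives semiboundedness, and with
  \<open>S\<close> the sublevel set it isolates the region where the potential may lie below
  \<open>c\<close>.\<close>

lemma mult_op_lower_bound:
  assumes u: "u \<in> dom (mult_op V)" and S: "S \<in> sets lebesgue"
    and le: "\<And>x. c - G * indicator S x \<le> V x"
  shows "c * (norm u)\<^sup>2 - G * (\<integral>x. indicator S x * (cmod (rep_L2 u x))\<^sup>2 \<partial>lebesgue) \<le> app (mult_op V) u \<bullet> u"
proof -
  have iS: "integrable lebesgue (\<lambda>x. indicator S x * (cmod (rep_L2 u x))\<^sup>2)"
    using integrable_real_mult_indicator[OF S rep_L2_integrable[of u]] by (simp add: mult.commute)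
  have "c * (norm u)\<^sup>2 - G * (\<integral>x. indicator S x * (cmod (rep_L2 u x))\<^sup>2 \<partial>lebesgue)
      = (\<integral>x. c * (cmod (rep_L2 u x))\<^sup>2 - G * (indicator S x * (cmod (rep_L2 u x))\<^sup>2) \<partial>lebesgue)"
    using iS rep_L2_integrable[of u] by (simp add: power2_norm_L2)
  also have "\<dots> \<le> (\<integral>x. V x * (rep_L2 u x \<bullet> rep_L2 u x) \<partial>lebesgue)"
  proof (rule integral_mono)
    show "integrable lebesgue (\<lambda>x. c * (cmod (rep_L2 u x))\<^sup>2 - G * (indicator S x * (cmod (rep_L2 u x))\<^sup>2))"
      by (intro Bochner_Integration.integrable_diff integrable_mult_right iS rep_L2_integrable)
    fix x
    show "c * (cmod (rep_L2 u x))\<^sup>2 - G * (indicator S x * (cmod (rep_L2 u x))\<^sup>2) \<le> V x * (rep_L2 u x \<bullet> rep_L2 u x)"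
      using mult_right_mono[OF le[of x], of "(cmod (rep_L2 u x))\<^sup>2"]
      by (simp add: power2_norm_eq_inner left_diff_distrib mult.assoc)
  qed (rule inner_mult_op(2)[OF u])
  finally show ?thesis by (simp add: inner_mult_op(1)[OF u])
qed

text \<open>The Kato--Rellich argument: \<open>-\<Delta> + V + t = (1 + V R)(-\<Delta> + t)\<close>, where \<open>V R\<close> is a
  strict contraction.\<close>

lemma shifted_schroedinger_surj:
  fixes f :: "'a L2"
  assumes rel: "relatively_bounded neg_laplacian (mult_op V)"
    and t: "t > 0"
    and q: "onorm (\<lambda>f. app (mult_op V) (resolvent neg_laplacian (- complex_of_real t) f)) < 1"
  shows "\<exists>u\<in>H2. - laplacian u + app (mult_op V) u + t *\<^sub>R u = f"
proof -
  define R :: "'a L2 \<Rightarrow> 'a L2" where "R = resolvent neg_laplacian (- complex_of_real t)"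
  note R = resolvent_neg_laplacian[OF t, where 'a = 'a, folded R_def]
  have domV: "H2 \<subseteq> dom (mult_op V)"
    and "\<exists>a\<ge>0. \<exists>b\<ge>0. \<forall>u\<in>H2. norm (app (mult_op V) u) \<le> a * norm (laplacian u) + b * norm u"
    using rel by (simp_all add: relatively_bounded_def neg_laplacian_def)
  then obtain a b where ab: "a \<ge> 0" "b \<ge> 0"
    "\<And>u. u \<in> H2 \<Longrightarrow> norm (app (mult_op V) u) \<le> a * norm (laplacian u) + b * norm u"
    by blast
  define S where "S g = app (mult_op V) (R g)" for g
  have dR: "R g \<in> dom (mult_op V)" for g by (rule subsetD[OF domV R(1)])
  have S: "bounded_linear S"
  \<comment> \<open>\<open>onorm\<close> acts as the operator norm only for a bounded linear map;
    relative boundedness, together with the resolvent bounds for \<open>R\<close>, supplies this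
    before the hypothesis on \<open>onorm\<close> is used.\<close>
  proof
    show "S (g + h) = S g + S h" for g h
      unfolding S_def linear_add[OF bounded_linear.linear[OF R(3)]] by (rule mult_op_add(2)[OF dR dR])
    show "S (r *\<^sub>R g) = r *\<^sub>R S g" for r g
      unfolding S_def linear_scale[OF bounded_linear.linear[OF R(3)]] unfolding scaleR_cscale
      by (rule mult_op_cscale(2)[OF dR])
    show "\<exists>K. \<forall>g. norm (S g) \<le> norm g * K"
    proof (intro exI allI)
      fix g
      have "norm (S g) \<le> a * norm (laplacian (R g)) + b * norm (R g)"
        unfolding S_def by (rule ab(3)[OF R(1)])
      also have "\<dots> \<le> a * norm g + b * (norm g / t)"
        using ab(1,2) by (intro add_mono mult_left_mono R)
      also have "\<dots> = norm g * (a + b / t)" by (simp add: algebra_simps)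
      finally show "norm (S g) \<le> norm g * (a + b / t)" .
    qed
  qed
  have q': "0 \<le> onorm S" "onorm S < 1"
    using q onorm_pos_le[OF S] by (simp_all add: S_def[abs_def] R_def)
  \<comment> \<open>The Neumann series in the form of Banach's fixed point theorem: the equation
    says \<open>g + S g = f\<close>, and then \<open>R g\<close> is the solution sought.\<close>
  have "\<exists>!g. f - S g = g"
  proof (rule banach_fix_type[OF q'], intro allI)
    show "dist (f - S x) (f - S y) \<le> onorm S * dist x y" for x y
      using onorm[OF S, of "y - x"]
      by (simp add: dist_norm linear_diff[OF bounded_linear.linear[OF S]] norm_minus_commute)
  qed
  then obtain g where g: "f - S g = g" by blast
  have "- laplacian (R g) + app (mult_op V) (R g) + t *\<^sub>R R g = (t *\<^sub>R R g - laplacian (R g)) + S g"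
    by (simp add: S_def)
  also have "\<dots> = f" unfolding R(2) using g by (simp add: diff_eq_eq)
  finally show ?thesis using R(1) by blast
qed

lemma schroedinger_self_adjoint:
  assumes bdd: "bdd_below (range V)"
    and rel: "relatively_bounded neg_laplacian (mult_op V)"
    and lim: "\<exists>L<1. ((\<lambda>t. onorm (\<lambda>f. app (mult_op V) (resolvent neg_laplacian (- complex_of_real t) f)))
        \<longlongrightarrow> L) at_top"
  shows "\<exists>t. self_adjoint_operator (schroedinger V) t 1"
proof -
  have domV: "H2 \<subseteq> dom (mult_op V)"
    using rel by (simp add: relatively_bounded_def neg_laplacian_def)
  then have dom: "dom (schroedinger V) = H2"
    by (auto simp: schroedinger_def op_add_def neg_laplacian_def)
  have app: "app (schroedinger V) u = - laplacian u + app (mult_op V) u" for u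
    by (simp add: schroedinger_def op_add_def neg_laplacian_def)
  obtain M where M: "\<And>x. M \<le> V x" using bdd by (auto simp: bdd_below_def)
  obtain L where L: "L < 1" "((\<lambda>t. onorm (\<lambda>f. app (mult_op V) (resolvent neg_laplacian (- complex_of_real t) f)))
        \<longlongrightarrow> L) at_top" using lim by blast
  have "\<forall>\<^sub>F t in at_top. onorm (\<lambda>f. app (mult_op V) (resolvent neg_laplacian (- complex_of_real t) f)) < 1
      \<and> t > 0 \<and> t > 1 - M"
    using order_tendstoD(2)[OF L(2,1)] by (intro eventually_conj eventually_gt_at_top)
  \<comment> \<open>Two conditions on one \<open>t\<close>: the norm bound serves surjectivity of
    \<open>H + t\<close>, and \<open>t > 1 - M\<close> makes its form at least
    \<open>(norm u)\<^sup>2\<close>.\<close>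
  then obtain t where t: "onorm (\<lambda>f. app (mult_op V) (resolvent neg_laplacian (- complex_of_real t) f)) < 1"
    "t > 0" "t > 1 - M" by (auto dest: eventually_happens)
  have "self_adjoint_operator (schroedinger V) t 1"
  proof (unfold_locales, unfold dom)
    fix u v :: "'a L2" and c :: complex
    show "u + v \<in> H2" if "u \<in> H2" "v \<in> H2" using that by (rule H2_add)
    show "c *\<^sub>C u \<in> H2" if "u \<in> H2" using that by (rule H2_cscale)
    show "0 \<in> (H2 :: 'a L2 set)" by (rule H2_0)
    show "app (schroedinger V) (u + v) = app (schroedinger V) u + app (schroedinger V) v" if "u \<in> H2" "v \<in> H2"
      using that domV by (simp add: app laplacian_add mult_op_add subset_iff)
    show "app (schroedinger V) (c *\<^sub>C u) = c *\<^sub>C app (schroedinger V) u" if "u \<in> H2"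
      using that domV by (simp add: app laplacian_cscale mult_op_cscale subset_iff L2.scale_right_distrib
          L2.scale_minus_right L2.scale_right_diff_distrib)
    show "app (schroedinger V) u \<bullet> v = u \<bullet> app (schroedinger V) v" if "u \<in> H2" "v \<in> H2"
    proof -
      have "laplacian u \<bullet> v = u \<bullet> laplacian v" "app (mult_op V) u \<bullet> v = u \<bullet> app (mult_op V) v"
        using that domV by (auto intro: laplacian_symmetric mult_op_symmetric)
      then show ?thesis by (simp add: app inner_diff_left inner_diff_right)
    qed
    show "\<exists>u\<in>H2. app (schroedinger V) u + t *\<^sub>R u = u'" for u' :: "'a L2"
      unfolding app using shifted_schroedinger_surj[OF rel t(2,1)] .
    show "1 * norm u \<le> norm (app (schroedinger V) u + t *\<^sub>R u)" if u: "u \<in> H2"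
    proof -
      have "M * (norm u)\<^sup>2 \<le> app (mult_op V) u \<bullet> u"
        using mult_op_lower_bound[of u "{}" M 0] u domV M by auto
      moreover have "laplacian u \<bullet> u \<le> 0"
        using inner_laplacian[OF u H2_H1[OF u]] by (simp add: sum_nonneg)
      moreover have "(1 - t) * (norm u)\<^sup>2 \<le> M * (norm u)\<^sup>2"
        using t(3) by (intro mult_right_mono) auto
      ultimately have "(norm u)\<^sup>2 \<le> (app (schroedinger V) u + t *\<^sub>R u) \<bullet> u"
        by (simp add: app inner_add_left power2_norm_eq_inner algebra_simps)
      also have "\<dots> \<le> norm (app (schroedinger V) u + t *\<^sub>R u) * norm u"
        by (rule norm_cauchy_schwarz)
      finally show ?thesis
        by (cases "norm u = 0") (auto simp: power2_eq_square mult_le_cancel_right)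
    qed
  qed simp_all
  then show ?thesis ..
qed

text \<open>Below \<open>c\<close> the potential is worth at most \<open>G\<close> on a set of
  finite measure. The compactness estimate trades this loss for a finite-rank form plus errors that
  the kinetic energy and the gap \<open>c - c'\<close> can pay for.\<close>

lemma schroedinger_coercive:
  assumes bdd: "bdd_below (range V)"
    and rel: "relatively_bounded neg_laplacian (mult_op V)"
    and fin: "emeasure lebesgue {x. V x \<le> c} < \<infinity>" and c': "c' < c"
  shows "\<exists>F C. finite F \<and> (\<forall>u\<in>dom (schroedinger V).
    c' * (norm u)\<^sup>2 - C * (\<Sum>w\<in>F. (w \<bullet> u)\<^sup>2) \<le> app (schroedinger V) u \<bullet> u)"
proof -
  have domV: "H2 \<subseteq> dom (mult_op V)"
    using rel by (simp add: relatively_bounded_def neg_laplacian_def)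
  let ?S = "{x. V x \<le> c}"
  have S: "?S \<in> sets lebesgue"
    using borel_measurable_le[OF V borel_measurable_const[of c]] by simp
  obtain M where M: "\<And>x. M \<le> V x" using bdd by (auto simp: bdd_below_def)
  \<comment> \<open>The absolute value keeps \<open>G\<close> nonnegative when \<open>M\<close>
    exceeds \<open>c\<close>; in that case the sublevel set is empty.\<close>
  define G where "G = \<bar>c - M\<bar>"
  have V_ge: "c - G * indicator ?S x \<le> V x" for x
    using M[of x] by (auto simp: G_def indicator_def)
  \<comment> \<open>Ensures \<open>G * \<epsilon> \<le> 1\<close>, so the gradient error fits into
    the kinetic energy, and \<open>G * \<epsilon> \<le> c - c'\<close>, so the remaining error fits
    into the gap. The denominator is \<open>G + 1\<close> because \<open>G\<close> may
    vanish.\<close>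
  define \<epsilon> where "\<epsilon> = min 1 (c - c') / (G + 1)"
  have G: "G \<ge> 0" "G + 1 > 0" by (simp_all add: G_def add_nonneg_pos)
  have \<epsilon>: "\<epsilon> > 0" using c' G by (simp add: \<epsilon>_def)
  have "G * \<epsilon> \<le> (G + 1) * \<epsilon>" using \<epsilon> by (intro mult_right_mono) auto
  then have G\<epsilon>: "G * \<epsilon> \<le> 1" "G * \<epsilon> \<le> c - c'" using G by (simp_all add: \<epsilon>_def)
  obtain F C where F: "finite F" "C \<ge> 0" "\<And>u. u \<in> H1 \<Longrightarrow> (\<integral>x. indicator ?S x * (cmod (rep_L2 u x))\<^sup>2 \<partial>lebesgue)
      \<le> \<epsilon> * ((norm u)\<^sup>2 + (\<Sum>b\<in>Basis. (norm (weak_deriv b u))\<^sup>2)) + C * (\<Sum>w\<in>F. (w \<bullet> u)\<^sup>2)"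
    using compactness_on_finite_measure[OF S fin \<epsilon>] by blast
  have "c' * (norm u)\<^sup>2 - (G * C) * (\<Sum>w\<in>F. (w \<bullet> u)\<^sup>2) \<le> app (schroedinger V) u \<bullet> u"
    if "u \<in> dom (schroedinger V)" for u
  proof -
    have u: "u \<in> H2" using that by (simp add: schroedinger_def op_add_def neg_laplacian_def)
    define D where "D = (\<Sum>b\<in>Basis. (norm (weak_deriv b u))\<^sup>2)"
    define \<Sigma> where "\<Sigma> = (\<Sum>w\<in>F. (w \<bullet> u)\<^sup>2)"
    have D: "0 \<le> D" by (simp add: D_def sum_nonneg)
    have "app (schroedinger V) u \<bullet> u = D + app (mult_op V) u \<bullet> u"
      using inner_laplacian[OF u H2_H1[OF u]]
      by (simp add: schroedinger_def op_add_def neg_laplacian_def inner_diff_left D_def power2_norm_eq_inner)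
    moreover have "c * (norm u)\<^sup>2 - G * (\<integral>x. indicator ?S x * (cmod (rep_L2 u x))\<^sup>2 \<partial>lebesgue) \<le> app (mult_op V) u \<bullet> u"
      using u domV V_ge by (intro mult_op_lower_bound S) auto
    moreover have "G * (\<integral>x. indicator ?S x * (cmod (rep_L2 u x))\<^sup>2 \<partial>lebesgue) \<le> G * (\<epsilon> * ((norm u)\<^sup>2 + D) + C * \<Sigma>)"
      using F(3)[OF H2_H1[OF u]] G by (intro mult_left_mono) (simp_all add: D_def \<Sigma>_def)
    moreover have "G * (\<epsilon> * ((norm u)\<^sup>2 + D) + C * \<Sigma>) = (G * \<epsilon>) * (norm u)\<^sup>2 + (G * \<epsilon>) * D + (G * C) * \<Sigma>"
      by (simp add: algebra_simps)
    moreover have "(G * \<epsilon>) * (norm u)\<^sup>2 \<le> (c - c') * (norm u)\<^sup>2" "(G * \<epsilon>) * D \<le> 1 * D"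
      by (rule mult_right_mono[OF G\<epsilon>(2)], simp) (rule mult_right_mono[OF G\<epsilon>(1) D])
    moreover have "(c - c') * (norm u)\<^sup>2 = c * (norm u)\<^sup>2 - c' * (norm u)\<^sup>2" by (rule left_diff_distrib)
    ultimately show ?thesis unfolding \<Sigma>_def[symmetric] by linarith
  qed
  then show ?thesis using F(1) by blast
qed

end

theorem proposition3p1:
  fixes V :: "real ^ 'n \<Rightarrow> real" and E0 \<delta> :: real
  assumes "V \<in> borel_measurable lebesgue"
    and "bdd_below (range V)"
    and "relatively_bounded neg_laplacian (mult_op V)"
    and "\<exists>L<1. ((\<lambda>t. onorm (\<lambda>f. app (mult_op V) (resolvent neg_laplacian (- complex_of_real t) f)))
                 \<longlongrightarrow> L) at_top"
    and "\<delta> > 0"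
    and "emeasure lebesgue {x. V x \<le> E0 + \<delta>} < \<infinity>"
  shows "ess_spectrum (schroedinger V) \<subseteq> complex_of_real ` {E0 + \<delta>..}"
proof -
  obtain t where "self_adjoint_operator (schroedinger V) t 1"
    using schroedinger_self_adjoint[OF assms(1-4)] by blast
  then show ?thesis
    by (rule self_adjoint_operator.ess_spectrum_subset)
       (rule schroedinger_coercive[OF assms(1-3,6)])
qed

end
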